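(* Let $U,X,Y$ be Hilbert spaces and let $(G,L,K)$ be a scattering passive boundary node on the spaces $(U,X,Y)$. Consider the LQ optimal control problem of minimizing $J(x_0,u)=\int_0^\infty\|u(t)\|_U^2+\|y(t)\|_Y^2\,\mathrm{d}t$ subject to $\dot x(t)=Lx(t)$, $Gx(t)=u(t)$, $y(t)=Kx(t)$, $t\ge0$, $x(0)=x_0$. Then the finite cost condition is satisfied and the optimal cost operator $\Pi$ satisfies $\Pi\le I$. In addition, if $(G,L,K)$ is scattering energy preserving and if the semigroup generated by $L_{|\ker(G)}$ is strongly stable, then $\Pi=I$ and the optimal control is given by $u^{\mathrm{opt}}(t)=0$, $t\ge0$. Moreover, $\Pi=I$ satisfies the boundary node Riccati equation $$\langle Lx,\Pi x\rangle_X+\langle \Pi x,Lx\rangle_X+\|Gx\|_U^2+\|Kx\|_Y^2=\|Nx\|_U^2,\qquad x\in D(L),$$ with $N:D(L)\to U$, $Nx=\sqrt{2}\,Gx$.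
   Context: Boundary node: for Hilbert spaces $U,X,Y$, a triple $(G,L,K)$ is a boundary node on $(U,X,Y)$ if $L:D(L)\subset X\to X$ is linear, $G\in\mathcal{L}(D(L),U)$, $K\in\mathcal{L}(D(L),Y)$ ($D(L)$ carrying the graph norm of $L$), and (i) $A:=L_{|\ker(G)}$ with $D(A)=\ker(G)$ generates a strongly continuous semigroup on $X$; (ii) $G$ has a bounded right inverse $G^r\in\mathcal{L}(U,D(L))$, $GG^r=I$. Scattering passive: $2\,\mathrm{Re}\,\langle Lx,x\rangle_X\le\|Gx\|_U^2-\|Kx\|_Y^2$ for all $x\in D(L)$; scattering energy preserving: equality for all $x\in D(L)$. Solutions: a classical solution $(x,u,y)$ on $[0,\infty)$ has $x\in C^1([0,\infty);X)$, $x(t)\in D(L)$, $u\in C([0,\infty);U)$, $y\in C([0,\infty);Y)$ and satisfies $\dot x=Lx$, $Gx=u$, $Kx=y$ for all $t\ge0$. A generalized solution is $(x,u,y)$ with $x\in C([0,\infty);X)$, $u\in L^2_{\mathrm{loc}}(0,\infty;U)$, $y\in L^2_{\mathrm{loc}}(0,\infty;Y)$ which is a limit of classical solutions $(x_k,u_k,y_k)$, with $x_k\to x$ uniformly on bounded intervals and $u_k\to u$, $y_k\to y$ in $L^2$ on every $[0,\tau]$. (These are the solutions of the associated system node $S=\begin{bmatrix}L\\ K\end{bmatrix}\begin{bmatrix}I\\ G\end{bmatrix}^{-1}$, $D(S)=\{(x,Gx)^\top:x\in D(L)\}$.) The cost is evaluated along generalized solutions with $x(0)=x_0\in X$. A semigroup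 $\mathbb{T}$ is strongly stable if $\|\mathbb{T}_tx_0\|\to0$ as $t\to\infty$ for every $x_0\in X$. Finite cost condition: for every $x_0\in X$ there is at least one input $u$ with $J(x_0,u)<\infty$. Optimal cost operator: the operator $\Pi=\Pi^*\in\mathcal{L}(X)$ with $\langle x_0,\Pi x_0\rangle_X=\inf_{u\in L^2(0,\infty;U)}J(x_0,u)$ for all $x_0\in X$; $\Pi\le I$ means $\langle x_0,\Pi x_0\rangle_X\le\|x_0\|_X^2$ for all $x_0\in X$. *)

theory Defs
  imports "HOL-Analysis.Analysis"
begin

(* Complex Hilbert spaces, not necessarily separable.  The underlying real Hilbert space structure
   (norm, topology, derivatives) is that of real_inner and banach; its real inner product is the
   real part of the complex one.  The complex inner product is linear in the first argument. *)

class complex_hilbert = real_inner + banach +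
  fixes scaleC :: "complex \<Rightarrow> 'a \<Rightarrow> 'a"  (infixr "*\<^sub>C" 75)
    and cinner :: "'a \<Rightarrow> 'a \<Rightarrow> complex"
  assumes scaleC_add_right: "a *\<^sub>C (x + y) = a *\<^sub>C x + a *\<^sub>C y"
    and scaleC_add_left: "(a + b) *\<^sub>C x = a *\<^sub>C x + b *\<^sub>C x"
    and scaleC_scaleC: "a *\<^sub>C (b *\<^sub>C x) = (a * b) *\<^sub>C x"
    and scaleR_scaleC: "r *\<^sub>R x = complex_of_real r *\<^sub>C x"
    and cinner_commute: "cinner x y = cnj (cinner y x)"
    and cinner_add_left: "cinner (x + y) z = cinner x z + cinner y z"
    and cinner_scaleC_left: "cinner (a *\<^sub>C x) y = a * cinner x y"
    and inner_eq_Re_cinner: "inner x y = Re (cinner x y)"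

lemma cinner_self: "cinner x x = complex_of_real ((norm x)\<^sup>2)"
proof -
  have "Im (cinner x x) = 0"
    using arg_cong[OF cinner_commute[of x x], of Im] by simp
  then show ?thesis
    by (simp add: complex_eq_iff power2_norm_eq_inner inner_eq_Re_cinner)
qed

instantiation complex :: complex_hilbert
begin

definition scaleC_complex :: "complex \<Rightarrow> complex \<Rightarrow> complex"
  where "scaleC_complex a x = a * x"

definition cinner_complex :: "complex \<Rightarrow> complex \<Rightarrow> complex"
  where "cinner_complex x y = x * cnj y"

instance
  by standard
    (auto simp: scaleC_complex_def cinner_complex_def algebra_simps scaleR_conv_of_real
      inner_complex_def)

end

definition csubspace :: "'a::complex_hilbert set \<Rightarrow> bool" where
  "csubspace S \<longleftrightarrow> 0 \<in> S \<and> (\<forall>x\<in>S. \<forall>y\<in>S. x + y \<in> S) \<and> (\<forall>c. \<forall>x\<in>S. c *\<^sub>C x \<in> S)"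

definition clinear_on :: "'a::complex_hilbert set \<Rightarrow> ('a \<Rightarrow> 'b::complex_hilbert) \<Rightarrow> bool" where
  "clinear_on S f \<longleftrightarrow>
     (\<forall>x\<in>S. \<forall>y\<in>S. f (x + y) = f x + f y) \<and> (\<forall>c. \<forall>x\<in>S. f (c *\<^sub>C x) = c *\<^sub>C f x)"

definition bounded_clinear :: "('a::complex_hilbert \<Rightarrow> 'b::complex_hilbert) \<Rightarrow> bool" where
  "bounded_clinear f \<longleftrightarrow> clinear_on UNIV f \<and> (\<exists>C. \<forall>x. norm (f x) \<le> C * norm x)"

definition C0_semigroup :: "(real \<Rightarrow> 'x::complex_hilbert \<Rightarrow> 'x) \<Rightarrow> bool" where
  "C0_semigroup T \<longleftrightarrow>
     (\<forall>t\<ge>0. bounded_clinear (T t)) \<and>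
     (\<forall>x. T 0 x = x) \<and>
     (\<forall>s\<ge>0. \<forall>t\<ge>0. \<forall>x. T (s + t) x = T s (T t x)) \<and>
     (\<forall>x. ((\<lambda>t. T t x) \<longlongrightarrow> x) (at_right 0))"

(* The restriction of A to the set S, as an operator with domain exactly S, is the generator of T. *)

definition generates_semigroup ::
  "'x::complex_hilbert set \<Rightarrow> ('x \<Rightarrow> 'x) \<Rightarrow> (real \<Rightarrow> 'x \<Rightarrow> 'x) \<Rightarrow> bool" where
  "generates_semigroup S A T \<longleftrightarrow>
     C0_semigroup T \<and>
     (\<forall>x z. ((\<lambda>h. (T h x - x) /\<^sub>R h) \<longlongrightarrow> z) (at_right 0) \<longleftrightarrow> x \<in> S \<and> A x = z)"

definition strongly_stable :: "(real \<Rightarrow> 'x::complex_hilbert \<Rightarrow> 'x) \<Rightarrow> bool" where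
  "strongly_stable T \<longleftrightarrow> (\<forall>x. ((\<lambda>t. norm (T t x)) \<longlongrightarrow> 0) at_top)"

definition graph_norm :: "('x::complex_hilbert \<Rightarrow> 'x) \<Rightarrow> 'x \<Rightarrow> real" where
  "graph_norm L x = sqrt ((norm x)\<^sup>2 + (norm (L x))\<^sup>2)"

definition graph_bounded_clinear ::
  "'x::complex_hilbert set \<Rightarrow> ('x \<Rightarrow> 'x) \<Rightarrow> ('x \<Rightarrow> 'b::complex_hilbert) \<Rightarrow> bool" where
  "graph_bounded_clinear D L F \<longleftrightarrow>
     clinear_on D F \<and> (\<exists>C. \<forall>x\<in>D. norm (F x) \<le> C * graph_norm L x)"

(* The partially defined operators L, G, K are represented by total functions together with their
   common domain D = D(L); their values outside D are never used. *)

definition boundary_node ::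
  "'x::complex_hilbert set \<Rightarrow> ('x \<Rightarrow> 'u::complex_hilbert) \<Rightarrow> ('x \<Rightarrow> 'x) \<Rightarrow>
     ('x \<Rightarrow> 'y::complex_hilbert) \<Rightarrow> bool" where
  "boundary_node D G L K \<longleftrightarrow>
     csubspace D \<and> clinear_on D L \<and>
     graph_bounded_clinear D L G \<and> graph_bounded_clinear D L K \<and>
     (\<exists>T. generates_semigroup {x\<in>D. G x = 0} L T) \<and>
     (\<exists>Gr. clinear_on UNIV Gr \<and> (\<forall>v. Gr v \<in> D) \<and>
           (\<exists>C. \<forall>v. graph_norm L (Gr v) \<le> C * norm v) \<and> (\<forall>v. G (Gr v) = v))"

definition scattering_passive ::
  "'x::complex_hilbert set \<Rightarrow> ('x \<Rightarrow> 'u::complex_hilbert) \<Rightarrow> ('x \<Rightarrow> 'x) \<Rightarrow>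
     ('x \<Rightarrow> 'y::complex_hilbert) \<Rightarrow> bool" where
  "scattering_passive D G L K \<longleftrightarrow>
     (\<forall>x\<in>D. 2 * Re (cinner (L x) x) \<le> (norm (G x))\<^sup>2 - (norm (K x))\<^sup>2)"

definition scattering_energy_preserving ::
  "'x::complex_hilbert set \<Rightarrow> ('x \<Rightarrow> 'u::complex_hilbert) \<Rightarrow> ('x \<Rightarrow> 'x) \<Rightarrow>
     ('x \<Rightarrow> 'y::complex_hilbert) \<Rightarrow> bool" where
  "scattering_energy_preserving D G L K \<longleftrightarrow>
     (\<forall>x\<in>D. 2 * Re (cinner (L x) x) = (norm (G x))\<^sup>2 - (norm (K x))\<^sup>2)"

(* Bochner measurability: the values may lie in a non-separable space, where Borel measurability
   would not be the right notion. *)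

definition strongly_measurable :: "'a measure \<Rightarrow> ('a \<Rightarrow> 'b::topological_space) \<Rightarrow> bool" where
  "strongly_measurable M f \<longleftrightarrow>
     (\<exists>s. (\<forall>i::nat. simple_function M (s i)) \<and> (AE t in M. (\<lambda>i. s i t) \<longlonglongrightarrow> f t))"

definition L2_on :: "real set \<Rightarrow> (real \<Rightarrow> 'b::real_normed_vector) \<Rightarrow> bool" where
  "L2_on S f \<longleftrightarrow>
     strongly_measurable (lebesgue_on S) f \<and>
     (\<integral>\<^sup>+ t. ennreal ((norm (f t))\<^sup>2) \<partial>lebesgue_on S) < \<infinity>"

definition L2_loc :: "(real \<Rightarrow> 'b::real_normed_vector) \<Rightarrow> bool" where
  "L2_loc f \<longleftrightarrow> (\<forall>\<tau>>0. L2_on {0..\<tau>} f)"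

definition classical_solution ::
  "'x::complex_hilbert set \<Rightarrow> ('x \<Rightarrow> 'u::complex_hilbert) \<Rightarrow> ('x \<Rightarrow> 'x) \<Rightarrow>
     ('x \<Rightarrow> 'y::complex_hilbert) \<Rightarrow> (real \<Rightarrow> 'x) \<Rightarrow> (real \<Rightarrow> 'u) \<Rightarrow> (real \<Rightarrow> 'y) \<Rightarrow> bool" where
  "classical_solution D G L K x u y \<longleftrightarrow>
     (\<exists>x'. continuous_on {0..} x' \<and>
        (\<forall>t\<ge>0. (x has_vector_derivative x' t) (at t within {0..}) \<and> x' t = L (x t))) \<and>
     continuous_on {0..} u \<and> continuous_on {0..} y \<and>
     (\<forall>t\<ge>0. x t \<in> D \<and> G (x t) = u t \<and> K (x t) = y t)"

definition generalized_solution ::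
  "'x::complex_hilbert set \<Rightarrow> ('x \<Rightarrow> 'u::complex_hilbert) \<Rightarrow> ('x \<Rightarrow> 'x) \<Rightarrow>
     ('x \<Rightarrow> 'y::complex_hilbert) \<Rightarrow> (real \<Rightarrow> 'x) \<Rightarrow> (real \<Rightarrow> 'u) \<Rightarrow> (real \<Rightarrow> 'y) \<Rightarrow> bool" where
  "generalized_solution D G L K x u y \<longleftrightarrow>
     continuous_on {0..} x \<and> L2_loc u \<and> L2_loc y \<and>
     (\<exists>xs us ys.
        (\<forall>k::nat. classical_solution D G L K (xs k) (us k) (ys k)) \<and>
        (\<forall>\<tau>>0. uniform_limit {0..\<tau>} xs x sequentially \<and>
           (\<lambda>k. \<integral>\<^sup>+ t. ennreal ((norm (us k t - u t))\<^sup>2) \<partial>lebesgue_on {0..\<tau>}) \<longlonglongrightarrow> 0 \<and>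
           (\<lambda>k. \<integral>\<^sup>+ t. ennreal ((norm (ys k t - y t))\<^sup>2) \<partial>lebesgue_on {0..\<tau>}) \<longlonglongrightarrow> 0))"

(* J x0 u.  For a boundary node, a generalized solution is determined (x everywhere, y almost
   everywhere on [0,infinity)) by x0 and u, so the infimum is over at most one value; it selects the
   cost along that solution, and is infinite when u admits no generalized solution from x0. *)

definition cost ::
  "'x::complex_hilbert set \<Rightarrow> ('x \<Rightarrow> 'u::complex_hilbert) \<Rightarrow> ('x \<Rightarrow> 'x) \<Rightarrow>
     ('x \<Rightarrow> 'y::complex_hilbert) \<Rightarrow> 'x \<Rightarrow> (real \<Rightarrow> 'u) \<Rightarrow> ennreal" where
  "cost D G L K x0 u =
     Inf {\<integral>\<^sup>+ t. ennreal ((norm (u t))\<^sup>2 + (norm (y t))\<^sup>2) \<partial>lebesgue_on {0..} | x y.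
            generalized_solution D G L K x u y \<and> x 0 = x0}"

definition finite_cost_condition ::
  "'x::complex_hilbert set \<Rightarrow> ('x \<Rightarrow> 'u::complex_hilbert) \<Rightarrow> ('x \<Rightarrow> 'x) \<Rightarrow>
     ('x \<Rightarrow> 'y::complex_hilbert) \<Rightarrow> bool" where
  "finite_cost_condition D G L K \<longleftrightarrow> (\<forall>x0. \<exists>u. cost D G L K x0 u < \<infinity>)"

definition optimal_cost ::
  "'x::complex_hilbert set \<Rightarrow> ('x \<Rightarrow> 'u::complex_hilbert) \<Rightarrow> ('x \<Rightarrow> 'x) \<Rightarrow>
     ('x \<Rightarrow> 'y::complex_hilbert) \<Rightarrow> 'x \<Rightarrow> ennreal" where
  "optimal_cost D G L K x0 = (INF u\<in>{u. L2_on {0..} u}. cost D G L K x0 u)"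

(* The form of a self-adjoint operator is real, so only its real part is compared.  The comparison is
   made in ereal because ennreal would truncate negative values of the form to 0. *)

definition optimal_cost_operator ::
  "'x::complex_hilbert set \<Rightarrow> ('x \<Rightarrow> 'u::complex_hilbert) \<Rightarrow> ('x \<Rightarrow> 'x) \<Rightarrow>
     ('x \<Rightarrow> 'y::complex_hilbert) \<Rightarrow> ('x \<Rightarrow> 'x) \<Rightarrow> bool" where
  "optimal_cost_operator D G L K P \<longleftrightarrow>
     bounded_clinear P \<and> (\<forall>x z. cinner (P x) z = cinner x (P z)) \<and>
     (\<forall>x0. ereal (Re (cinner x0 (P x0))) = enn2ereal (optimal_cost D G L K x0))"

definition optimal_control ::
  "'x::complex_hilbert set \<Rightarrow> ('x \<Rightarrow> 'u::complex_hilbert) \<Rightarrow> ('x \<Rightarrow> 'x) \<Rightarrow>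
     ('x \<Rightarrow> 'y::complex_hilbert) \<Rightarrow> 'x \<Rightarrow> (real \<Rightarrow> 'u) \<Rightarrow> bool" where
  "optimal_control D G L K x0 u \<longleftrightarrow>
     L2_on {0..} u \<and> cost D G L K x0 u = optimal_cost D G L K x0"

definition boundary_node_Riccati ::
  "'x::complex_hilbert set \<Rightarrow> ('x \<Rightarrow> 'u::complex_hilbert) \<Rightarrow> ('x \<Rightarrow> 'x) \<Rightarrow>
     ('x \<Rightarrow> 'y::complex_hilbert) \<Rightarrow> ('x \<Rightarrow> 'x) \<Rightarrow> ('x \<Rightarrow> 'u) \<Rightarrow> bool" where
  "boundary_node_Riccati D G L K P N \<longleftrightarrow>
     (\<forall>x\<in>D. cinner (L x) (P x) + cinner (P x) (L x)
         + complex_of_real ((norm (G x))\<^sup>2) + complex_of_real ((norm (K x))\<^sup>2)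
       = complex_of_real ((norm (N x))\<^sup>2))"

end

theory Submission
  imports Defs
begin

text \<open>
  Passivity makes the semigroup of \<open>L\<close> restricted to \<open>ker G\<close> contractive and bounds the output energy of a free
  trajectory by \<open>\<parallel>x\<^sub>0\<parallel>\<^sup>2\<close>. So \<open>u = 0\<close> has cost at most \<open>\<parallel>x\<^sub>0\<parallel>\<^sup>2\<close>. Since solutions form a linear space and the cost is a
  quadratic functional on it, the optimal cost satisfies the parallelogram law (no minimizer is needed), and the
  Jordan--von Neumann and Riesz theorems turn it into a self-adjoint operator.

  In the energy preserving case, the state driven by an \<open>L\<^sup>2\<close> input differs from a free trajectory started at a late
  time \<open>s\<close> by at most the energy of the input after \<open>s\<close>. With strong stability the state tends to zero, and the energy
  balance gives the cost \<open>\<parallel>x\<^sub>0\<parallel>\<^sup>2 + 2 \<parallel>u\<parallel>\<^sup>2\<close> for every \<open>L\<^sup>2\<close> input.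
\<close>

section \<open>Complex Hilbert spaces\<close>

text \<open>The energy inequality is integrated along orbits, so it presupposes that orbits starting
  in the domain of the generator are differentiable, from the left as well. Left differentiability
  needs a bound on the semigroup that is uniform on bounded time intervals, and strong continuity at
  0 yields one only through the uniform boundedness principle. The contraction bound then extends
  from the domain by density.

  The spaces may be non-separable and costs may be infinite, so L2 norms are handled as squared
  integrals in \<open>ennreal\<close>, and measurability is carried by the norms and by simple
  approximants. A rapidly convergent sequence of outputs takes the place of completeness of L2.

  Existence of a solution is established for zero input only. All other inputs enter through given
  solutions, which are combined linearly. In the energy preserving case the input energy counts
  twice, once in the cost itself and once as output energy; the same 2 reappears as
  \<open>sqrt 2\<close> in front of \<open>G\<close> in the Riccati equation.\<close>

lemma scaleC_of_real: "complex_of_real r *\<^sub>C x = r *\<^sub>R x"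
  by (simp add: scaleR_scaleC)

lemma scaleC_one [simp]: "1 *\<^sub>C x = x"
  using scaleC_of_real[of 1 x] by simp

lemma scaleC_zero_left [simp]: "0 *\<^sub>C x = 0"
  using scaleC_of_real[of 0 x] by simp

lemma scaleC_minus_one: "(-1) *\<^sub>C x = - x"
  using scaleC_of_real[of "-1" x] by simp

lemma scaleC_ii_ii: "\<i> *\<^sub>C (\<i> *\<^sub>C x) = - x"
  by (simp add: scaleC_scaleC scaleC_minus_one)

lemma scaleC_scaleR_commute: "c *\<^sub>C (r *\<^sub>R x) = r *\<^sub>R (c *\<^sub>C x)"
  by (simp add: scaleR_scaleC scaleC_scaleC mult.commute)

lemma linear_scaleC: "linear (\<lambda>x. c *\<^sub>C x)"
  by (rule linearI) (simp_all add: scaleC_add_right scaleC_scaleR_commute)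

lemma cinner_scaleC_right: "cinner x (a *\<^sub>C y) = cnj a * cinner x y"
  by (metis cinner_commute cinner_scaleC_left complex_cnj_mult)

lemma norm_scaleC: "norm (c *\<^sub>C x) = cmod c * norm x"
proof -
  have "complex_of_real ((norm (c *\<^sub>C x))\<^sup>2) = complex_of_real ((cmod c * norm x)\<^sup>2)"
    unfolding cinner_self[symmetric] cinner_scaleC_left cinner_scaleC_right
    by (simp add: cinner_self power_mult_distrib complex_norm_square mult_ac del: of_real_power)
  then have "(norm (c *\<^sub>C x))\<^sup>2 = (cmod c * norm x)\<^sup>2"
    by (simp only: of_real_eq_iff)
  then show ?thesis
    by (simp add: power2_eq_iff_nonneg)
qed

lemma bounded_linear_scaleC: "bounded_linear (\<lambda>x. c *\<^sub>C x)"
  using linear_scaleC by (rule bounded_linear.intro)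
    (auto simp: bounded_linear_axioms_def norm_scaleC intro!: exI[of _ "cmod c"])

lemma inner_scaleC_ii: "inner (\<i> *\<^sub>C x) (\<i> *\<^sub>C y) = inner x y"
  by (simp add: inner_eq_Re_cinner cinner_scaleC_left cinner_scaleC_right)

lemma Im_cinner: "Im (cinner x y) = inner x (\<i> *\<^sub>C y)"
  by (simp add: inner_eq_Re_cinner cinner_scaleC_right)

lemma bounded_clinear_imp_bounded_linear:
  assumes "bounded_clinear f"
  shows "bounded_linear f"
proof -
  have 1: "f (x + y) = f x + f y" "f (c *\<^sub>C x) = c *\<^sub>C f x" for x y c
    using assms by (auto simp: bounded_clinear_def clinear_on_def)
  obtain C where "\<And>x. norm (f x) \<le> C * norm x"
    using assms by (auto simp: bounded_clinear_def)
  then show ?thesis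
    by (intro bounded_linear_intro[where K = C]) (auto simp: 1 scaleR_scaleC mult.commute)
qed

lemma csubspaceD:
  assumes "csubspace S"
  shows "0 \<in> S" "x \<in> S \<Longrightarrow> y \<in> S \<Longrightarrow> x + y \<in> S" "x \<in> S \<Longrightarrow> c *\<^sub>C x \<in> S"
    "x \<in> S \<Longrightarrow> y \<in> S \<Longrightarrow> x - y \<in> S" "x \<in> S \<Longrightarrow> r *\<^sub>R x \<in> S"
proof -
  show *: "0 \<in> S" "x \<in> S \<Longrightarrow> y \<in> S \<Longrightarrow> x + y \<in> S" "x \<in> S \<Longrightarrow> c *\<^sub>C x \<in> S" for x y c
    using assms by (auto simp: csubspace_def)
  show "x \<in> S \<Longrightarrow> y \<in> S \<Longrightarrow> x - y \<in> S" "x \<in> S \<Longrightarrow> r *\<^sub>R x \<in> S"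
    using *(2)[of x "(-1) *\<^sub>C y"] *(3)[of y "-1"] *(3)[of x "complex_of_real r"]
    by (auto simp: scaleC_minus_one scaleC_of_real)
qed

lemma clinear_onD:
  assumes "clinear_on S f" "csubspace S"
  shows "x \<in> S \<Longrightarrow> y \<in> S \<Longrightarrow> f (x + y) = f x + f y"
    "x \<in> S \<Longrightarrow> f (c *\<^sub>C x) = c *\<^sub>C f x"
    "x \<in> S \<Longrightarrow> y \<in> S \<Longrightarrow> f (x - y) = f x - f y"
    "f 0 = 0"
proof -
  show *: "x \<in> S \<Longrightarrow> y \<in> S \<Longrightarrow> f (x + y) = f x + f y" "x \<in> S \<Longrightarrow> f (c *\<^sub>C x) = c *\<^sub>C f x" for x y c
    using assms(1) by (auto simp: clinear_on_def)
  show "x \<in> S \<Longrightarrow> y \<in> S \<Longrightarrow> f (x - y) = f x - f y"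
    using *(1)[of x "(-1) *\<^sub>C y"] *(2)[of y "-1"] csubspaceD(3)[OF assms(2), of y "-1"]
    by (auto simp: scaleC_minus_one)
  show "f 0 = 0"
    using *(2)[of 0 0] csubspaceD(1)[OF assms(2)] by simp
qed

text \<open>The representing vector is the minimizer of \<open>\<parallel>x\<parallel>\<^sup>2 - 2 f x\<close>; minimizing sequences are Cauchy by the
  parallelogram law.\<close>

lemma Riesz_representation:
  fixes f :: "'a::{real_inner,banach} \<Rightarrow> real"
  assumes "bounded_linear f"
  shows "\<exists>z. \<forall>x. f x = inner x z"
proof -
  interpret f: bounded_linear f by fact
  obtain C where C: "\<And>x. \<bar>f x\<bar> \<le> norm x * C"
    using f.bounded by auto
  define F where "F x = (norm x)\<^sup>2 - 2 * f x" for x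
  \<comment> \<open>\<open>F x\<close> is at least \<open>(norm x)\<^sup>2 - 2 * C * norm x\<close>;
    complete the square.\<close>
  have low: "F x \<ge> - C\<^sup>2" for x
  proof -
    have "0 \<le> (norm x - C)\<^sup>2" by simp
    moreover have "f x \<le> norm x * C" using C[of x] by linarith
    ultimately show ?thesis
      by (simp add: F_def power2_eq_square algebra_simps)
  qed
  have bdd: "bdd_below (range F)"
    using low by (auto simp: bdd_below_def)
  define m where "m = Inf (range F)"
  have m_le: "m \<le> F x" for x
    unfolding m_def using bdd by (auto intro: cInf_lower)
  have "\<exists>x. F x < m + inverse (real (Suc n))" for n
    using cInf_lessD[of "range F" "m + inverse (real (Suc n))"] by (auto simp: m_def)
  then obtain x where x: "\<And>n. F (x n) < m + inverse (real (Suc n))"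
    by metis
  \<comment> \<open>The contributions of \<open>f\<close> cancel because \<open>f\<close> is linear,
    so only the parallelogram law for the norm remains.\<close>
  have par: "(norm (a - b))\<^sup>2 = 2 * F a + 2 * F b - 4 * F ((1/2) *\<^sub>R (a + b))" for a b
  proof -
    have "(norm (a - b))\<^sup>2 + (norm (a + b))\<^sup>2 = 2 * (norm a)\<^sup>2 + 2 * (norm b)\<^sup>2"
      by (simp add: power2_norm_eq_inner inner_simps inner_commute)
    moreover have "f ((1/2) *\<^sub>R (a + b)) = (f a + f b) / 2" "norm ((1/2) *\<^sub>R (a + b)) = norm (a + b) / 2"
      unfolding f.scaleR f.add norm_scaleR by simp_all
    ultimately show ?thesis
      by (simp add: F_def power_divide)
  qed
  have cau: "(norm (x i - x j))\<^sup>2 \<le> 4 * inverse (real (Suc n))" if "i \<ge> n" "j \<ge> n" for i j n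
  proof -
    have "inverse (real (Suc i)) \<le> inverse (real (Suc n))" "inverse (real (Suc j)) \<le> inverse (real (Suc n))"
      using that by (auto simp: field_simps)
    then show ?thesis
      using par[of "x i" "x j"] x[of i] x[of j] m_le[of "(1/2) *\<^sub>R (x i + x j)"] by linarith
  qed
  have "Cauchy x"
  proof (rule metric_CauchyI)
    fix e :: real assume "0 < e"
    then obtain n where n: "inverse (real (Suc n)) < e\<^sup>2 / 4"
      using reals_Archimedean[of "e\<^sup>2 / 4"] by auto
    have "dist (x i) (x j) < e" if "i \<ge> n" "j \<ge> n" for i j
    proof -
      have "(norm (x i - x j))\<^sup>2 < e\<^sup>2"
        using cau[OF that] n by linarith
      then show ?thesis
        using \<open>0 < e\<close> by (simp add: dist_norm power2_less_imp_less)
    qed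
    then show "\<exists>n. \<forall>i\<ge>n. \<forall>j\<ge>n. dist (x i) (x j) < e" by blast
  qed
  then obtain z where z: "x \<longlonglongrightarrow> z"
    by (auto simp: Cauchy_convergent_iff convergent_def)
  have "(\<lambda>n. F (x n)) \<longlonglongrightarrow> F z"
    unfolding F_def by (intro tendsto_intros z f.tendsto)
  moreover have "(\<lambda>n. m + inverse (real (Suc n))) \<longlonglongrightarrow> m"
    using LIMSEQ_inverse_real_of_nat_add[of m] by simp
  ultimately have Fz: "F z \<le> m"
    by (rule LIMSEQ_le) (use x less_imp_le in blast)
  have "f h = inner h z" for h
  proof (rule ccontr)
    assume ne: "f h \<noteq> inner h z"
    define d where "d = f h - inner h z"
    have h0: "h \<noteq> 0" using ne by (auto simp: f.zero)
    \<comment> \<open>The minimizer of the quadratic polynomial \<open>F (z + t *\<^sub>R h)\<close>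
      in \<open>t\<close>; it would undercut \<open>F z\<close> by
      \<open>d\<^sup>2 / (norm h)\<^sup>2\<close>.\<close>
    define t where "t = d / (norm h)\<^sup>2"
    have "F (z + t *\<^sub>R h) = F z - 2 * t * d + t\<^sup>2 * (norm h)\<^sup>2"
      unfolding F_def d_def f.add f.scaleR power2_norm_eq_inner inner_simps inner_commute[of z h]
      by (simp add: algebra_simps power2_eq_square)
    also have "\<dots> = F z - d\<^sup>2 / (norm h)\<^sup>2"
      using h0 by (simp add: t_def field_simps power2_eq_square)
    finally have "F (z + t *\<^sub>R h) < F z"
      using h0 ne by (simp add: d_def)
    with m_le[of "z + t *\<^sub>R h"] Fz show False by linarith
  qed
  then show ?thesis by blast
qed

text \<open>For fixed \<open>x\<close> the additive function \<open>r \<mapsto> f (r x) - r f x\<close> has period 1, hence is bounded, hence vanishes.\<close>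

lemma additive_locally_bounded_imp_bounded_linear:
  fixes f :: "'a::real_normed_vector \<Rightarrow> real"
  assumes add: "\<And>x y. f (x + y) = f x + f y"
    and bdd: "\<And>x. norm x \<le> 1 \<Longrightarrow> \<bar>f x\<bar> \<le> C"
  shows "bounded_linear f"
proof -
  have 0: "f 0 = 0" using add[of 0 0] by simp
  have minus: "f (- x) = - f x" for x using add[of x "- x"] 0 by simp
  have nat: "f (real n *\<^sub>R x) = real n * f x" for n x
    by (induction n) (auto simp: 0 add scaleR_add_left algebra_simps)
  have int: "f (of_int k *\<^sub>R x) = of_int k * f x" for k x
    by (cases k rule: int_cases2) (auto simp: nat minus)
  have unit: "f (r *\<^sub>R x) = r * f x" if x: "norm x \<le> 1" for r x
  proof -
    define g where "g r = f (r *\<^sub>R x) - r * f x" for r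
    have gadd: "g (a + b) = g a + g b" for a b
      by (simp add: g_def scaleR_add_left add algebra_simps)
    have gbound: "\<bar>g r\<bar> \<le> 2 * C" for r
    proof -
      have "g r = g (frac r)"
        using gadd[of "of_int \<lfloor>r\<rfloor>" "frac r"] int[of "\<lfloor>r\<rfloor>" x] by (simp add: g_def frac_def)
      moreover have fr: "0 \<le> frac r" "frac r \<le> 1"
        using frac_lt_1[of r] by auto
      then have "\<bar>f (frac r *\<^sub>R x)\<bar> \<le> C"
        using x by (intro bdd) (simp add: mult_le_one)
      moreover have "\<bar>frac r * f x\<bar> \<le> C"
        using fr bdd[OF x] mult_mono[of "frac r" 1 "\<bar>f x\<bar>" C] by (simp add: abs_mult)
      ultimately show ?thesis by (simp add: g_def)
    qed
    have gnat: "g (real n * r) = real n * g r" for n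
      proof (induction n)
      case (Suc n)
      then show ?case by (simp add: distrib_right gadd)
    qed (simp add: g_def 0)
    have "g r = 0"
    proof (rule ccontr)
      assume "g r \<noteq> 0"
      then obtain n where "real n * \<bar>g r\<bar> > 2 * C"
        using reals_Archimedean3[of "\<bar>g r\<bar>"] by auto
      then show False using gbound[of "real n * r"] by (simp add: gnat abs_mult)
    qed
    then show ?thesis by (simp add: g_def)
  qed
  have scale: "f (r *\<^sub>R x) = r * f x" for r x
  proof (cases "x = 0")
    case False
    then show ?thesis
      using unit[of "sgn x" "r * norm x"] unit[of "sgn x" "norm x"]
      by (simp add: sgn_div_norm mult.assoc)
  qed (simp add: 0)
  have "\<bar>f x\<bar> \<le> norm x * C" for x
    using unit[of "sgn x" "norm x"] bdd[of "sgn x"] mult_left_mono[of "\<bar>f (sgn x)\<bar>" C "norm x"]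
    by (cases "x = 0") (auto simp: sgn_div_norm abs_mult 0)
  then show ?thesis
    by (intro bounded_linear_intro[where K = C]) (use add scale in auto)
qed

section \<open>Self-adjoint operators and their quadratic forms\<close>

text \<open>Polarization. The real inner product suffices: \<open>inner x (P z)\<close> is
  symmetric, so the form at \<open>x + z\<close> determines it, and testing with
  \<open>P z - Q z\<close> separates the values.\<close>

lemma selfadjoint_eqI:
  fixes P Q :: "'x::complex_hilbert \<Rightarrow> 'x"
  assumes "bounded_clinear P" "bounded_clinear Q"
    and P: "\<And>x z. cinner (P x) z = cinner x (P z)"
    and Q: "\<And>x z. cinner (Q x) z = cinner x (Q z)"
    and eq: "\<And>x. Re (cinner x (P x)) = Re (cinner x (Q x))"
  shows "P = Q"
proof
  fix z :: 'x
  interpret P: bounded_linear P using assms(1) by (rule bounded_clinear_imp_bounded_linear)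
  interpret Q: bounded_linear Q using assms(2) by (rule bounded_clinear_imp_bounded_linear)
  have sym: "inner x (P y) = inner y (P x)" "inner x (Q y) = inner y (Q x)" for x y
    using P[of x y] Q[of x y] by (metis inner_commute inner_eq_Re_cinner)+
  have "inner x (P z) = inner x (Q z)" for x
    using eq[of "x + z"] eq[of x] eq[of z] sym(1)[of x z] sym(2)[of x z]
    by (simp add: inner_eq_Re_cinner[symmetric] P.add Q.add inner_add_left inner_add_right)
  from this[of "P z - Q z"] have "inner (P z - Q z) (P z - Q z) = 0"
    by (simp add: inner_diff_right)
  then show "P z = Q z" by simp
qed

text \<open>Jordan--von Neumann: the polarization \<open>B\<close> of \<open>q\<close> is additive by the parallelogram law, hence real linear by
  boundedness, and the represented operator is complex linear because \<open>q (\<i> x) = q x\<close>.\<close>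

lemma quadratic_form_operator:
  fixes q :: "'x::complex_hilbert \<Rightarrow> real"
  assumes par: "\<And>x z. q (x + z) + q (x - z) = 2 * q x + 2 * q z"
    and scale: "\<And>c x. q (c *\<^sub>C x) = (cmod c)\<^sup>2 * q x"
    and nonneg: "\<And>x. 0 \<le> q x"
    and bound: "\<And>x. q x \<le> (norm x)\<^sup>2"
  shows "\<exists>P. bounded_clinear P \<and> (\<forall>x z. cinner (P x) z = cinner x (P z)) \<and>
    (\<forall>x. Re (cinner x (P x)) = q x)"
proof -
  define B where "B x z = (q (x + z) - q (x - z)) / 4" for x z
  have q0: "q 0 = 0" using scale[of 0 0] by simp
  have qm: "q (- x) = q x" for x using scale[of "-1" x] by (simp add: scaleC_minus_one)
  have q2: "q (2 *\<^sub>R x) = 4 * q x" for x using scale[of "of_real 2" x] by (simp only: scaleC_of_real) simp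
  have sym: "B x z = B z x" for x z
    using qm[of "x - z"] by (simp add: B_def add.commute)
  have B0: "B 0 z = 0" for z by (simp add: B_def qm)
  \<comment> \<open>Midpoint version of additivity: with x = a + b and y = a - b, the parallelogram
    law at \<open>a + z\<close> and at \<open>a - z\<close>, each paired with \<open>b\<close>,
    makes the terms \<open>q b\<close> cancel. Additivity follows by comparing the pairs
    \<open>x\<close>, \<open>y\<close> and \<open>x + y\<close>, \<open>0\<close>, which have the
    same midpoint.\<close>
  have half: "B x z + B y z = 2 * B ((1/2) *\<^sub>R (x + y)) z" for x y z
  proof -
    define a b where "a = (1/2) *\<^sub>R (x + y)" and "b = (1/2) *\<^sub>R (x - y)"
    have "x = a + b" "y = a - b"
      unfolding a_def b_def by (simp_all add: scaleR_add_right[symmetric] scaleR_diff_right[symmetric])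
    moreover have "q ((a + z) + b) + q ((a + z) - b) = 2 * q (a + z) + 2 * q b"
      "q ((a - z) + b) + q ((a - z) - b) = 2 * q (a - z) + 2 * q b"
      by (rule par)+
    ultimately show ?thesis
      unfolding a_def[symmetric] by (simp only: \<open>x = a + b\<close> \<open>y = a - b\<close> B_def) (simp add: algebra_simps diff_divide_distrib)
  qed
  have add: "B (x + y) z = B x z + B y z" for x y z
    using half[of x z y] half[of "x + y" z 0] B0[of z] by simp
  have Bbound: "\<bar>B x z\<bar> \<le> ((norm x)\<^sup>2 + (norm z)\<^sup>2) / 2" for x z
  proof -
    have "q (x + z) + q (x - z) \<le> 2 * (norm x)\<^sup>2 + 2 * (norm z)\<^sup>2"
      using par[of x z] bound[of x] bound[of z] by linarith
    then show ?thesis using nonneg[of "x + z"] nonneg[of "x - z"] by (simp add: B_def)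
  qed
  have lin: "bounded_linear (\<lambda>x. B x z)" for z
  proof (rule additive_locally_bounded_imp_bounded_linear[where C = "(1 + (norm z)\<^sup>2) / 2"])
    fix x :: 'x assume "norm x \<le> 1"
    then have "(norm x)\<^sup>2 \<le> 1" by (simp add: power_le_one)
    then show "\<bar>B x z\<bar> \<le> (1 + (norm z)\<^sup>2) / 2" using Bbound[of x z] by simp
  qed (rule add)
  have "\<exists>w. \<forall>x. B x z = inner x w" for z
    by (rule Riesz_representation[OF lin])
  then obtain P where P: "\<And>x z. B x z = inner x (P z)" by metis
  have eqI: "a = b" if "\<And>x. inner x a = inner x b" for a b :: 'x
  proof -
    have "inner (a - b) (a - b) = 0" using that[of "a - b"] by (simp add: inner_diff_right)
    then show ?thesis by simp
  qed
  have Psym: "inner x (P z) = inner (P x) z" for x z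
    by (metis P sym inner_commute)
  have Padd: "P (x + y) = P x + P y" for x y
    by (rule eqI) (metis Psym inner_add_left inner_add_right)
  have Pscale: "P (r *\<^sub>R x) = r *\<^sub>R P x" for r x
    by (rule eqI) (metis Psym inner_scaleR_left inner_scaleR_right)
  have Bii: "B (\<i> *\<^sub>C x) (\<i> *\<^sub>C z) = B x z" for x z
    using scale[of \<i> "x + z"] scale[of \<i> "x - z"] linear_diff[OF linear_scaleC, of \<i> x z]
    by (simp add: B_def scaleC_add_right)
  have Pii: "P (\<i> *\<^sub>C z) = \<i> *\<^sub>C P z" for z
  proof (rule eqI)
    fix x :: 'x
    have x: "x = \<i> *\<^sub>C (- (\<i> *\<^sub>C x))"
      by (simp add: linear_neg[OF linear_scaleC] scaleC_ii_ii)
    have "inner x (P (\<i> *\<^sub>C z)) = B (\<i> *\<^sub>C (- (\<i> *\<^sub>C x))) (\<i> *\<^sub>C z)"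
      using x P by simp
    also have "\<dots> = inner (\<i> *\<^sub>C (- (\<i> *\<^sub>C x))) (\<i> *\<^sub>C P z)"
      unfolding Bii by (simp add: P inner_scaleC_ii)
    finally show "inner x (P (\<i> *\<^sub>C z)) = inner x (\<i> *\<^sub>C P z)"
      using x by simp
  qed
  have Pc: "P (c *\<^sub>C x) = c *\<^sub>C P x" for c x
  proof -
    have split: "c *\<^sub>C y = Re c *\<^sub>R y + Im c *\<^sub>R (\<i> *\<^sub>C y)" for y :: 'x
    proof -
      have "c = complex_of_real (Re c) + complex_of_real (Im c) * \<i>"
        by (simp add: complex_eq_iff)
      then have "c *\<^sub>C y = (complex_of_real (Re c) + complex_of_real (Im c) * \<i>) *\<^sub>C y" by simp
      then show ?thesis by (simp add: scaleC_add_left scaleR_scaleC scaleC_scaleC)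
    qed
    show ?thesis by (simp add: split[of x] split[of "P x"] Padd Pscale Pii)
  qed
  have Pnorm: "norm (P z) \<le> 1 * norm z" for z
  proof (cases "P z = 0 \<or> z = 0")
    case True
    then show ?thesis using Pscale[of 0 z] by auto
  next
    case False
    \<comment> \<open>Rescaling \<open>P z\<close> to the norm of \<open>z\<close> turns the sum of
      squares in \<open>Bbound\<close> into \<open>(norm z)\<^sup>2\<close>.\<close>
    define a where "a = (norm z / norm (P z)) *\<^sub>R P z"
    have "norm a = norm z" using False by (simp add: a_def)
    then have "inner a (P z) \<le> (norm z)\<^sup>2" using Bbound[of a z] by (simp add: P)
    moreover have "inner a (P z) = norm z * norm (P z)"
      using False by (simp add: a_def power2_norm_eq_inner[symmetric] power2_eq_square)
    ultimately show ?thesis using False by (simp add: power2_eq_square)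
  qed
  have Pq: "inner x (P x) = q x" for x
    using P[of x x] q2[of x] by (simp add: B_def q0 scaleR_2)
  have "cinner (P x) z = cinner x (P z)" for x z
  proof (rule complex_eqI)
    show "Re (cinner (P x) z) = Re (cinner x (P z))"
      using Psym[of x z] by (simp add: inner_eq_Re_cinner)
    show "Im (cinner (P x) z) = Im (cinner x (P z))"
      using Psym[of x "\<i> *\<^sub>C z"] by (simp add: Im_cinner Pii)
  qed
  moreover have "bounded_clinear P"
    unfolding bounded_clinear_def clinear_on_def using Padd Pc Pnorm by blast
  ultimately show ?thesis using Pq by (auto simp: inner_eq_Re_cinner)
qed

section \<open>Uniform boundedness and strongly continuous semigroups\<close>

text \<open>Sokal's gliding hump: \<open>x\<close> is a series of nearly norming vectors \<open>\<plusminus> h k\<close> of size \<open>3\<^sup>-\<^sup>k\<close>, the signs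
  being chosen so that no cancellation occurs.\<close>

lemma uniform_boundedness:
  fixes T :: "nat \<Rightarrow> 'a::banach \<Rightarrow> 'b::real_normed_vector"
  assumes lin: "\<And>n. bounded_linear (T n)"
    and pt: "\<And>x. \<exists>C. \<forall>n. norm (T n x) \<le> C"
  shows "\<exists>M. \<forall>n x. norm (T n x) \<le> M * norm x"
proof (rule ccontr)
  assume nex: "\<not> ?thesis"
  \<comment> \<open>The rate 4 beats the shrinking factor 3 of the humps, whose images therefore
    grow at least like a multiple of \<open>(4/3) ^ k\<close>.\<close>
  have "\<exists>n. onorm (T n) > 4 ^ k" for k :: nat
  proof (rule ccontr)
    assume "\<not> ?thesis"
    then have "norm (T n x) \<le> 4 ^ k * norm x" for n x
      using onorm[OF lin, of n x] by (meson linorder_not_less mult_right_mono norm_ge_zero order_trans)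
    with nex show False by blast
  qed
  then obtain N where N: "\<And>k. onorm (T (N k)) > 4 ^ k" by metis
  define S where "S k = T (N k)" for k
  have Slin: "bounded_linear (S k)" for k by (simp add: S_def lin)
  have Spos: "onorm (S k) > 4 ^ k" for k by (simp add: S_def N)
  then have Spos0: "onorm (S k) > 0" for k
    using zero_less_power[of "4::real" k] by (meson less_trans zero_less_numeral)
  \<comment> \<open>The factor must be below 1, since the operator norm need not be attained, and
    above 1/2, since the later humps together have size at most \<open>1/2 * (1/3) ^ k\<close>. The
    choice 9/10 leaves 2/5.\<close>
  have "\<exists>h. norm h = (1/3) ^ k \<and> norm (S k h) \<ge> 9/10 * onorm (S k) * (1/3) ^ k" for k
  proof -
    have "\<exists>h. norm (S k h) > 9/10 * onorm (S k) * norm h"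
    proof (rule ccontr)
      assume "\<not> ?thesis"
      then have "onorm (S k) \<le> 9/10 * onorm (S k)"
        using Spos0[of k] by (intro onorm_bound) (auto simp: not_less)
      then show False using Spos0[of k] by simp
    qed
    then obtain h where h: "norm (S k h) > 9/10 * onorm (S k) * norm h" by blast
    have h0: "h \<noteq> 0"
    proof
      assume "h = 0"
      then show False using h linear_simps(3)[OF Slin] by simp
    qed
    interpret bounded_linear "S k" by (rule Slin)
    show ?thesis
    proof (intro exI conjI)
      show "norm (((1/3) ^ k / norm h) *\<^sub>R h) = (1/3) ^ k" using h0 by simp
      have "(1/3) ^ k / norm h * (9/10 * onorm (S k) * norm h) \<le> (1/3) ^ k / norm h * norm (S k h)"
        using h by (intro mult_left_mono) auto
      then show "norm (S k (((1/3) ^ k / norm h) *\<^sub>R h)) \<ge> 9/10 * onorm (S k) * (1/3) ^ k"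
        using h0 by (simp add: scaleR mult_ac)
    qed
  qed
  then obtain h where h: "\<And>k. norm (h k) = (1/3) ^ k"
    "\<And>k. norm (S k (h k)) \<ge> 9/10 * onorm (S k) * (1/3) ^ k" by metis
  define next_x where "next_x k x =
    (if norm (S k (x + h k)) \<ge> norm (S k (h k)) then x + h k else x - h k)" for k x
  define x where "x = rec_nat 0 next_x"
  have x0: "x 0 = 0" and xSuc: "x (Suc k) = next_x k (x k)" for k
    by (simp_all add: x_def)
  have hump: "norm (S k (x (Suc k))) \<ge> norm (S k (h k))" for k
  proof -
    interpret bounded_linear "S k" by (rule Slin)
    have "2 * norm (S k (h k)) = norm (S k (x k + h k) - S k (x k - h k))"
      by (simp add: add diff scaleR_2[symmetric])
    also have "\<dots> \<le> norm (S k (x k + h k)) + norm (S k (x k - h k))" by (rule norm_triangle_ineq4)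
    finally show ?thesis by (auto simp: xSuc next_x_def)
  qed
  define d where "d k = x (Suc k) - x k" for k
  have dnorm: "norm (d k) = (1/3) ^ k" for k
    by (simp add: d_def xSuc next_x_def h)
  have xsum: "x n = (\<Sum>k<n. d k)" for n
    by (induction n) (auto simp: x0 d_def)
  have geo: "summable (\<lambda>k. (1/3::real) ^ k)" by (rule summable_geometric) simp
  have dsum: "summable d"
    by (rule summable_norm_cancel) (simp add: dnorm geo)
  define y where "y = suminf d"
  have tail: "norm (y - x (Suc k)) \<le> 1/2 * (1/3) ^ k" for k
  proof -
    have "y - x (Suc k) = (\<Sum>j. d (j + Suc k))"
      unfolding y_def xsum by (rule suminf_minus_initial_segment[OF dsum, symmetric])
    also have "norm \<dots> \<le> (\<Sum>j. (1/3) ^ (j + Suc k))"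
      using summable_ignore_initial_segment[OF geo, of "Suc k"] by (intro norm_suminf_le) (auto simp: dnorm)
    also have "\<dots> = (1/3) ^ Suc k * (\<Sum>j. (1/3) ^ j)"
      using suminf_mult[OF geo, of "(1/3) ^ Suc k"] by (simp add: power_add mult_ac)
    also have "\<dots> = 1/2 * (1/3) ^ k" by (simp add: suminf_geometric)
    finally show ?thesis .
  qed
  obtain C where C: "\<And>n. norm (T n y) \<le> C" using pt by blast
  have "2/5 * (4/3) ^ k \<le> C" for k :: nat
  proof -
    interpret bounded_linear "S k" by (rule Slin)
    have "norm (S k (y - x (Suc k))) \<le> onorm (S k) * (1/2 * (1/3) ^ k)"
      using onorm[OF Slin, of k "y - x (Suc k)"] tail[of k] mult_left_mono[OF tail, of "onorm (S k)" k] Spos0[of k]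
      by linarith
    moreover have "norm (S k (x (Suc k))) \<le> norm (S k y) + norm (S k (y - x (Suc k)))"
      by (metis diff add.commute norm_triangle_sub norm_minus_commute)
    ultimately have "2/5 * onorm (S k) * (1/3) ^ k \<le> norm (S k y)"
      using hump[of k] h(2)[of k] by (simp add: algebra_simps)
    also have "\<dots> \<le> C" by (simp add: S_def C)
    finally have "2/5 * onorm (S k) * (1/3) ^ k \<le> C" .
    moreover have "2/5 * 4 ^ k * (1/3) ^ k \<le> 2/5 * onorm (S k) * (1/3) ^ k"
      using Spos[of k] by (intro mult_right_mono mult_left_mono) auto
    ultimately show ?thesis by (simp add: power_divide)
  qed
  from this show False
  proof -
    obtain k where "5/2 * C < (4/3) ^ k" using real_arch_pow[of "4/3" "5/2 * C"] by auto
    then show False using \<open>\<And>k. 2/5 * (4/3) ^ k \<le> C\<close>[of k] by simp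
  qed
qed

section \<open>Strongly continuous semigroups: local bounds, orbits and the domain of the
  generator\<close>

locale C0_semigroup_locale =
  fixes T :: "real \<Rightarrow> 'x::complex_hilbert \<Rightarrow> 'x"
  assumes C0: "C0_semigroup T"
begin

lemma bounded_linear_T: "t \<ge> 0 \<Longrightarrow> bounded_linear (T t)"
  using C0 by (auto simp: C0_semigroup_def intro: bounded_clinear_imp_bounded_linear)

lemma T_zero [simp]: "T 0 x = x"
  using C0 by (auto simp: C0_semigroup_def)

lemma T_add: "s \<ge> 0 \<Longrightarrow> t \<ge> 0 \<Longrightarrow> T (s + t) x = T s (T t x)"
  using C0 by (auto simp: C0_semigroup_def)

lemma tendsto_T_right_zero: "((\<lambda>t. T t x) \<longlongrightarrow> x) (at_right 0)"
  using C0 by (auto simp: C0_semigroup_def)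

text \<open>Otherwise some times \<open>t n\<close> tend to 0 while the operators
  \<open>T (t n)\<close> are not uniformly bounded. But \<open>T (t n) z\<close> converges to
  \<open>z\<close> for every \<open>z\<close>, so uniform boundedness applies to this sequence.
  Requiring \<open>M\<close> to be at least 1 makes its powers increasing, which the iteration over
  longer intervals uses.\<close>

lemma bounded_near_zero: "\<exists>\<delta>>0. \<exists>M\<ge>1. \<forall>t\<in>{0..\<delta>}. \<forall>x. norm (T t x) \<le> M * norm x"
proof (rule ccontr)
  assume nex: "\<not> ?thesis"
  have "\<exists>t x. 0 \<le> t \<and> t \<le> inverse (real (Suc n)) \<and> norm (T t x) > real (Suc n) * norm x" for n
  proof (rule ccontr)
    assume "\<not> ?thesis"
    then have "\<forall>t\<in>{0..inverse (real (Suc n))}. \<forall>x. norm (T t x) \<le> real (Suc n) * norm x"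
      by (simp add: not_less)
    moreover have "inverse (real (Suc n)) > 0" "real (Suc n) \<ge> 1" by simp_all
    ultimately show False using nex by blast
  qed
  then obtain t x where t: "\<And>n. 0 \<le> t n" "\<And>n. t n \<le> inverse (real (Suc n))"
    and x: "\<And>n. norm (T (t n) (x n)) > real (Suc n) * norm (x n)" by metis
  have t0: "t \<longlonglongrightarrow> 0"
    by (rule tendsto_sandwich[OF _ _ tendsto_const LIMSEQ_inverse_real_of_nat]) (use t in auto)
  have "\<exists>C. \<forall>n. norm (T (t n) z) \<le> C" for z
  proof -
    have "((\<lambda>s. T s z) \<longlongrightarrow> T 0 z) (at 0 within {0..})"
      using tendsto_T_right_zero[of z] by (simp add: at_within_Ici_at_right)
    then have "continuous (at 0 within {0..}) (\<lambda>s. T s z)"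
      by (simp add: continuous_within)
    then have "(\<lambda>n. T (t n) z) \<longlonglongrightarrow> T 0 z"
      using t0 t(1) unfolding continuous_within_sequentially by (auto simp: o_def)
    then have "Bseq (\<lambda>n. T (t n) z)" by (rule convergent_imp_Bseq[OF convergentI])
    then show ?thesis by (auto simp: Bseq_def)
  qed
  then obtain M where M: "\<And>n z. norm (T (t n) z) \<le> M * norm z"
    using uniform_boundedness[of "\<lambda>n. T (t n)"] bounded_linear_T[OF t(1)] by blast
  obtain n where "M < real n" using reals_Archimedean2 by blast
  then have "M * norm (x n) \<le> real (Suc n) * norm (x n)" by (intro mult_right_mono) auto
  then show False using M[of n "x n"] x[of n] by linarith
qed

text \<open>Splitting off steps of length \<open>\<delta>\<close> gives the bound
  \<open>M ^ n\<close> on an interval of length \<open>n * \<delta>\<close>. The contraction bound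
  obtained later is sharper, but its proof rests on this one.\<close>

lemma bounded_on_compact:
  "\<exists>M\<ge>0. \<forall>t\<in>{0..\<tau>}. \<forall>x. norm (T t x) \<le> M * norm x"
proof -
  obtain \<delta> M where \<delta>: "\<delta> > 0" and M: "M \<ge> 1" "\<And>t x. t \<in> {0..\<delta>} \<Longrightarrow> norm (T t x) \<le> M * norm x"
    using bounded_near_zero by blast
  have step: "\<forall>t\<in>{0..real n * \<delta>}. \<forall>x. norm (T t x) \<le> M ^ n * norm x" for n
  proof (induction n)
    case (Suc n)
    show ?case
    proof (intro ballI allI)
      fix t x assume t: "t \<in> {0..real (Suc n) * \<delta>}"
      show "norm (T t x) \<le> M ^ Suc n * norm x"
      proof (cases "t \<le> \<delta>")
        case True
        then have "norm (T t x) \<le> M ^ 1 * norm x" using M(2)[of t x] t by simp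
        also have "\<dots> \<le> M ^ Suc n * norm x"
          using M(1) by (intro mult_right_mono power_increasing) auto
        finally show ?thesis .
      next
        case False
        then have "norm (T t x) = norm (T \<delta> (T (t - \<delta>) x))"
          using T_add[of \<delta> "t - \<delta>" x] \<delta> by simp
        also have "\<dots> \<le> M * norm (T (t - \<delta>) x)" using \<delta> by (intro M(2)) auto
        also have "\<dots> \<le> M * (M ^ n * norm x)"
          using Suc.IH t False M(1) by (intro mult_left_mono) (auto simp: algebra_simps)
        finally show ?thesis by simp
      qed
    qed
  qed auto
  obtain n where "\<tau> / \<delta> < real n" using reals_Archimedean2 by blast
  then have "\<tau> \<le> real n * \<delta>" using \<delta> by (simp add: field_simps)
  then show ?thesis using step[of n] M(1) by (intro exI[of _ "M ^ n"]) auto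
qed

text \<open>Factoring out the operator at the earlier of two times reduces every increment to one at
  time 0. To the left of \<open>t\<close> that earlier time varies, hence the uniform bound.
  Dividing by \<open>M + 1\<close> covers \<open>M = 0\<close>.\<close>

lemma continuous_on_T: "continuous_on {0..} (\<lambda>t. T t x)"
  unfolding continuous_on_iff
proof (intro ballI allI impI)
  fix t e :: real assume t: "t \<in> {0..}" and e: "e > 0"
  obtain M where M: "M \<ge> 0" "\<And>s y. s \<in> {0..t + 1} \<Longrightarrow> norm (T s y) \<le> M * norm y"
    using bounded_on_compact[of "t + 1"] by blast
  have "\<forall>\<^sub>F h in at_right 0. dist (T h x) x < e / (M + 1)"
    using tendsto_T_right_zero[of x] e M(1) by (intro tendstoD) auto
  then obtain d where d: "d > 0" "\<And>h. 0 < h \<Longrightarrow> h < d \<Longrightarrow> dist (T h x) x < e / (M + 1)"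
    by (auto simp: eventually_at_right_field)
  have key: "norm (T b x - T a x) < e" if "0 \<le> a" "a \<le> b" "b \<le> t + 1" "b - a < d" for a b
  proof (cases "a = b")
    case False
    interpret bounded_linear "T a" using that by (intro bounded_linear_T)
    have "norm (T b x - T a x) = norm (T a (T (b - a) x - x))"
      using T_add[of a "b - a" x] that by (simp add: diff)
    also have "\<dots> \<le> M * norm (T (b - a) x - x)" using that by (intro M(2)) auto
    also have "\<dots> \<le> M * (e / (M + 1))"
      using d(2)[of "b - a"] that False M(1) by (intro mult_left_mono) (auto simp: dist_norm)
    also have "\<dots> < e" using e M(1) by (simp add: field_simps)
    finally show ?thesis .
  qed (use e in simp)
  show "\<exists>d>0. \<forall>s\<in>{0..}. dist s t < d \<longrightarrow> dist (T s x) (T t x) < e"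
  proof (intro exI[of _ "min d 1"] conjI ballI impI)
    fix s assume "s \<in> {0..}" "dist s t < min d 1"
    then show "dist (T s x) (T t x) < e"
      using key[of s t] key[of t s] t by (cases "s \<le> t") (auto simp: dist_norm dist_real_def norm_minus_commute)
  qed (use d in auto)
qed

text \<open>As for continuity, the earlier time serves as base point. To the left of
  \<open>t\<close> this yields the slope \<open>T s z\<close> at the varying point \<open>s\<close>;
  continuity of the orbit of \<open>z\<close> replaces it by \<open>T t z\<close>. Each of these two
  errors gets half of \<open>e\<close>.\<close>

lemma has_vector_derivative_T:
  assumes gen: "((\<lambda>h. (T h x - x) /\<^sub>R h) \<longlongrightarrow> z) (at_right 0)" and t: "t \<ge> 0"
  shows "((\<lambda>s. T s x) has_vector_derivative T t z) (at t within {0..})"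
  unfolding has_vector_derivative_def has_derivative_within_alt
proof (intro conjI allI impI)
  fix e :: real assume e: "e > 0"
  obtain M where M: "M \<ge> 0" "\<And>s y. s \<in> {0..t + 1} \<Longrightarrow> norm (T s y) \<le> M * norm y"
    using bounded_on_compact[of "t + 1"] by blast
  have "\<forall>\<^sub>F h in at_right 0. dist ((T h x - x) /\<^sub>R h) z < e / (2 * (M + 1))"
    using gen e M(1) by (intro tendstoD) auto
  then obtain d1 where d1: "d1 > 0"
    "\<And>h. 0 < h \<Longrightarrow> h < d1 \<Longrightarrow> dist ((T h x - x) /\<^sub>R h) z < e / (2 * (M + 1))"
    by (auto simp: eventually_at_right_field)
  have quot: "norm (T h x - x - h *\<^sub>R z) \<le> h * (e / (2 * (M + 1)))" if "0 < h" "h < d1" for h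
  proof -
    have "T h x - x - h *\<^sub>R z = h *\<^sub>R ((T h x - x) /\<^sub>R h - z)"
      using that by (simp add: scaleR_diff_right)
    then show ?thesis
      using mult_left_mono[OF less_imp_le[OF d1(2)[OF that]], of h] that by (simp add: dist_norm)
  qed
  obtain d2 where d2: "d2 > 0" "\<And>s. s \<ge> 0 \<Longrightarrow> dist s t < d2 \<Longrightarrow> dist (T s z) (T t z) < e / 2"
    using continuous_on_T[of z, unfolded continuous_on_iff, rule_format, of t "e / 2"] t e by auto
  have key: "norm (T b x - T a x - (b - a) *\<^sub>R T a z) \<le> (b - a) * (e / 2)"
    if "0 \<le> a" "a \<le> b" "b \<le> t + 1" "b - a < d1" for a b
  proof (cases "a = b")
    case False
    interpret bounded_linear "T a" using that by (intro bounded_linear_T)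
    have "norm (T b x - T a x - (b - a) *\<^sub>R T a z) = norm (T a (T (b - a) x - x - (b - a) *\<^sub>R z))"
      using T_add[of a "b - a" x] that by (simp add: diff scaleR)
    also have "\<dots> \<le> M * norm (T (b - a) x - x - (b - a) *\<^sub>R z)" using that by (intro M(2)) auto
    also have "\<dots> \<le> M * ((b - a) * (e / (2 * (M + 1))))"
      using quot[of "b - a"] that False M(1) by (intro mult_left_mono) auto
    also have "\<dots> = (b - a) * (e / 2) * (M / (M + 1))" using M(1) by (simp add: field_simps)
    also have "\<dots> \<le> (b - a) * (e / 2) * 1" using M(1) that e by (intro mult_left_mono) auto
    finally show ?thesis by simp
  qed simp
  show "\<exists>d>0. \<forall>s\<in>{0..}. norm (s - t) < d \<longrightarrow>
      norm (T s x - T t x - (s - t) *\<^sub>R T t z) \<le> e * norm (s - t)"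
  proof (intro exI[of _ "min (min d1 d2) 1"] conjI ballI impI)
    fix s assume s: "s \<in> {0..}" "norm (s - t) < min (min d1 d2) 1"
    show "norm (T s x - T t x - (s - t) *\<^sub>R T t z) \<le> e * norm (s - t)"
    proof (cases "t \<le> s")
      case True
      then have "norm (T s x - T t x - (s - t) *\<^sub>R T t z) \<le> (s - t) * (e / 2)"
        using s t by (intro key) auto
      also have "\<dots> \<le> e * norm (s - t)" using True e by (simp add: mult.commute mult_right_mono)
      finally show ?thesis .
    next
      case False
      have "T s x - T t x - (s - t) *\<^sub>R T t z =
          - (T t x - T s x - (t - s) *\<^sub>R T s z) - (t - s) *\<^sub>R (T s z - T t z)"
        by (simp add: algebra_simps)
      also have "norm \<dots> \<le> norm (T t x - T s x - (t - s) *\<^sub>R T s z) + norm ((t - s) *\<^sub>R (T s z - T t z))"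
        by (metis norm_minus_cancel norm_triangle_ineq4)
      also have "\<dots> \<le> (t - s) * (e / 2) + (t - s) * (e / 2)"
        using s False d2(2)[of s] by (intro add_mono key) (auto simp: dist_norm)
      also have "\<dots> = e * norm (s - t)" using False by (simp add: algebra_simps)
      finally show ?thesis .
    qed
  qed (use d1 d2 in auto)
qed (rule bounded_linear_scaleR_left)

text \<open>The means of the orbit of \<open>x\<close> over \<open>[0, r]\<close> lie in the domain
  and tend to \<open>x\<close> as \<open>r\<close> decreases to 0. The generator maps such a mean to
  the difference quotient of the orbit at \<open>r\<close>.\<close>

lemma generator_domain_dense:
  assumes "e > 0"
  shows "\<exists>w z. ((\<lambda>h. (T h w - w) /\<^sub>R h) \<longlongrightarrow> z) (at_right 0) \<and> dist w x < e"
proof -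
  define F where "F t = integral {0..t} (\<lambda>s. T s x)" for t
  have F0: "F 0 = 0" by (simp add: F_def)
  have F: "(F has_vector_derivative T t x) (at t within {0..})" if "t \<ge> 0" for t
  proof -
    have "(F has_vector_derivative T t x) (at t within {0..t + 1})"
      unfolding F_def using that
      by (intro integral_has_vector_derivative continuous_on_subset[OF continuous_on_T]) auto
    moreover have "at t within {0..t + 1} = at t within {0..}"
      by (rule at_within_nhd[of _ "{..<t + 1}"]) auto
    ultimately show ?thesis by simp
  qed
  \<comment> \<open>\<open>T h\<close> shifts the interval of integration by \<open>h\<close>. As
    functions of \<open>r\<close> both sides have the same derivative and both vanish at 0, so the
    operator need not be moved under the integral.\<close>
  have TF: "T h (F r) = F (r + h) - F h" if h: "h \<ge> 0" and r: "r \<ge> 0" for h r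
  proof -
    define g where "g s = T h (F s) - (F (s + h) - F h)" for s
    have "(g has_derivative (\<lambda>_. 0)) (at s within {0..})" if s: "s \<in> {0..}" for s
    proof -
      have "((\<lambda>s. T h (F s)) has_vector_derivative T h (T s x)) (at s within {0..})"
        using s by (intro bounded_linear.has_vector_derivative[OF bounded_linear_T[OF h] F]) auto
      moreover have "((F \<circ> (\<lambda>s. s + h)) has_vector_derivative 1 *\<^sub>R T (s + h) x) (at s within {0..})"
      proof (rule vector_diff_chain_within)
        show "((\<lambda>s. s + h) has_vector_derivative 1) (at s within {0..})"
          by (auto intro!: derivative_eq_intros simp: has_vector_derivative_def has_derivative_within)
        show "(F has_vector_derivative T (s + h) x) (at (s + h) within (\<lambda>s. s + h) ` {0..})"
          by (rule has_vector_derivative_within_subset[OF F]) (use s h in auto)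
      qed
      ultimately have "(g has_vector_derivative T h (T s x) - (T (s + h) x - 0)) (at s within {0..})"
        unfolding g_def o_def by (intro has_vector_derivative_diff has_vector_derivative_const) auto
      then show ?thesis
        using T_add[of h s x] s h by (simp add: add.commute has_vector_derivative_def)
    qed
    then have "\<exists>c. \<forall>s\<in>{0..}. g s = c"
      by (intro has_derivative_zero_constant) (auto simp: convex_real_interval)
    then have "g r = g 0" using r by auto
    then show ?thesis
      using linear_simps(3)[OF bounded_linear_T[OF h]] by (simp add: g_def F0)
  qed
  have quot: "((\<lambda>h. (F (t + h) - F t) /\<^sub>R h) \<longlongrightarrow> T t x) (at_right 0)" if t: "t \<ge> 0" for t
  proof (rule tendstoI)
    fix e :: real assume e: "e > 0"
    then obtain d where d: "d > 0" "\<And>s. s \<ge> 0 \<Longrightarrow> norm (s - t) < d \<Longrightarrow>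
        norm (F s - F t - (s - t) *\<^sub>R T t x) \<le> e / 2 * norm (s - t)"
      using F[OF t, unfolded has_vector_derivative_def has_derivative_within_alt, THEN conjunct2,
          rule_format, of "e / 2"] by auto
    have "dist ((F (t + h) - F t) /\<^sub>R h) (T t x) < e" if h: "0 < h" "h < d" for h
    proof -
      have "(F (t + h) - F t) /\<^sub>R h - T t x = (F (t + h) - F t - h *\<^sub>R T t x) /\<^sub>R h"
        using h by (simp add: scaleR_diff_right)
      also have "norm \<dots> = norm (F (t + h) - F t - h *\<^sub>R T t x) / h"
        using h by (simp add: divide_inverse mult.commute)
      also have "\<dots> \<le> e / 2 * h / h"
        using d(2)[of "t + h"] h t by (intro divide_right_mono) auto
      also have "\<dots> = e / 2" using h by simp
      finally show ?thesis using e by (simp add: dist_norm)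
    qed
    then show "\<forall>\<^sub>F h in at_right 0. dist ((F (t + h) - F t) /\<^sub>R h) (T t x) < e"
      using d(1) by (auto simp: eventually_at_right_field)
  qed
  have "((\<lambda>r. F r /\<^sub>R r) \<longlongrightarrow> x) (at_right 0)"
    using quot[of 0] by (simp add: F0)
  then have "\<forall>\<^sub>F r in at_right 0. dist (F r /\<^sub>R r) x < e"
    using assms by (rule tendstoD)
  then obtain r where r: "r > 0" "dist (F r /\<^sub>R r) x < e"
    unfolding eventually_at_right_field by (meson dense)
  have "((\<lambda>h. ((F (r + h) - F r) /\<^sub>R h - (F (0 + h) - F 0) /\<^sub>R h) /\<^sub>R r) \<longlongrightarrow> (T r x - T 0 x) /\<^sub>R r) (at_right 0)"
    using r by (intro tendsto_intros quot) auto
  moreover have "\<forall>\<^sub>F h in at_right 0. ((F (r + h) - F r) /\<^sub>R h - (F (0 + h) - F 0) /\<^sub>R h) /\<^sub>R r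
      = (T h (F r /\<^sub>R r) - F r /\<^sub>R r) /\<^sub>R h"
    using eventually_at_right_less[of "0::real"]
  proof eventually_elim
    case (elim h)
    then have "T h (F r /\<^sub>R r) = (F (r + h) - F h) /\<^sub>R r"
      using TF[of h r] r linear_simps(5)[OF bounded_linear_T[of h]] by simp
    moreover have "((F (r + h) - F r) /\<^sub>R h - F h /\<^sub>R h) /\<^sub>R r = ((F (r + h) - F h) /\<^sub>R r - F r /\<^sub>R r) /\<^sub>R h"
      by (simp add: scaleR_diff_right mult.commute)
    ultimately show ?case by (simp add: F0)
  qed
  ultimately have "((\<lambda>h. (T h (F r /\<^sub>R r) - F r /\<^sub>R r) /\<^sub>R h) \<longlongrightarrow> (T r x - T 0 x) /\<^sub>R r) (at_right 0)"
    by (rule Lim_transform_eventually)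
  then show ?thesis using r(2) by blast
qed

end

section \<open>Square-integrable functions\<close>

text \<open>The squared L2 norm on \<open>S\<close>; being in \<open>ennreal\<close>, it exists
  without any integrability assumption.\<close>

definition sqint :: "real set \<Rightarrow> (real \<Rightarrow> 'b::real_normed_vector) \<Rightarrow> ennreal" where
  "sqint S f = (\<integral>\<^sup>+ t. ennreal ((norm (f t))\<^sup>2) \<partial>lebesgue_on S)"

lemma borel_measurable_lebesgue_on_iff:
  fixes g :: "real \<Rightarrow> real"
  assumes "S \<in> sets lebesgue"
  shows "g \<in> borel_measurable (lebesgue_on S) \<longleftrightarrow> (\<lambda>t. indicator S t * g t) \<in> borel_measurable lebesgue"
  using assms by (subst borel_measurable_restrict_space_iff) (auto simp: mult.commute)

text \<open>The norms of the simple approximants are Borel, and so is their pointwise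
  \<open>lim\<close>, which agrees with the norm of \<open>f\<close> almost everywhere. Completeness
  of Lebesgue measure absorbs the null set, which is why the functions are first extended by 0 to
  the whole line.\<close>

lemma strongly_measurable_norm:
  fixes f :: "real \<Rightarrow> 'b::real_normed_vector"
  assumes S: "S \<in> sets lebesgue" and f: "strongly_measurable (lebesgue_on S) f"
  shows "(\<lambda>t. norm (f t)) \<in> borel_measurable (lebesgue_on S)"
proof -
  obtain s where s: "\<And>i::nat. simple_function (lebesgue_on S) (s i)"
    and lim: "AE t in lebesgue_on S. (\<lambda>i. s i t) \<longlonglongrightarrow> f t"
    using f unfolding strongly_measurable_def by blast
  define N where "N t = lim (\<lambda>i. norm (s i t))" for t
  have "simple_function (lebesgue_on S) (\<lambda>t. norm (s i t))" for i
    by (rule simple_function_compose1[OF s])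
  then have "(\<lambda>t. norm (s i t)) \<in> borel_measurable (lebesgue_on S)" for i
    by (rule borel_measurable_simple_function)
  then have "N \<in> borel_measurable (lebesgue_on S)"
    unfolding N_def by (rule borel_measurable_lim_metric)
  then have m: "(\<lambda>t. indicator S t * N t) \<in> borel_measurable lebesgue"
    unfolding borel_measurable_lebesgue_on_iff[OF S] .
  have "AE t in lebesgue. t \<in> S \<longrightarrow> (\<lambda>i. s i t) \<longlonglongrightarrow> f t"
    using lim S by (simp add: AE_restrict_space_iff)
  then have "AE t in lebesgue. indicator S t * N t = indicator S t * norm (f t)"
  proof eventually_elim
    case (elim t)
    then show ?case
      by (auto simp: N_def indicator_def intro!: limI tendsto_norm)
  qed
  then show ?thesis
    unfolding borel_measurable_lebesgue_on_iff[OF S] by (rule borel_measurable_AE[OF m])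
qed

text \<open>In a non-separable space a sum of Borel functions may fail to be Borel. Simple
  approximants can be combined pointwise, so strong measurability survives any sequentially
  continuous operation \<open>h\<close>.\<close>

lemma strongly_measurable_compose2:
  fixes f :: "'a \<Rightarrow> 'b::topological_space" and g :: "'a \<Rightarrow> 'c::topological_space"
  assumes f: "strongly_measurable M f" and g: "strongly_measurable M g"
    and h: "\<And>F a b X Y. (X \<longlongrightarrow> a) F \<Longrightarrow> (Y \<longlongrightarrow> b) F \<Longrightarrow> ((\<lambda>i::nat. h (X i) (Y i)) \<longlongrightarrow> h a b) F"
  shows "strongly_measurable M (\<lambda>t. h (f t) (g t))"
proof -
  obtain s where s: "\<And>i::nat. simple_function M (s i)" "AE t in M. (\<lambda>i. s i t) \<longlonglongrightarrow> f t"
    using f unfolding strongly_measurable_def by blast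
  obtain r where r: "\<And>i::nat. simple_function M (r i)" "AE t in M. (\<lambda>i. r i t) \<longlonglongrightarrow> g t"
    using g unfolding strongly_measurable_def by blast
  show ?thesis
    unfolding strongly_measurable_def
  proof (intro exI[of _ "\<lambda>i t. h (s i t) (r i t)"] conjI allI)
    show "simple_function M (\<lambda>t. h (s i t) (r i t))" for i
      by (rule simple_function_compose2[OF s(1) r(1)])
    show "AE t in M. (\<lambda>i. h (s i t) (r i t)) \<longlonglongrightarrow> h (f t) (g t)"
      using s(2) r(2) by eventually_elim (rule h)
  qed
qed

lemma strongly_measurable_lincomb:
  fixes f g :: "'a \<Rightarrow> 'b::complex_hilbert"
  assumes "strongly_measurable M f" "strongly_measurable M g"
  shows "strongly_measurable M (\<lambda>t. a *\<^sub>C f t + b *\<^sub>C g t)"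
  using assms by (rule strongly_measurable_compose2)
    (intro tendsto_add bounded_linear.tendsto[OF bounded_linear_scaleC])

lemma strongly_measurable_diff:
  fixes f g :: "'a \<Rightarrow> 'b::real_normed_vector"
  assumes "strongly_measurable M f" "strongly_measurable M g"
  shows "strongly_measurable M (\<lambda>t. f t - g t)"
  using assms by (rule strongly_measurable_compose2) (rule tendsto_diff)

lemma strongly_measurable_AE_zero:
  assumes "AE t in M. f t = 0"
  shows "strongly_measurable M f"
  unfolding strongly_measurable_def
proof (intro exI[of _ "\<lambda>_ _. 0"] conjI allI)
  show "AE t in M. (\<lambda>i. 0) \<longlonglongrightarrow> f t" using assms by eventually_elim simp
qed simp

text \<open>Sample \<open>f\<close> at the grid point to the left of \<open>t\<close>, with mesh
  below the modulus of uniform continuity. Left grid points of nonnegative times stay inside the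
  interval, and only finitely many occur.\<close>

lemma continuous_simple_approximation:
  fixes f :: "real \<Rightarrow> 'b::real_normed_vector"
  assumes f: "continuous_on {0..\<tau>} f" and e: "e > 0"
  shows "\<exists>s. simple_function (lebesgue_on {0..\<tau>}) s \<and> (\<forall>t\<in>{0..\<tau>}. norm (s t - f t) < e)"
proof -
  have "uniformly_continuous_on {0..\<tau>} f"
    by (rule compact_uniformly_continuous[OF f compact_Icc])
  then obtain d where d: "d > 0"
    "\<And>t s. t \<in> {0..\<tau>} \<Longrightarrow> s \<in> {0..\<tau>} \<Longrightarrow> dist s t < d \<Longrightarrow> dist (f s) (f t) < e"
    using e unfolding uniformly_continuous_on_def by metis
  define c where "c = d / 2"
  have c: "c > 0" "c < d" using d by (auto simp: c_def)
  define n where "n t = \<lfloor>t / c\<rfloor>" for t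
  have n: "of_int (n t) * c \<le> t" "t < of_int (n t) * c + c" for t
  proof -
    have "of_int (n t) \<le> t / c" "t / c < of_int (n t) + 1" unfolding n_def by linarith+
    then show "of_int (n t) * c \<le> t" "t < of_int (n t) * c + c" using c by (simp_all add: field_simps)
  qed
  have n0: "n t \<ge> 0" if "t \<ge> 0" for t using that c by (simp add: n_def)
  have "simple_function (lebesgue_on {0..\<tau>}) n"
    unfolding simple_function_def
  proof (intro conjI ballI)
    have "n ` {0..\<tau>} \<subseteq> {0..n \<tau>}"
      using n0 c by (auto simp: n_def intro!: floor_mono divide_right_mono)
    then show "finite (n ` space (lebesgue_on {0..\<tau>}))"
      by (auto intro: finite_subset)
    have "(\<lambda>t::real. t / c) \<in> borel_measurable (lebesgue_on {0..\<tau>})"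
      by (intro measurable_restrict_space1 measurable_completion) simp
    then have "n \<in> measurable (lebesgue_on {0..\<tau>}) (count_space UNIV)"
      unfolding n_def by (rule measurable_compose[OF _ measurable_real_floor])
    then show "n -` {x} \<inter> space (lebesgue_on {0..\<tau>}) \<in> sets (lebesgue_on {0..\<tau>})" for x
      by (rule measurable_sets) simp
  qed
  then have "simple_function (lebesgue_on {0..\<tau>}) (\<lambda>t. f (of_int (n t) * c))"
    by (rule simple_function_compose1)
  moreover have "norm (f (of_int (n t) * c) - f t) < e" if "t \<in> {0..\<tau>}" for t
    using d(2)[of t "of_int (n t) * c"] that n[of t] n0[of t] c
    by (auto simp: dist_norm)
  ultimately show ?thesis by blast
qed

text \<open>Diagonal choice: the simple function attached to \<open>f k\<close> has uniform error
  below \<open>inverse (real (Suc k))\<close>, so it shares the limit of the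
  \<open>f k\<close>.\<close>

lemma strongly_measurable_limit_continuous:
  fixes f :: "nat \<Rightarrow> real \<Rightarrow> 'b::real_normed_vector"
  assumes f: "\<And>k. continuous_on {0..\<tau>} (f k)"
    and lim: "AE t in lebesgue_on {0..\<tau>}. (\<lambda>k. f k t) \<longlonglongrightarrow> g t"
  shows "strongly_measurable (lebesgue_on {0..\<tau>}) g"
proof -
  have "\<exists>s. simple_function (lebesgue_on {0..\<tau>}) s \<and>
      (\<forall>t\<in>{0..\<tau>}. norm (s t - f k t) < inverse (real (Suc k)))" for k
    by (rule continuous_simple_approximation[OF f]) simp
  then obtain s where s: "\<And>k. simple_function (lebesgue_on {0..\<tau>}) (s k)"
    "\<And>k t. t \<in> {0..\<tau>} \<Longrightarrow> norm (s k t - f k t) < inverse (real (Suc k))" by metis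
  have "AE t in lebesgue_on {0..\<tau>}. (\<lambda>k. s k t) \<longlonglongrightarrow> g t"
    using lim AE_space
  proof eventually_elim
    case (elim t)
    then have "(\<lambda>k. s k t - f k t) \<longlonglongrightarrow> 0"
      using s(2)[of t] by (intro Lim_null_comparison[OF _ LIMSEQ_inverse_real_of_nat])
        (auto intro!: always_eventually less_imp_le)
    from tendsto_add[OF this elim(1)] show ?case by simp
  qed
  with s(1) show ?thesis unfolding strongly_measurable_def by blast
qed

lemma strongly_measurable_continuous:
  fixes f :: "real \<Rightarrow> 'b::real_normed_vector"
  shows "continuous_on {0..\<tau>} f \<Longrightarrow> strongly_measurable (lebesgue_on {0..\<tau>}) f"
  by (rule strongly_measurable_limit_continuous[of \<tau> "\<lambda>_. f"]) auto

text \<open>Local square integrability controls bounded intervals only, whereas the cost integrates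
  over the half-line; truncations to growing intervals converge pointwise.\<close>

lemma norm_measurable_Ici:
  fixes f :: "real \<Rightarrow> 'b::real_normed_vector"
  assumes "\<And>\<tau>. \<tau> > 0 \<Longrightarrow> (\<lambda>t. norm (f t)) \<in> borel_measurable (lebesgue_on {0..\<tau>})"
  shows "(\<lambda>t. norm (f t)) \<in> borel_measurable (lebesgue_on {0..})"
proof -
  have "(\<lambda>t. indicator {0..real (Suc n)} t * norm (f t)) \<in> borel_measurable lebesgue" for n
    using assms[of "real (Suc n)"] borel_measurable_lebesgue_on_iff[of "{0..real (Suc n)}"] by simp
  moreover have "(\<lambda>n. indicator {0..real (Suc n)} t * norm (f t)) \<longlonglongrightarrow> indicator {0..} t * norm (f t)" for t
  proof -
    obtain N where "t < real N" using reals_Archimedean2 by blast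
    then have "\<forall>\<^sub>F n in sequentially. indicator {0..} t * norm (f t) = indicator {0..real (Suc n)} t * norm (f t)"
      unfolding eventually_sequentially by (intro exI[of _ N]) (auto simp: indicator_def)
    then show ?thesis
      by (rule Lim_transform_eventually[OF tendsto_const])
  qed
  ultimately have "(\<lambda>t. indicator {0..} t * norm (f t)) \<in> borel_measurable lebesgue"
    by (rule borel_measurable_LIMSEQ_real[where u = "\<lambda>n t. indicator {0..real (Suc n)} t * norm (f t)", rotated])
  then show ?thesis using borel_measurable_lebesgue_on_iff[of "{0..}"] by simp
qed

section \<open>Estimates and limits for the squared L2 norm\<close>

lemma sqint_eq:
  assumes "S \<in> sets lebesgue"
  shows "sqint S f = (\<integral>\<^sup>+ t. ennreal ((norm (f t))\<^sup>2) * indicator S t \<partial>lebesgue)"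
  using assms unfolding sqint_def by (subst nn_integral_restrict_space) auto

lemma sqint_mono_set:
  assumes "S \<in> sets lebesgue" "S' \<in> sets lebesgue" "S \<subseteq> S'"
  shows "sqint S f \<le> sqint S' f"
  unfolding sqint_eq[OF assms(1)] sqint_eq[OF assms(2)]
  using assms(3) by (intro nn_integral_mono mult_left_mono) (auto simp: indicator_def)

lemma sqint_Ici:
  assumes "(\<lambda>t. norm (f t)) \<in> borel_measurable (lebesgue_on {0..})"
  shows "(\<lambda>n. sqint {0..real n} f) \<longlonglongrightarrow> sqint {0..} f"
proof -
  have m: "(\<lambda>t. indicator {0..} t * norm (f t)) \<in> borel_measurable lebesgue"
    using assms borel_measurable_lebesgue_on_iff[of "{0..}"] by simp
  have meas: "(\<lambda>t. ennreal ((norm (f t))\<^sup>2) * indicator {0..real n} t) \<in> borel_measurable lebesgue" for n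
  proof -
    have "(indicator {0..real n} :: real \<Rightarrow> ennreal) \<in> borel_measurable lebesgue"
      by (intro borel_measurable_indicator) simp
    with m have "(\<lambda>t. ennreal ((indicator {0..} t * norm (f t))\<^sup>2) * indicator {0..real n} t)
        \<in> borel_measurable lebesgue"
      by (intro borel_measurable_times_ennreal measurable_compose[OF _ measurable_ennreal] borel_measurable_power)
    moreover have "ennreal ((indicator {0..} t * norm (f t))\<^sup>2) * indicator {0..real n} t
        = ennreal ((norm (f t))\<^sup>2) * indicator {0..real n} t" for t
      by (auto simp: indicator_def)
    ultimately show ?thesis by simp
  qed
  have "(\<lambda>n. \<integral>\<^sup>+ t. ennreal ((norm (f t))\<^sup>2) * indicator {0..real n} t \<partial>lebesgue)
      \<longlonglongrightarrow> (\<integral>\<^sup>+ t. ennreal ((norm (f t))\<^sup>2) * indicator {0..} t \<partial>lebesgue)"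
  proof (rule nn_integral_LIMSEQ)
    show "incseq (\<lambda>n t. ennreal ((norm (f t))\<^sup>2) * indicator {0..real n} t)"
      by (intro incseq_SucI le_funI mult_left_mono) (auto simp: indicator_def)
    fix t :: real
    obtain N where "t < real N" using reals_Archimedean2 by blast
    then have "\<forall>\<^sub>F n in sequentially. ennreal ((norm (f t))\<^sup>2) * indicator {0..} t
        = ennreal ((norm (f t))\<^sup>2) * indicator {0..real n} t"
      unfolding eventually_sequentially by (intro exI[of _ N]) (auto simp: indicator_def)
    then show "(\<lambda>n. ennreal ((norm (f t))\<^sup>2) * indicator {0..real n} t)
        \<longlonglongrightarrow> ennreal ((norm (f t))\<^sup>2) * indicator {0..} t"
      by (rule Lim_transform_eventually[OF tendsto_const])
  qed (rule meas)
  then show ?thesis by (simp add: sqint_eq)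
qed

lemma sqint_has_integral:
  fixes f :: "real \<Rightarrow> 'b::real_normed_vector"
  assumes "((\<lambda>t. (norm (f t))\<^sup>2) has_integral I) S" "S \<in> sets lebesgue"
  shows "sqint S f = ennreal I"
  using nn_integral_has_integral_lebesgue'[OF _ assms(1)] assms(2)
  by (simp add: sqint_eq nn_integral_completion)

lemma sqint_cong_AE:
  "AE t in lebesgue_on S. f t = g t \<Longrightarrow> sqint S f = sqint S g"
  unfolding sqint_def by (intro nn_integral_cong_AE) (auto elim: eventually_mono)

lemma sqint_zero [simp]: "sqint S (\<lambda>t. 0) = 0"
  by (simp add: sqint_def)

text \<open>Square the triangle inequality and split the mixed product with weight \<open>d\<close>.
  The parameter stays free: 1 gives crude bounds for linear combinations, the optimal value gives
  sharp ones.\<close>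

lemma power2_norm_Young:
  fixes a b :: "'a::real_normed_vector"
  assumes "d > 0"
  shows "(norm a)\<^sup>2 \<le> (1 + d) * (norm b)\<^sup>2 + (1 + 1/d) * (norm (a - b))\<^sup>2"
proof -
  have "norm a \<le> norm b + norm (a - b)" by (metis norm_triangle_sub)
  then have "(norm a)\<^sup>2 \<le> (norm b + norm (a - b))\<^sup>2" by (intro power_mono) auto
  have "0 \<le> (d * norm b - norm (a - b))\<^sup>2 / d" using assms by simp
  moreover have "(d * p - q)\<^sup>2 / d = d * p\<^sup>2 - 2 * p * q + q\<^sup>2 / d" for p q
    using assms by (simp add: field_simps power2_eq_square)
  ultimately have "2 * norm b * norm (a - b) \<le> d * (norm b)\<^sup>2 + (norm (a - b))\<^sup>2 / d"
    by (smt (verit))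
  with \<open>(norm a)\<^sup>2 \<le> (norm b + norm (a - b))\<^sup>2\<close> show ?thesis by (simp add: power2_sum algebra_simps)
qed

lemma sqint_Young:
  fixes f g :: "real \<Rightarrow> 'b::real_normed_vector"
  assumes m: "(\<lambda>t. norm (g t)) \<in> borel_measurable (lebesgue_on S)"
    "(\<lambda>t. norm (f t - g t)) \<in> borel_measurable (lebesgue_on S)" and d: "d > 0"
  shows "sqint S f \<le> ennreal (1 + d) * sqint S g + ennreal (1 + 1/d) * sqint S (\<lambda>t. f t - g t)"
proof -
  have "sqint S f \<le> (\<integral>\<^sup>+ t. ennreal (1 + d) * ennreal ((norm (g t))\<^sup>2)
      + ennreal (1 + 1/d) * ennreal ((norm (f t - g t))\<^sup>2) \<partial>lebesgue_on S)"
    unfolding sqint_def using d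
    by (intro nn_integral_mono)
      (simp add: ennreal_mult[symmetric] ennreal_plus[symmetric] power2_norm_Young ennreal_leI del: ennreal_plus)
  also have "\<dots> = ennreal (1 + d) * sqint S g + ennreal (1 + 1/d) * sqint S (\<lambda>t. f t - g t)"
    unfolding sqint_def using m by (subst nn_integral_add) (auto simp: nn_integral_cmult)
  finally show ?thesis .
qed

text \<open>Optimizing the parameter of Young's inequality recovers Minkowski's inequality.\<close>

lemma sqrt_le_if_Young:
  fixes a b n :: real
  assumes "0 \<le> b" "0 \<le> n" and Y: "\<And>d. d > 0 \<Longrightarrow> a \<le> (1 + d) * b + (1 + 1/d) * n"
  shows "sqrt a \<le> sqrt b + sqrt n"
proof (rule field_le_epsilon)
  fix e :: real assume e: "e > 0"
  \<comment> \<open>The optimal parameter would be \<open>sqrt n / sqrt b\<close>; the shifts by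
    \<open>e/2\<close> keep numerator and denominator positive.\<close>
  define p m where "p = sqrt b + e/2" and "m = sqrt n + e/2"
  have pm: "p > 0" "m > 0" using assms e by (auto simp: p_def m_def add_nonneg_pos)
  have "(sqrt b)\<^sup>2 \<le> p\<^sup>2" "(sqrt n)\<^sup>2 \<le> m\<^sup>2"
    by (rule power_mono; use assms e in \<open>simp add: p_def m_def\<close>)+
  then have bn: "b \<le> p\<^sup>2" "n \<le> m\<^sup>2" using assms by simp_all
  have "a \<le> (1 + m/p) * b + (1 + 1/(m/p)) * n" using pm by (intro Y) simp
  also have "\<dots> \<le> (1 + m/p) * p\<^sup>2 + (1 + 1/(m/p)) * m\<^sup>2"
    using bn pm by (intro add_mono mult_left_mono) auto
  also have "\<dots> = (p + m)\<^sup>2"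
    using pm by (simp add: field_simps power2_eq_square)
  finally have "sqrt a \<le> p + m" using pm by (simp add: real_le_lsqrt)
  then show "sqrt a \<le> sqrt b + sqrt n + e" by (simp add: p_def m_def)
qed

text \<open>The reverse triangle inequality in L2: \<open>sqrt_le_if_Young\<close>, used in both
  directions, bounds the difference of the two norms by the norm of the difference. It is carried
  out on real numbers, because \<open>ennreal\<close> has no usable subtraction.\<close>

lemma sqint_tendsto:
  fixes f :: "nat \<Rightarrow> real \<Rightarrow> 'b::real_normed_vector"
  assumes mf: "\<And>k. (\<lambda>t. norm (f k t)) \<in> borel_measurable (lebesgue_on S)"
    and mg: "(\<lambda>t. norm (g t)) \<in> borel_measurable (lebesgue_on S)"
    and md: "\<And>k. (\<lambda>t. norm (f k t - g t)) \<in> borel_measurable (lebesgue_on S)"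
    and fin: "sqint S g < \<infinity>" "\<And>k. sqint S (f k) < \<infinity>"
    and lim: "(\<lambda>k. sqint S (\<lambda>t. f k t - g t)) \<longlonglongrightarrow> 0"
  shows "(\<lambda>k. sqint S (f k)) \<longlonglongrightarrow> sqint S g"
proof -
  define A n a where "A k = enn2real (sqint S (f k))"
    and "n k = enn2real (sqint S (\<lambda>t. f k t - g t))" and "a = enn2real (sqint S g)" for k
  have A: "sqint S (f k) = ennreal (A k)" and a: "sqint S g = ennreal a" for k
    using fin by (auto simp: A_def a_def)
  have nonneg: "A k \<ge> 0" "a \<ge> 0" "n k \<ge> 0" for k by (auto simp: A_def a_def n_def)
  have "\<forall>\<^sub>F k in sequentially. sqint S (\<lambda>t. f k t - g t) < 1"
    using order_tendstoD(2)[OF lim, of 1] by simp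
  \<comment> \<open>The difference is known to be finite only for large \<open>k\<close>; before
    that, \<open>n k\<close> carries no information, as \<open>enn2real\<close> sends infinity to
    0.\<close>
  then have ev: "\<forall>\<^sub>F k in sequentially. \<bar>sqrt (A k) - sqrt a\<bar> \<le> sqrt (n k)"
  proof eventually_elim
    case (elim k)
    then have n: "sqint S (\<lambda>t. f k t - g t) = ennreal (n k)"
      using ennreal_enn2real[of "sqint S (\<lambda>t. f k t - g t)"] order_less_trans[OF elim ennreal_one_less_top]
      by (simp add: n_def)
    have "sqint S (\<lambda>t. g t - f k t) = sqint S (\<lambda>t. f k t - g t)"
      by (simp add: sqint_def norm_minus_commute)
    moreover have "(\<lambda>t. norm (g t - f k t)) \<in> borel_measurable (lebesgue_on S)"
      using md[of k] by (simp add: norm_minus_commute)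
    ultimately have "A k \<le> (1 + d) * a + (1 + 1/d) * n k" "a \<le> (1 + d) * A k + (1 + 1/d) * n k"
      if "d > 0" for d
      using sqint_Young[OF mg md that, of k] sqint_Young[where f = g and g = "f k", OF mf _ that] that nonneg
      by (simp_all add: A a n ennreal_mult[symmetric] ennreal_plus[symmetric] del: ennreal_plus)
    then have "sqrt (A k) \<le> sqrt a + sqrt (n k)" "sqrt a \<le> sqrt (A k) + sqrt (n k)"
      using nonneg by (auto intro!: sqrt_le_if_Young)
    then show ?case by linarith
  qed
  have "n \<longlonglongrightarrow> 0"
    using tendsto_enn2real[where l = 0] lim unfolding n_def by simp
  then have "(\<lambda>k. sqrt (n k)) \<longlonglongrightarrow> 0" using tendsto_real_sqrt by fastforce
  then have "(\<lambda>k. sqrt (A k) - sqrt a) \<longlonglongrightarrow> 0"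
    by (rule Lim_null_comparison[rotated]) (use ev in simp)
  then have "(\<lambda>k. sqrt (A k)) \<longlonglongrightarrow> sqrt a" by (simp add: LIM_zero_iff)
  then have "(\<lambda>k. (sqrt (A k))\<^sup>2) \<longlonglongrightarrow> (sqrt a)\<^sup>2" by (rule tendsto_power)
  then have "A \<longlonglongrightarrow> a" using nonneg by simp
  then show ?thesis by (simp add: A a tendsto_ennrealI)
qed

text \<open>Young's inequality with parameter 1. The estimate is made under the integral, so only
  the norms of the two summands have to be measurable.\<close>

lemma sqint_lincomb:
  fixes f g :: "real \<Rightarrow> 'b::complex_hilbert"
  assumes f: "(\<lambda>t. norm (f t)) \<in> borel_measurable (lebesgue_on S)"
    and g: "(\<lambda>t. norm (g t)) \<in> borel_measurable (lebesgue_on S)"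
  shows "sqint S (\<lambda>t. a *\<^sub>C f t + b *\<^sub>C g t)
    \<le> ennreal (2 * (cmod a)\<^sup>2) * sqint S f + ennreal (2 * (cmod b)\<^sup>2) * sqint S g"
proof -
  have "(norm (a *\<^sub>C x + b *\<^sub>C y))\<^sup>2 \<le> 2 * (cmod a)\<^sup>2 * (norm x)\<^sup>2 + 2 * (cmod b)\<^sup>2 * (norm y)\<^sup>2" for x y :: 'b
    using power2_norm_Young[of 1 "a *\<^sub>C x + b *\<^sub>C y" "a *\<^sub>C x"]
    by (simp add: norm_scaleC power_mult_distrib)
  then have "sqint S (\<lambda>t. a *\<^sub>C f t + b *\<^sub>C g t) \<le> (\<integral>\<^sup>+ t. ennreal (2 * (cmod a)\<^sup>2) * ennreal ((norm (f t))\<^sup>2)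
      + ennreal (2 * (cmod b)\<^sup>2) * ennreal ((norm (g t))\<^sup>2) \<partial>lebesgue_on S)"
    unfolding sqint_def
    by (intro nn_integral_mono)
      (simp add: ennreal_mult[symmetric] ennreal_plus[symmetric] ennreal_leI del: ennreal_plus)
  also have "\<dots> = ennreal (2 * (cmod a)\<^sup>2) * sqint S f + ennreal (2 * (cmod b)\<^sup>2) * sqint S g"
    unfolding sqint_def using f g by (subst nn_integral_add) (auto simp: nn_integral_cmult)
  finally show ?thesis .
qed

lemma sqint_scaleC:
  fixes f :: "real \<Rightarrow> 'b::complex_hilbert"
  assumes "(\<lambda>t. norm (f t)) \<in> borel_measurable (lebesgue_on S)"
  shows "sqint S (\<lambda>t. c *\<^sub>C f t) = ennreal ((cmod c)\<^sup>2) * sqint S f"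
  unfolding sqint_def norm_scaleC power_mult_distrib
  using assms by (simp add: ennreal_mult nn_integral_cmult)

lemma sqint_parallelogram:
  fixes f g :: "real \<Rightarrow> 'b::real_inner"
  assumes "(\<lambda>t. norm (f t)) \<in> borel_measurable (lebesgue_on S)"
    "(\<lambda>t. norm (g t)) \<in> borel_measurable (lebesgue_on S)"
    "(\<lambda>t. norm (f t + g t)) \<in> borel_measurable (lebesgue_on S)"
    "(\<lambda>t. norm (f t - g t)) \<in> borel_measurable (lebesgue_on S)"
  shows "sqint S (\<lambda>t. f t + g t) + sqint S (\<lambda>t. f t - g t) = 2 * sqint S f + 2 * sqint S g"
proof -
  have "(norm (x + y))\<^sup>2 + (norm (x - y))\<^sup>2 = 2 * (norm x)\<^sup>2 + 2 * (norm y)\<^sup>2" for x y :: 'b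
    by (simp add: power2_norm_eq_inner inner_simps inner_commute)
  then have "ennreal ((norm (x + y))\<^sup>2) + ennreal ((norm (x - y))\<^sup>2)
      = ennreal 2 * ennreal ((norm x)\<^sup>2) + ennreal 2 * ennreal ((norm y)\<^sup>2)" for x y :: 'b
    by (simp only: ennreal_plus[symmetric] ennreal_mult[symmetric] zero_le_power2 mult_nonneg_nonneg zero_le_numeral)
  then have "(\<integral>\<^sup>+ t. ennreal ((norm (f t + g t))\<^sup>2) + ennreal ((norm (f t - g t))\<^sup>2) \<partial>lebesgue_on S)
      = (\<integral>\<^sup>+ t. ennreal 2 * ennreal ((norm (f t))\<^sup>2) + ennreal 2 * ennreal ((norm (g t))\<^sup>2) \<partial>lebesgue_on S)"
    by simp
  then show ?thesis
    unfolding sqint_def using assms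
    by (subst (asm) (1 2) nn_integral_add) (auto simp: nn_integral_cmult)
qed

lemma sqint_Fatou:
  fixes f :: "nat \<Rightarrow> real \<Rightarrow> 'b::real_normed_vector"
  assumes m: "\<And>j. (\<lambda>t. norm (f j t)) \<in> borel_measurable (lebesgue_on S)"
    and lim: "AE t in lebesgue_on S. (\<lambda>j. f j t) \<longlonglongrightarrow> g t"
    and le: "\<forall>\<^sub>F j in sequentially. sqint S (f j) \<le> c j" and c: "c \<longlonglongrightarrow> C"
  shows "sqint S g \<le> C"
proof -
  have "sqint S g = (\<integral>\<^sup>+ t. liminf (\<lambda>j. ennreal ((norm (f j t))\<^sup>2)) \<partial>lebesgue_on S)"
    unfolding sqint_def
  proof (rule nn_integral_cong_AE)
    show "AE t in lebesgue_on S. ennreal ((norm (g t))\<^sup>2) = liminf (\<lambda>j. ennreal ((norm (f j t))\<^sup>2))"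
      using lim
    proof eventually_elim
      case (elim t)
      then have "(\<lambda>j. ennreal ((norm (f j t))\<^sup>2)) \<longlonglongrightarrow> ennreal ((norm (g t))\<^sup>2)"
        by (intro tendsto_ennrealI tendsto_power tendsto_norm)
      then show ?case by (rule lim_imp_Liminf[OF sequentially_bot, symmetric])
    qed
  qed
  also have "\<dots> \<le> liminf (\<lambda>j. sqint S (f j))"
    unfolding sqint_def using m by (intro nn_integral_liminf) auto
  also have "\<dots> \<le> liminf c" by (rule Liminf_mono[OF le])
  also have "\<dots> = C" by (rule lim_imp_Liminf[OF sequentially_bot c])
  finally show ?thesis .
qed

lemma sqint_tail:
  fixes f :: "real \<Rightarrow> 'b::real_normed_vector"
  assumes "(\<lambda>t. norm (f t)) \<in> borel_measurable (lebesgue_on {0..})" and fin: "sqint {0..} f < \<infinity>"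
  shows "(\<lambda>n. sqint {real n..} f) \<longlonglongrightarrow> 0"
proof -
  have m: "(\<lambda>t. indicator {0..} t * norm (f t)) \<in> borel_measurable lebesgue"
    using assms borel_measurable_lebesgue_on_iff[of "{0..}"] by simp
  have meas: "(\<lambda>t. ennreal ((norm (f t))\<^sup>2) * indicator {real n..} t) \<in> borel_measurable lebesgue" for n
  proof -
    have "(indicator {real n..} :: real \<Rightarrow> ennreal) \<in> borel_measurable lebesgue"
      by (intro borel_measurable_indicator) simp
    with m have "(\<lambda>t. ennreal ((indicator {0..} t * norm (f t))\<^sup>2) * indicator {real n..} t)
        \<in> borel_measurable lebesgue"
      by (intro borel_measurable_times_ennreal measurable_compose[OF _ measurable_ennreal] borel_measurable_power)
    moreover have "ennreal ((indicator {0..} t * norm (f t))\<^sup>2) * indicator {real n..} t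
        = ennreal ((norm (f t))\<^sup>2) * indicator {real n..} t" for t
      by (auto simp: indicator_def)
    ultimately show ?thesis by simp
  qed
  have "(\<lambda>n. \<integral>\<^sup>+ t. ennreal ((norm (f t))\<^sup>2) * indicator {real n..} t \<partial>lebesgue)
      \<longlonglongrightarrow> (\<integral>\<^sup>+ t. 0 \<partial>(lebesgue :: real measure))"
  proof (rule nn_integral_dominated_convergence[where w = "\<lambda>t. ennreal ((norm (f t))\<^sup>2) * indicator {real 0..} t"])
    show "AE t in lebesgue. ennreal ((norm (f t))\<^sup>2) * indicator {real n..} t
        \<le> ennreal ((norm (f t))\<^sup>2) * indicator {real 0..} t" for n
      by (intro always_eventually allI mult_left_mono) (auto simp: indicator_def)
    show "(\<integral>\<^sup>+ t. ennreal ((norm (f t))\<^sup>2) * indicator {real 0..} t \<partial>lebesgue) < \<infinity>"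
      using fin by (simp add: sqint_eq)
    show "AE t in lebesgue. (\<lambda>n. ennreal ((norm (f t))\<^sup>2) * indicator {real n..} t) \<longlonglongrightarrow> 0"
    proof (intro always_eventually allI)
      fix t :: real
      obtain N where "t < real N" using reals_Archimedean2 by blast
      then have "\<forall>\<^sub>F n in sequentially. 0 = ennreal ((norm (f t))\<^sup>2) * indicator {real n..} t"
        unfolding eventually_sequentially by (intro exI[of _ N]) (auto simp: indicator_def)
      then show "(\<lambda>n. ennreal ((norm (f t))\<^sup>2) * indicator {real n..} t) \<longlonglongrightarrow> 0"
        by (rule Lim_transform_eventually[OF tendsto_const])
    qed
  qed (rule meas | simp)+
  then show ?thesis by (simp add: sqint_eq)
qed

lemma L2_loc_norm_measurable:
  fixes f :: "real \<Rightarrow> 'b::real_normed_vector"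
  assumes "L2_loc f"
  shows "(\<lambda>t. norm (f t)) \<in> borel_measurable (lebesgue_on {0..})"
  using assms by (intro norm_measurable_Ici strongly_measurable_norm) (auto simp: L2_loc_def L2_on_def)

lemma continuous_norm_measurable:
  fixes f :: "real \<Rightarrow> 'b::real_normed_vector"
  assumes "continuous_on {0..} f"
  shows "(\<lambda>t. norm (f t)) \<in> borel_measurable (lebesgue_on {0..})"
  using assms by (intro norm_measurable_Ici strongly_measurable_norm strongly_measurable_continuous)
    (auto intro: continuous_on_subset)

lemma continuous_diff_norm_measurable:
  fixes f g :: "real \<Rightarrow> 'b::real_normed_vector"
  assumes "continuous_on {0..} f" "L2_loc g"
  shows "(\<lambda>t. norm (f t - g t)) \<in> borel_measurable (lebesgue_on {0..})"
proof (intro norm_measurable_Ici strongly_measurable_norm strongly_measurable_diff)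
  fix \<tau> :: real assume \<tau>: "\<tau> > 0"
  show "strongly_measurable (lebesgue_on {0..\<tau>}) f"
    by (rule strongly_measurable_continuous[OF continuous_on_subset[OF assms(1)]]) auto
  show "strongly_measurable (lebesgue_on {0..\<tau>}) g"
    using assms(2) \<tau> by (auto simp: L2_loc_def L2_on_def)
qed simp

lemma norm_measurable_subset:
  "(\<lambda>t. norm (f t)) \<in> borel_measurable (lebesgue_on {0..}) \<Longrightarrow> S \<subseteq> {0..} \<Longrightarrow>
    (\<lambda>t. norm (f t)) \<in> borel_measurable (lebesgue_on S)"
  by (rule measurable_restrict_mono)

lemma sqint_continuous:
  fixes f :: "real \<Rightarrow> 'b::real_normed_vector"
  assumes "continuous_on {a..b} f"
  shows "sqint {a..b} f = ennreal (integral {a..b} (\<lambda>t. (norm (f t))\<^sup>2))"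
    "((\<lambda>t. (norm (f t))\<^sup>2) has_integral integral {a..b} (\<lambda>t. (norm (f t))\<^sup>2)) {a..b}"
proof -
  show "((\<lambda>t. (norm (f t))\<^sup>2) has_integral integral {a..b} (\<lambda>t. (norm (f t))\<^sup>2)) {a..b}"
    by (intro integrable_integral integrable_continuous_interval continuous_intros assms)
  then show "sqint {a..b} f = ennreal (integral {a..b} (\<lambda>t. (norm (f t))\<^sup>2))"
    by (rule sqint_has_integral) simp
qed

lemma sqint_L2_limit:
  fixes us :: "nat \<Rightarrow> real \<Rightarrow> 'b::real_normed_vector"
  assumes us: "\<And>k. continuous_on {0..} (us k)" and u: "L2_loc u"
    and lim: "\<And>\<tau>. \<tau> > 0 \<Longrightarrow> (\<lambda>k. sqint {0..\<tau>} (\<lambda>t. us k t - u t)) \<longlonglongrightarrow> 0"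
    and a: "0 \<le> a"
  shows "(\<lambda>k. sqint {a..b} (us k)) \<longlonglongrightarrow> sqint {a..b} u" "sqint {a..b} u < \<infinity>"
proof -
  \<comment> \<open>Positive and at least \<open>b\<close> in every case, also when \<open>b\<close>
    is not positive; the convergence assumption speaks of positive \<open>\<tau>\<close>
    only.\<close>
  define \<tau> where "\<tau> = \<bar>b\<bar> + 1"
  have \<tau>: "\<tau> > 0" "{a..b} \<subseteq> {0..\<tau>}" "{a..b} \<subseteq> {0..}" using a by (auto simp: \<tau>_def)
  have "sqint {a..b} u \<le> sqint {0..\<tau>} u" using \<tau> by (intro sqint_mono_set) auto
  also have "\<dots> < \<infinity>" using u \<tau> by (simp add: L2_loc_def L2_on_def sqint_def)
  finally show fin: "sqint {a..b} u < \<infinity>" .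
  show "(\<lambda>k. sqint {a..b} (us k)) \<longlonglongrightarrow> sqint {a..b} u"
  proof (rule sqint_tendsto[OF _ _ _ fin])
    show "(\<lambda>t. norm (us k t)) \<in> borel_measurable (lebesgue_on {a..b})"
      "(\<lambda>t. norm (u t)) \<in> borel_measurable (lebesgue_on {a..b})"
      "(\<lambda>t. norm (us k t - u t)) \<in> borel_measurable (lebesgue_on {a..b})" for k
      using continuous_norm_measurable[OF us] L2_loc_norm_measurable[OF u]
        continuous_diff_norm_measurable[OF us u] \<tau>(3)
      by (auto intro: norm_measurable_subset)
    show "sqint {a..b} (us k) < \<infinity>" for k
      using continuous_on_subset[OF us \<tau>(3)] by (simp add: sqint_continuous)
    show "(\<lambda>k. sqint {a..b} (\<lambda>t. us k t - u t)) \<longlonglongrightarrow> 0"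
      by (rule tendsto_sandwich[OF _ _ tendsto_const lim[OF \<tau>(1)]])
        (use \<tau> in \<open>auto intro!: always_eventually sqint_mono_set\<close>)
  qed
qed

lemma nn_integral_cost:
  assumes "L2_loc u" "L2_loc y"
  shows "(\<integral>\<^sup>+ t. ennreal ((norm (u t))\<^sup>2 + (norm (y t))\<^sup>2) \<partial>lebesgue_on {0..}) = sqint {0..} u + sqint {0..} y"
  using L2_loc_norm_measurable[OF assms(1)] L2_loc_norm_measurable[OF assms(2)]
  by (simp add: sqint_def nn_integral_add)

lemma L2_on_lincomb:
  fixes f g :: "real \<Rightarrow> 'b::complex_hilbert"
  assumes "L2_on S f" "L2_on S g" "S \<in> sets lebesgue"
  shows "L2_on S (\<lambda>t. a *\<^sub>C f t + b *\<^sub>C g t)"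
proof -
  have "sqint S f < \<infinity>" "sqint S g < \<infinity>" and sm: "strongly_measurable (lebesgue_on S) f" "strongly_measurable (lebesgue_on S) g"
    using assms by (auto simp: L2_on_def sqint_def)
  then have "ennreal (2 * (cmod a)\<^sup>2) * sqint S f + ennreal (2 * (cmod b)\<^sup>2) * sqint S g < \<infinity>"
    by (simp add: ennreal_mult_less_top)
  then have "sqint S (\<lambda>t. a *\<^sub>C f t + b *\<^sub>C g t) < \<infinity>"
    using sqint_lincomb[OF sm[THEN strongly_measurable_norm[OF assms(3)]], of a b] by (rule order_le_less_trans[rotated])
  then show ?thesis
    using strongly_measurable_lincomb[OF sm] by (simp add: L2_on_def sqint_def)
qed

lemma L2_on_zero: "L2_on S (\<lambda>t. 0 :: 'b::real_normed_vector)"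
  unfolding L2_on_def sqint_def[symmetric] by (simp add: strongly_measurable_AE_zero)

lemma ennreal_tendsto_zero_le:
  fixes f g :: "nat \<Rightarrow> ennreal"
  assumes "\<And>k. f k \<le> g k" "g \<longlonglongrightarrow> 0"
  shows "f \<longlonglongrightarrow> 0"
  by (rule tendsto_sandwich[of "\<lambda>_. 0" f sequentially g]) (use assms in auto)

lemma sqint_lincomb_tendsto:
  fixes f1 f2 :: "nat \<Rightarrow> real \<Rightarrow> 'b::complex_hilbert"
  assumes c: "\<And>k. continuous_on {0..} (f1 k)" "\<And>k. continuous_on {0..} (f2 k)" and L2: "L2_loc g1" "L2_loc g2"
    and 1: "(\<lambda>k. sqint {0..\<tau>} (\<lambda>t. f1 k t - g1 t)) \<longlonglongrightarrow> 0"
    and 2: "(\<lambda>k. sqint {0..\<tau>} (\<lambda>t. f2 k t - g2 t)) \<longlonglongrightarrow> 0"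
  shows "(\<lambda>k. sqint {0..\<tau>} (\<lambda>t. a *\<^sub>C f1 k t + b *\<^sub>C f2 k t - (a *\<^sub>C g1 t + b *\<^sub>C g2 t))) \<longlonglongrightarrow> 0"
proof -
  have m: "(\<lambda>t. norm (f1 k t - g1 t)) \<in> borel_measurable (lebesgue_on {0..\<tau>})"
    "(\<lambda>t. norm (f2 k t - g2 t)) \<in> borel_measurable (lebesgue_on {0..\<tau>})" for k
    by (rule norm_measurable_subset[OF continuous_diff_norm_measurable[OF c(1) L2(1)]], simp)
      (rule norm_measurable_subset[OF continuous_diff_norm_measurable[OF c(2) L2(2)]], simp)
  have eq: "a *\<^sub>C f1 k t + b *\<^sub>C f2 k t - (a *\<^sub>C g1 t + b *\<^sub>C g2 t) = a *\<^sub>C (f1 k t - g1 t) + b *\<^sub>C (f2 k t - g2 t)" for k t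
    by (simp add: linear_diff[OF linear_scaleC])
  have "(\<lambda>k. ennreal (2 * (cmod a)\<^sup>2) * sqint {0..\<tau>} (\<lambda>t. f1 k t - g1 t)
      + ennreal (2 * (cmod b)\<^sup>2) * sqint {0..\<tau>} (\<lambda>t. f2 k t - g2 t))
      \<longlonglongrightarrow> ennreal (2 * (cmod a)\<^sup>2) * 0 + ennreal (2 * (cmod b)\<^sup>2) * 0"
    by (intro tendsto_add ennreal_tendsto_cmult 1 2) simp_all
  then have "(\<lambda>k. ennreal (2 * (cmod a)\<^sup>2) * sqint {0..\<tau>} (\<lambda>t. f1 k t - g1 t)
      + ennreal (2 * (cmod b)\<^sup>2) * sqint {0..\<tau>} (\<lambda>t. f2 k t - g2 t)) \<longlonglongrightarrow> 0"
    by simp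
  then show ?thesis
    unfolding eq by (rule ennreal_tendsto_zero_le[OF sqint_lincomb[OF m]])
qed

section \<open>Energy balance along trajectories\<close>

text \<open>\<open>F\<close> need not be continuous for the norm of the state space. Continuity of
  both \<open>x\<close> and \<open>L\<close> along \<open>x\<close> makes the graph norm of the
  increments tend to 0, and that norm controls \<open>F\<close>.\<close>

lemma graph_bounded_continuous:
  assumes F: "graph_bounded_clinear D L F" and D: "csubspace D" and L: "clinear_on D L"
    and x: "continuous_on S x" "\<And>t. t \<in> S \<Longrightarrow> x t \<in> D" and Lx: "continuous_on S (\<lambda>t. L (x t))"
  shows "continuous_on S (\<lambda>t. F (x t))"
proof -
  obtain C where C: "\<And>x. x \<in> D \<Longrightarrow> norm (F x) \<le> C * graph_norm L x"
    and Flin: "clinear_on D F"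
    using F unfolding graph_bounded_clinear_def by blast
  have bound: "norm (F (x s) - F (x t)) \<le> C * sqrt ((norm (x s - x t))\<^sup>2 + (norm (L (x s) - L (x t)))\<^sup>2)"
    if "s \<in> S" "t \<in> S" for s t
    using C[of "x s - x t"] x(2)[OF that(1)] x(2)[OF that(2)]
    by (simp add: graph_norm_def clinear_onD[OF Flin D] clinear_onD[OF L D] csubspaceD[OF D])
  show ?thesis
    unfolding continuous_on_def
  proof
    fix t assume t: "t \<in> S"
    have "(x \<longlongrightarrow> x t) (at t within S)" "((\<lambda>t. L (x t)) \<longlongrightarrow> L (x t)) (at t within S)"
      using x(1) Lx t by (auto simp: continuous_on_def)
    then have "((\<lambda>s. C * sqrt ((norm (x s - x t))\<^sup>2 + (norm (L (x s) - L (x t)))\<^sup>2)) \<longlongrightarrow>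
        C * sqrt ((norm (x t - x t))\<^sup>2 + (norm (L (x t) - L (x t)))\<^sup>2)) (at t within S)"
      by (intro tendsto_intros)
    then have "((\<lambda>s. C * sqrt ((norm (x s - x t))\<^sup>2 + (norm (L (x s) - L (x t)))\<^sup>2)) \<longlongrightarrow> 0) (at t within S)"
      by simp
    moreover have "\<forall>\<^sub>F s in at t within S. norm (F (x s) - F (x t)) \<le>
        C * sqrt ((norm (x s - x t))\<^sup>2 + (norm (L (x s) - L (x t)))\<^sup>2)"
      using bound[OF _ t] by (auto simp: eventually_at_filter)
    ultimately have "((\<lambda>s. F (x s) - F (x t)) \<longlongrightarrow> 0) (at t within S)"
      by (rule Lim_null_comparison[rotated])
    then show "((\<lambda>t. F (x t)) \<longlongrightarrow> F (x t)) (at t within S)" by (simp add: LIM_zero_iff)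
  qed
qed

lemma has_integral_norm_derivative:
  fixes x :: "real \<Rightarrow> 'a::real_inner"
  assumes "a \<le> b" "\<And>t. t \<in> {a..b} \<Longrightarrow> (x has_vector_derivative x' t) (at t within {a..b})"
  shows "((\<lambda>t. 2 * inner (x' t) (x t)) has_integral (norm (x b))\<^sup>2 - (norm (x a))\<^sup>2) {a..b}"
  unfolding power2_norm_eq_inner
proof (rule fundamental_theorem_of_calculus[OF assms(1)])
  fix t assume "t \<in> {a..b}"
  then have "(x has_derivative (\<lambda>h. h *\<^sub>R x' t)) (at t within {a..b})"
    using assms(2) by (simp add: has_vector_derivative_def)
  from has_derivative_inner[OF this this]
  show "((\<lambda>t. inner (x t) (x t)) has_vector_derivative 2 * inner (x' t) (x t)) (at t within {a..b})"
    by (simp add: has_vector_derivative_def inner_commute algebra_simps)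
qed

text \<open>The left side of the passivity condition is the derivative of the squared norm of the
  state, so the condition integrates to an energy inequality. The initial time is arbitrary because
  trajectories are later compared from a late time on; keeping all terms additive avoids subtraction
  in \<open>ennreal\<close>.\<close>

lemma trajectory_energy:
  fixes x :: "real \<Rightarrow> 'x::complex_hilbert" and K :: "'x \<Rightarrow> 'y::complex_hilbert" and G :: "'x \<Rightarrow> 'u::complex_hilbert"
  assumes ab: "a \<le> b" and der: "\<And>t. t \<in> {a..b} \<Longrightarrow> (x has_vector_derivative L (x t)) (at t within {a..b})"
    and D: "\<And>t. t \<in> {a..b} \<Longrightarrow> x t \<in> D"
    and G: "continuous_on {a..b} (\<lambda>t. G (x t))" and K: "continuous_on {a..b} (\<lambda>t. K (x t))"
  shows "scattering_passive D G L K \<Longrightarrow>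
      ennreal ((norm (x b))\<^sup>2) + sqint {a..b} (\<lambda>t. K (x t)) \<le> ennreal ((norm (x a))\<^sup>2) + sqint {a..b} (\<lambda>t. G (x t))"
    "scattering_energy_preserving D G L K \<Longrightarrow>
      ennreal ((norm (x b))\<^sup>2) + sqint {a..b} (\<lambda>t. K (x t)) = ennreal ((norm (x a))\<^sup>2) + sqint {a..b} (\<lambda>t. G (x t))"
proof -
  define IK IG where "IK = integral {a..b} (\<lambda>t. (norm (K (x t)))\<^sup>2)"
    and "IG = integral {a..b} (\<lambda>t. (norm (G (x t)))\<^sup>2)"
  have nn: "IK \<ge> 0" "IG \<ge> 0"
    using has_integral_nonneg[OF sqint_continuous(2)[OF K]] has_integral_nonneg[OF sqint_continuous(2)[OF G]]
    by (auto simp: IK_def IG_def)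
  have int: "((\<lambda>t. 2 * inner (L (x t)) (x t)) has_integral (norm (x b))\<^sup>2 - (norm (x a))\<^sup>2) {a..b}"
    by (rule has_integral_norm_derivative[OF ab der])
  have diff: "((\<lambda>t. (norm (G (x t)))\<^sup>2 - (norm (K (x t)))\<^sup>2) has_integral IG - IK) {a..b}"
    unfolding IK_def IG_def by (intro has_integral_diff sqint_continuous(2) G K)
  have sq: "sqint {a..b} (\<lambda>t. K (x t)) = ennreal IK" "sqint {a..b} (\<lambda>t. G (x t)) = ennreal IG"
    using sqint_continuous(1)[OF K] sqint_continuous(1)[OF G] by (auto simp: IK_def IG_def)
  {
    assume "scattering_passive D G L K"
    then have "(norm (x b))\<^sup>2 - (norm (x a))\<^sup>2 \<le> IG - IK"
      using D by (intro has_integral_le[OF int diff]) (auto simp: scattering_passive_def inner_eq_Re_cinner)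
    then show "ennreal ((norm (x b))\<^sup>2) + sqint {a..b} (\<lambda>t. K (x t)) \<le>
        ennreal ((norm (x a))\<^sup>2) + sqint {a..b} (\<lambda>t. G (x t))"
      using nn by (simp add: sq ennreal_plus[symmetric] del: ennreal_plus)
  next
    assume "scattering_energy_preserving D G L K"
    then have "((\<lambda>t. (norm (G (x t)))\<^sup>2 - (norm (K (x t)))\<^sup>2) has_integral (norm (x b))\<^sup>2 - (norm (x a))\<^sup>2) {a..b}"
      using D by (intro has_integral_eq[OF _ int]) (auto simp: scattering_energy_preserving_def inner_eq_Re_cinner)
    then have "(norm (x b))\<^sup>2 - (norm (x a))\<^sup>2 = IG - IK"
      using diff by (rule has_integral_unique)
    then have "(norm (x b))\<^sup>2 + IK = (norm (x a))\<^sup>2 + IG" by simp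
    then show "ennreal ((norm (x b))\<^sup>2) + sqint {a..b} (\<lambda>t. K (x t)) =
        ennreal ((norm (x a))\<^sup>2) + sqint {a..b} (\<lambda>t. G (x t))"
      using nn by (simp add: sq ennreal_plus[symmetric] del: ennreal_plus)
  }
qed

lemma classical_solution_energy:
  fixes x :: "real \<Rightarrow> 'x::complex_hilbert" and K :: "'x \<Rightarrow> 'y::complex_hilbert" and G :: "'x \<Rightarrow> 'u::complex_hilbert"
  assumes sol: "classical_solution D G L K x u y" and \<tau>: "\<tau> \<ge> 0"
  shows "scattering_passive D G L K \<Longrightarrow>
      ennreal ((norm (x \<tau>))\<^sup>2) + sqint {0..\<tau>} y \<le> ennreal ((norm (x 0))\<^sup>2) + sqint {0..\<tau>} u"
    "scattering_energy_preserving D G L K \<Longrightarrow>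
      ennreal ((norm (x \<tau>))\<^sup>2) + sqint {0..\<tau>} y = ennreal ((norm (x 0))\<^sup>2) + sqint {0..\<tau>} u"
proof -
  have cu: "continuous_on {0..} u" and cy: "continuous_on {0..} y"
    and xt: "\<And>t. t \<ge> 0 \<Longrightarrow> x t \<in> D" "\<And>t. t \<ge> 0 \<Longrightarrow> G (x t) = u t" "\<And>t. t \<ge> 0 \<Longrightarrow> K (x t) = y t"
    and der: "\<And>t. t \<ge> 0 \<Longrightarrow> (x has_vector_derivative L (x t)) (at t within {0..})"
    using sol unfolding classical_solution_def by metis+
  have G: "continuous_on {0..\<tau>} (\<lambda>t. G (x t))"
    using continuous_on_subset[OF cu] xt(2) by (subst continuous_on_cong[OF refl, where g = u]) auto
  have K: "continuous_on {0..\<tau>} (\<lambda>t. K (x t))"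
    using continuous_on_subset[OF cy] xt(3) by (subst continuous_on_cong[OF refl, where g = y]) auto
  have sq: "sqint {0..\<tau>} (\<lambda>t. G (x t)) = sqint {0..\<tau>} u" "sqint {0..\<tau>} (\<lambda>t. K (x t)) = sqint {0..\<tau>} y"
    using xt(2,3) by (auto simp: sqint_def intro!: nn_integral_cong)
  have der': "(x has_vector_derivative L (x t)) (at t within {0..\<tau>})" if "t \<in> {0..\<tau>}" for t
    by (rule has_vector_derivative_within_subset[OF der]) (use that in auto)
  have D: "x t \<in> D" if "t \<in> {0..\<tau>}" for t using that xt(1) by auto
  note * = trajectory_energy[where D = D and G = G and L = L and K = K, OF \<tau> der' D G K, unfolded sq]
  show "scattering_passive D G L K \<Longrightarrow>
      ennreal ((norm (x \<tau>))\<^sup>2) + sqint {0..\<tau>} y \<le> ennreal ((norm (x 0))\<^sup>2) + sqint {0..\<tau>} u"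
    "scattering_energy_preserving D G L K \<Longrightarrow>
      ennreal ((norm (x \<tau>))\<^sup>2) + sqint {0..\<tau>} y = ennreal ((norm (x 0))\<^sup>2) + sqint {0..\<tau>} u"
    by (rule *(1); assumption) (rule *(2); assumption)
qed

lemma generalized_solutionE:
  assumes "generalized_solution D G L K x u y"
  obtains xs us ys where "\<And>k. classical_solution D G L K (xs k) (us k) (ys k)"
    "\<And>k. continuous_on {0..} (us k)" "\<And>k. continuous_on {0..} (ys k)"
    "\<And>t. t \<ge> 0 \<Longrightarrow> (\<lambda>k. xs k t) \<longlonglongrightarrow> x t"
    "\<And>\<tau>. \<tau> > 0 \<Longrightarrow> uniform_limit {0..\<tau>} xs x sequentially"
    "\<And>\<tau>. \<tau> > 0 \<Longrightarrow> (\<lambda>k. sqint {0..\<tau>} (\<lambda>t. us k t - u t)) \<longlonglongrightarrow> 0"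
    "\<And>\<tau>. \<tau> > 0 \<Longrightarrow> (\<lambda>k. sqint {0..\<tau>} (\<lambda>t. ys k t - y t)) \<longlonglongrightarrow> 0"
    "continuous_on {0..} x" "L2_loc u" "L2_loc y"
proof -
  obtain xs us ys where *: "\<And>k. classical_solution D G L K (xs k) (us k) (ys k)"
    "\<And>\<tau>. \<tau> > 0 \<Longrightarrow> uniform_limit {0..\<tau>} xs x sequentially"
    "\<And>\<tau>. \<tau> > 0 \<Longrightarrow> (\<lambda>k. sqint {0..\<tau>} (\<lambda>t. us k t - u t)) \<longlonglongrightarrow> 0"
    "\<And>\<tau>. \<tau> > 0 \<Longrightarrow> (\<lambda>k. sqint {0..\<tau>} (\<lambda>t. ys k t - y t)) \<longlonglongrightarrow> 0"
    and **: "continuous_on {0..} x" "L2_loc u" "L2_loc y"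
    using assms unfolding generalized_solution_def sqint_def by blast
  \<comment> \<open>The convergence is given on intervals of positive length only, hence
    \<open>t + 1\<close>, which also covers \<open>t = 0\<close>.\<close>
  have lim: "(\<lambda>k. xs k t) \<longlonglongrightarrow> x t" if "t \<ge> 0" for t
    by (rule tendsto_uniform_limitI[OF *(2)[of "t + 1"]]) (use that in auto)
  have "continuous_on {0..} (us k)" "continuous_on {0..} (ys k)" for k
    using *(1)[of k] unfolding classical_solution_def by blast+
  from that[OF *(1) this lim *(2-4) **] show thesis .
qed

lemma generalized_solution_energy:
  fixes x :: "real \<Rightarrow> 'x::complex_hilbert" and K :: "'x \<Rightarrow> 'y::complex_hilbert" and G :: "'x \<Rightarrow> 'u::complex_hilbert"
  assumes sol: "generalized_solution D G L K x u y" and \<tau>: "\<tau> \<ge> 0"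
    and pres: "scattering_energy_preserving D G L K"
  shows "ennreal ((norm (x \<tau>))\<^sup>2) + sqint {0..\<tau>} y = ennreal ((norm (x 0))\<^sup>2) + sqint {0..\<tau>} u"
proof -
  obtain xs us ys where s: "\<And>k. classical_solution D G L K (xs k) (us k) (ys k)"
    "\<And>k. continuous_on {0..} (us k)" "\<And>k. continuous_on {0..} (ys k)"
    "\<And>t. t \<ge> 0 \<Longrightarrow> (\<lambda>k. xs k t) \<longlonglongrightarrow> x t"
    "\<And>\<tau>. \<tau> > 0 \<Longrightarrow> uniform_limit {0..\<tau>} xs x sequentially"
    "\<And>\<tau>. \<tau> > 0 \<Longrightarrow> (\<lambda>k. sqint {0..\<tau>} (\<lambda>t. us k t - u t)) \<longlonglongrightarrow> 0"
    "\<And>\<tau>. \<tau> > 0 \<Longrightarrow> (\<lambda>k. sqint {0..\<tau>} (\<lambda>t. ys k t - y t)) \<longlonglongrightarrow> 0"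
    "continuous_on {0..} x" "L2_loc u" "L2_loc y"
    by (rule generalized_solutionE[OF sol], rule that)
  have lu: "(\<lambda>k. sqint {0..\<tau>} (us k)) \<longlonglongrightarrow> sqint {0..\<tau>} u"
    by (rule sqint_L2_limit(1)[OF s(2) s(9) s(6)]) auto
  have ly: "(\<lambda>k. sqint {0..\<tau>} (ys k)) \<longlonglongrightarrow> sqint {0..\<tau>} y"
    by (rule sqint_L2_limit(1)[OF s(3) s(10) s(7)]) auto
  have "(\<lambda>k. ennreal ((norm (xs k \<tau>))\<^sup>2) + sqint {0..\<tau>} (ys k)) \<longlonglongrightarrow> ennreal ((norm (x \<tau>))\<^sup>2) + sqint {0..\<tau>} y"
    by (intro tendsto_add ly tendsto_ennrealI tendsto_power tendsto_norm s(4) \<tau>)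
  moreover have "(\<lambda>k. ennreal ((norm (xs k 0))\<^sup>2) + sqint {0..\<tau>} (us k)) \<longlonglongrightarrow> ennreal ((norm (x 0))\<^sup>2) + sqint {0..\<tau>} u"
    by (intro tendsto_add lu tendsto_ennrealI tendsto_power tendsto_norm s(4)) simp
  moreover have "ennreal ((norm (xs k \<tau>))\<^sup>2) + sqint {0..\<tau>} (ys k) = ennreal ((norm (xs k 0))\<^sup>2) + sqint {0..\<tau>} (us k)" for k
    by (rule classical_solution_energy(2)[OF s(1) \<tau> pres])
  ultimately show ?thesis by (simp add: LIMSEQ_unique)
qed

section \<open>Passive boundary nodes\<close>

text \<open>A boundary node provides its semigroup only existentially. As a parameter, it can later
  be taken to be whichever semigroup is known to be stable.\<close>

locale passive_node =
  fixes D :: "'x::complex_hilbert set" and G :: "'x \<Rightarrow> 'u::complex_hilbert" and L :: "'x \<Rightarrow> 'x"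
    and K :: "'x \<Rightarrow> 'y::complex_hilbert" and T :: "real \<Rightarrow> 'x \<Rightarrow> 'x"
  assumes node: "boundary_node D G L K" and node_passive: "scattering_passive D G L K"
    and gen: "generates_semigroup {x\<in>D. G x = 0} L T"
begin

sublocale C0_semigroup_locale T
  by standard (use gen in \<open>simp add: generates_semigroup_def\<close>)

lemma subspace_D: "csubspace D" and linear_L: "clinear_on D L"
  and graph_K: "graph_bounded_clinear D L K"
  and linear_G: "clinear_on D G" and linear_K: "clinear_on D K"
  using node by (auto simp: boundary_node_def graph_bounded_clinear_def)

lemmas D_simps = csubspaceD[OF subspace_D] and L_simps = clinear_onD[OF linear_L subspace_D]
  and G_simps = clinear_onD[OF linear_G subspace_D] and K_simps = clinear_onD[OF linear_K subspace_D]

definition domA :: "'x set" where "domA = {x \<in> D. G x = 0}"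

lemma dom_D: "x \<in> domA \<Longrightarrow> x \<in> D"
  by (auto simp: domA_def)

lemma generator_iff: "((\<lambda>h. (T h x - x) /\<^sub>R h) \<longlongrightarrow> z) (at_right 0) \<longleftrightarrow> x \<in> domA \<and> L x = z"
  using gen by (simp add: generates_semigroup_def domA_def)

lemma dom_diff: "x \<in> domA \<Longrightarrow> z \<in> domA \<Longrightarrow> x - z \<in> domA"
  by (simp add: domA_def D_simps G_simps)

lemma dom_dense: "e > 0 \<Longrightarrow> \<exists>w\<in>domA. dist w x < e"
  using generator_domain_dense[of e x] by (auto simp: generator_iff)

text \<open>\<open>T t\<close> maps the difference quotient of \<open>x\<close> at 0 to that of
  \<open>T t x\<close>. Its limit exists by continuity of \<open>T t\<close>, and
  \<open>generator_iff\<close> reads off membership and value together.\<close>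

lemma T_dom:
  assumes "x \<in> domA" "t \<ge> 0"
  shows "T t x \<in> domA" "L (T t x) = T t (L x)"
proof -
  interpret bounded_linear "T t" using assms(2) by (rule bounded_linear_T)
  have "((\<lambda>h. (T h x - x) /\<^sub>R h) \<longlongrightarrow> L x) (at_right 0)"
    using assms(1) generator_iff[of x "L x"] by simp
  then have "((\<lambda>h. T t ((T h x - x) /\<^sub>R h)) \<longlongrightarrow> T t (L x)) (at_right 0)"
    by (rule tendsto)
  moreover have "\<forall>\<^sub>F h in at_right 0. T t ((T h x - x) /\<^sub>R h) = (T h (T t x) - T t x) /\<^sub>R h"
    using eventually_at_right_less[of "0::real"]
  proof eventually_elim
    case (elim h)
    then have "T t (T h x) = T h (T t x)"
      using T_add[of t h x] T_add[of h t x] assms(2) by (simp add: add.commute)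
    then show ?case by (simp add: scaleR diff)
  qed
  ultimately have "((\<lambda>h. (T h (T t x) - T t x) /\<^sub>R h) \<longlongrightarrow> T t (L x)) (at_right 0)"
    by (rule Lim_transform_eventually)
  then show "T t x \<in> domA" "L (T t x) = T t (L x)"
    using generator_iff[of "T t x" "T t (L x)"] by simp_all
qed

lemma has_vector_derivative_T_dom:
  assumes "x \<in> domA" "t \<ge> 0"
  shows "((\<lambda>t. T t x) has_vector_derivative L (T t x)) (at t within {0..})"
  using has_vector_derivative_T[of x "L x" t] generator_iff[of x "L x"] assms T_dom(2)[OF assms] by simp

text \<open>\<open>K\<close> is bounded in the graph norm, and \<open>L\<close> along the orbit
  equals the continuous orbit of \<open>L x\<close>.\<close>

lemma continuous_K_T: "x \<in> domA \<Longrightarrow> continuous_on {0..} (\<lambda>t. K (T t x))"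
proof (rule graph_bounded_continuous[OF graph_K subspace_D linear_L continuous_on_T])
  assume x: "x \<in> domA"
  show "T t x \<in> D" if "t \<in> {0..}" for t using that T_dom(1)[OF x] dom_D by simp
  show "continuous_on {0..} (\<lambda>t. L (T t x))"
    using continuous_on_T[of "L x"]
    by (subst continuous_on_cong[OF refl, where g = "\<lambda>t. T t (L x)"]) (auto simp: T_dom(2)[OF x])
qed

lemma classical_solution_T:
  assumes x: "x \<in> domA"
  shows "classical_solution D G L K (\<lambda>t. T t x) (\<lambda>t. 0) (\<lambda>t. K (T t x))"
  unfolding classical_solution_def
proof (intro conjI exI[of _ "\<lambda>t. T t (L x)"] allI impI)
  fix t :: real assume t: "0 \<le> t"
  show "((\<lambda>t. T t x) has_vector_derivative T t (L x)) (at t within {0..})" "T t (L x) = L (T t x)"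
    using has_vector_derivative_T_dom[OF x t] T_dom(2)[OF x t] by simp_all
  show "T t x \<in> D" "G (T t x) = 0" using T_dom(1)[OF x t] by (auto simp: domA_def)
qed (auto intro: continuous_on_T continuous_K_T x)

lemma T_energy_dom:
  assumes x: "x \<in> domA" and t: "t \<ge> 0"
  shows "ennreal ((norm (T t x))\<^sup>2) + sqint {0..t} (\<lambda>t. K (T t x)) \<le> ennreal ((norm x)\<^sup>2)"
  using classical_solution_energy(1)[OF classical_solution_T[OF x] t node_passive] by simp

text \<open>On \<open>domA\<close> this is the energy inequality with the output term dropped.
  Density extends it, since \<open>T t\<close> is already known to be continuous.\<close>

lemma contraction:
  assumes t: "t \<ge> 0"
  shows "norm (T t x) \<le> norm x"
proof -
  interpret bounded_linear "T t" using t by (rule bounded_linear_T)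
  have dom_le: "norm (T t w) \<le> norm w" if "w \<in> domA" for w
  proof -
    have "ennreal ((norm (T t w))\<^sup>2) \<le> ennreal ((norm w)\<^sup>2)"
      using T_energy_dom[OF that t] by (meson le_iff_add order_trans)
    then show ?thesis by (simp add: abs_le_square_iff[symmetric])
  qed
  have "\<exists>w\<in>domA. dist w x < inverse (real (Suc n))" for n by (rule dom_dense) simp
  then obtain w where w: "\<And>n. w n \<in> domA" "\<And>n. dist (w n) x < inverse (real (Suc n))" by metis
  have "w \<longlonglongrightarrow> x"
    by (rule metric_tendsto_imp_tendsto[OF LIMSEQ_inverse_real_of_nat])
      (use w(2) in \<open>auto intro!: always_eventually less_imp_le simp: dist_norm\<close>)
  then have "(\<lambda>n. norm (w n)) \<longlonglongrightarrow> norm x" "(\<lambda>n. norm (T t (w n))) \<longlonglongrightarrow> norm (T t x)"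
    by (auto intro!: tendsto_norm tendsto)
  then show ?thesis using dom_le[OF w(1)] by (intro LIMSEQ_le) auto
qed

text \<open>Infinite-time admissibility of \<open>K\<close> with constant 1: the energy inequality
  bounds the output energy on \<open>[0, n]\<close> independently of \<open>n\<close>. This lets
  outputs be defined for all initial states by approximation.\<close>

lemma K_T_energy:
  assumes x: "x \<in> domA"
  shows "sqint {0..} (\<lambda>t. K (T t x)) \<le> ennreal ((norm x)\<^sup>2)"
proof (rule LIMSEQ_le_const2[OF sqint_Ici[OF continuous_norm_measurable[OF continuous_K_T[OF x]]]])
  show "\<exists>N. \<forall>n\<ge>N. sqint {0..real n} (\<lambda>t. K (T t x)) \<le> ennreal ((norm x)\<^sup>2)"
  proof (intro exI[of _ 0] allI impI)
    fix n
    show "sqint {0..real n} (\<lambda>t. K (T t x)) \<le> ennreal ((norm x)\<^sup>2)"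
      by (rule order_trans[OF _ T_energy_dom[OF x of_nat_0_le_iff[of n]]]) simp
  qed
qed

section \<open>Linearity of the solution set and the zero input\<close>

lemma classical_solution_lincomb:
  assumes 1: "classical_solution D G L K x1 u1 y1" and 2: "classical_solution D G L K x2 u2 y2"
  shows "classical_solution D G L K (\<lambda>t. a *\<^sub>C x1 t + b *\<^sub>C x2 t) (\<lambda>t. a *\<^sub>C u1 t + b *\<^sub>C u2 t)
    (\<lambda>t. a *\<^sub>C y1 t + b *\<^sub>C y2 t)"
proof -
  note sc = bounded_linear_scaleC
  obtain d1 where d1: "continuous_on {0..} d1"
    "\<And>t. t \<ge> 0 \<Longrightarrow> (x1 has_vector_derivative d1 t) (at t within {0..}) \<and> d1 t = L (x1 t)"
    using 1 unfolding classical_solution_def by blast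
  obtain d2 where d2: "continuous_on {0..} d2"
    "\<And>t. t \<ge> 0 \<Longrightarrow> (x2 has_vector_derivative d2 t) (at t within {0..}) \<and> d2 t = L (x2 t)"
    using 2 unfolding classical_solution_def by blast
  have c: "continuous_on {0..} u1" "continuous_on {0..} y1" "continuous_on {0..} u2" "continuous_on {0..} y2"
    and f: "\<And>t. t \<ge> 0 \<Longrightarrow> x1 t \<in> D \<and> G (x1 t) = u1 t \<and> K (x1 t) = y1 t"
      "\<And>t. t \<ge> 0 \<Longrightarrow> x2 t \<in> D \<and> G (x2 t) = u2 t \<and> K (x2 t) = y2 t"
    using 1 2 unfolding classical_solution_def by blast+
  show ?thesis
    unfolding classical_solution_def
  proof (intro conjI exI[of _ "\<lambda>t. a *\<^sub>C d1 t + b *\<^sub>C d2 t"] allI impI)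
    show "continuous_on {0..} (\<lambda>t. a *\<^sub>C d1 t + b *\<^sub>C d2 t)"
      by (intro continuous_on_add bounded_linear.continuous_on[OF sc] d1 d2)
    show "continuous_on {0..} (\<lambda>t. a *\<^sub>C u1 t + b *\<^sub>C u2 t)" "continuous_on {0..} (\<lambda>t. a *\<^sub>C y1 t + b *\<^sub>C y2 t)"
      by (intro continuous_on_add bounded_linear.continuous_on[OF sc] c)+
    fix t :: real assume t: "0 \<le> t"
    show "((\<lambda>t. a *\<^sub>C x1 t + b *\<^sub>C x2 t) has_vector_derivative a *\<^sub>C d1 t + b *\<^sub>C d2 t) (at t within {0..})"
      using d1(2)[OF t] d2(2)[OF t]
      by (intro has_vector_derivative_add bounded_linear.has_vector_derivative[OF sc]) auto
    show "a *\<^sub>C d1 t + b *\<^sub>C d2 t = L (a *\<^sub>C x1 t + b *\<^sub>C x2 t)"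
      "a *\<^sub>C x1 t + b *\<^sub>C x2 t \<in> D"
      "G (a *\<^sub>C x1 t + b *\<^sub>C x2 t) = a *\<^sub>C u1 t + b *\<^sub>C u2 t"
      "K (a *\<^sub>C x1 t + b *\<^sub>C x2 t) = a *\<^sub>C y1 t + b *\<^sub>C y2 t"
      using d1(2)[OF t] d2(2)[OF t] f[OF t] by (simp_all add: D_simps L_simps G_simps K_simps)
  qed
qed

lemma generalized_solution_lincomb:
  assumes 1: "generalized_solution D G L K x1 u1 y1" and 2: "generalized_solution D G L K x2 u2 y2"
  shows "generalized_solution D G L K (\<lambda>t. a *\<^sub>C x1 t + b *\<^sub>C x2 t) (\<lambda>t. a *\<^sub>C u1 t + b *\<^sub>C u2 t)
    (\<lambda>t. a *\<^sub>C y1 t + b *\<^sub>C y2 t)"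
proof -
  note sc = bounded_linear_scaleC
  obtain xs us ys where s: "\<And>k. classical_solution D G L K (xs k) (us k) (ys k)"
    "\<And>k. continuous_on {0..} (us k)" "\<And>k. continuous_on {0..} (ys k)"
    "\<And>t. t \<ge> 0 \<Longrightarrow> (\<lambda>k. xs k t) \<longlonglongrightarrow> x1 t"
    "\<And>\<tau>. \<tau> > 0 \<Longrightarrow> uniform_limit {0..\<tau>} xs x1 sequentially"
    "\<And>\<tau>. \<tau> > 0 \<Longrightarrow> (\<lambda>k. sqint {0..\<tau>} (\<lambda>t. us k t - u1 t)) \<longlonglongrightarrow> 0"
    "\<And>\<tau>. \<tau> > 0 \<Longrightarrow> (\<lambda>k. sqint {0..\<tau>} (\<lambda>t. ys k t - y1 t)) \<longlonglongrightarrow> 0"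
    "continuous_on {0..} x1" "L2_loc u1" "L2_loc y1"
    by (rule generalized_solutionE[OF 1], rule that)
  obtain xr ur yr where r: "\<And>k. classical_solution D G L K (xr k) (ur k) (yr k)"
    "\<And>k. continuous_on {0..} (ur k)" "\<And>k. continuous_on {0..} (yr k)"
    "\<And>t. t \<ge> 0 \<Longrightarrow> (\<lambda>k. xr k t) \<longlonglongrightarrow> x2 t"
    "\<And>\<tau>. \<tau> > 0 \<Longrightarrow> uniform_limit {0..\<tau>} xr x2 sequentially"
    "\<And>\<tau>. \<tau> > 0 \<Longrightarrow> (\<lambda>k. sqint {0..\<tau>} (\<lambda>t. ur k t - u2 t)) \<longlonglongrightarrow> 0"
    "\<And>\<tau>. \<tau> > 0 \<Longrightarrow> (\<lambda>k. sqint {0..\<tau>} (\<lambda>t. yr k t - y2 t)) \<longlonglongrightarrow> 0"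
    "continuous_on {0..} x2" "L2_loc u2" "L2_loc y2"
    by (rule generalized_solutionE[OF 2], rule that)
  show ?thesis
    unfolding generalized_solution_def sqint_def[symmetric]
  proof (intro conjI exI[of _ "\<lambda>k t. a *\<^sub>C xs k t + b *\<^sub>C xr k t"] exI[of _ "\<lambda>k t. a *\<^sub>C us k t + b *\<^sub>C ur k t"]
      exI[of _ "\<lambda>k t. a *\<^sub>C ys k t + b *\<^sub>C yr k t"] allI impI)
    show "continuous_on {0..} (\<lambda>t. a *\<^sub>C x1 t + b *\<^sub>C x2 t)"
      by (intro continuous_on_add bounded_linear.continuous_on[OF sc] s(8) r(8))
    show "L2_loc (\<lambda>t. a *\<^sub>C u1 t + b *\<^sub>C u2 t)" "L2_loc (\<lambda>t. a *\<^sub>C y1 t + b *\<^sub>C y2 t)"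
      using s(9,10) r(9,10) by (auto simp: L2_loc_def intro!: L2_on_lincomb)
    show "classical_solution D G L K (\<lambda>t. a *\<^sub>C xs k t + b *\<^sub>C xr k t) (\<lambda>t. a *\<^sub>C us k t + b *\<^sub>C ur k t)
        (\<lambda>t. a *\<^sub>C ys k t + b *\<^sub>C yr k t)" for k
      by (rule classical_solution_lincomb[OF s(1) r(1)])
    fix \<tau> :: real assume \<tau>: "\<tau> > 0"
    show "uniform_limit {0..\<tau>} (\<lambda>k t. a *\<^sub>C xs k t + b *\<^sub>C xr k t) (\<lambda>t. a *\<^sub>C x1 t + b *\<^sub>C x2 t) sequentially"
      by (intro uniform_limit_add bounded_linear.uniform_limit[OF sc] s(5) r(5) \<tau>)
    show "(\<lambda>k. sqint {0..\<tau>} (\<lambda>t. a *\<^sub>C us k t + b *\<^sub>C ur k t - (a *\<^sub>C u1 t + b *\<^sub>C u2 t))) \<longlonglongrightarrow> 0"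
      by (rule sqint_lincomb_tendsto[OF s(2) r(2) s(9) r(9) s(6)[OF \<tau>] r(6)[OF \<tau>]])
    show "(\<lambda>k. sqint {0..\<tau>} (\<lambda>t. a *\<^sub>C ys k t + b *\<^sub>C yr k t - (a *\<^sub>C y1 t + b *\<^sub>C y2 t))) \<longlonglongrightarrow> 0"
      by (rule sqint_lincomb_tendsto[OF s(3) r(3) s(10) r(10) s(7)[OF \<tau>] r(7)[OF \<tau>]])
  qed
qed

text \<open>For a general initial state the output is an \<open>L\<^sup>2\<close> limit of outputs from states in \<open>domA\<close>; choosing the
  latter to converge geometrically makes the outputs converge almost everywhere.\<close>

lemma zero_input_solution:
  assumes u0: "AE t in lebesgue_on {0..}. u t = 0"
  shows "\<exists>y. generalized_solution D G L K (\<lambda>t. T t x0) u y \<and> sqint {0..} y \<le> ennreal ((norm x0)\<^sup>2)"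
proof -
  have "\<exists>w\<in>domA. dist w x0 < (1/4) ^ k" for k :: nat by (rule dom_dense) simp
  then obtain w where w: "\<And>k. w k \<in> domA" "\<And>k. dist (w k) x0 < (1/4) ^ k" by metis
  define Y where "Y k t = K (T t (w k))" for k t
  have quarter: "(\<lambda>k. (1/4::real) ^ k) \<longlonglongrightarrow> 0" by (rule LIMSEQ_power_zero) simp
  have wlim: "w \<longlonglongrightarrow> x0"
    by (rule metric_tendsto_imp_tendsto[OF quarter])
      (use w(2) in \<open>auto intro!: always_eventually less_imp_le\<close>)
  have Yc: "continuous_on {0..} (Y k)" for k
    unfolding Y_def by (rule continuous_K_T[OF w(1)])
  have Ydiff: "Y k t - Y j t = K (T t (w k - w j))" if "t \<ge> 0" for k j t
    using linear_simps(2)[OF bounded_linear_T[OF that]] T_dom(1)[OF w(1) that]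
    by (simp add: Y_def K_simps dom_D)
  have Ydm: "(\<lambda>t. norm (Y k t - Y j t)) \<in> borel_measurable (lebesgue_on {0..})" for k j
    by (rule continuous_norm_measurable) (intro continuous_on_diff Yc)
  have wdiff: "norm (w k - w j) \<le> 2 * (1/4) ^ k" if "j \<ge> k" for k j
  proof -
    have "norm (w k - w j) \<le> dist (w k) x0 + dist (w j) x0"
      by (metis dist_norm dist_triangle2)
    also have "\<dots> \<le> (1/4) ^ k + (1/4) ^ j" using w(2)[of k] w(2)[of j] by linarith
    also have "(1/4::real) ^ j \<le> (1/4) ^ k" using that by (intro power_decreasing) auto
    finally show ?thesis by simp
  qed
  have Ysq: "sqint {0..} (\<lambda>t. Y k t - Y j t) \<le> ennreal ((2 * (1/4) ^ k)\<^sup>2)" if "j \<ge> k" for k j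
  proof -
    have "sqint {0..} (\<lambda>t. Y k t - Y j t) = sqint {0..} (\<lambda>t. K (T t (w k - w j)))"
      unfolding sqint_def by (intro nn_integral_cong) (simp add: Ydiff)
    also have "\<dots> \<le> ennreal ((norm (w k - w j))\<^sup>2)"
      by (rule K_T_energy[OF dom_diff[OF w(1) w(1)]])
    also have "\<dots> \<le> ennreal ((2 * (1/4) ^ k)\<^sup>2)"
      using wdiff[OF that] by (intro ennreal_leI power_mono) auto
    finally show ?thesis .
  qed
  \<comment> \<open>The squared distances decay like \<open>(1/16) ^ k\<close>, so the weights
    \<open>2 ^ k\<close> keep the sum finite. At almost every \<open>t\<close> the weighted sum is
    then some finite \<open>C\<close>, and the increments of \<open>Y k t\<close> are at most
    \<open>sqrt C * (sqrt (1/2)) ^ k\<close>, which is summable.\<close>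
  have "(\<integral>\<^sup>+ t. (\<Sum>k. ennreal (2 ^ k) * ennreal ((norm (Y k t - Y (Suc k) t))\<^sup>2)) \<partial>lebesgue_on {0..})
      = (\<Sum>k. ennreal (2 ^ k) * sqint {0..} (\<lambda>t. Y k t - Y (Suc k) t))"
    unfolding sqint_def using Ydm by (subst nn_integral_suminf) (auto simp: nn_integral_cmult)
  also have "\<dots> \<le> (\<Sum>k. ennreal (2 ^ k) * ennreal ((2 * (1/4) ^ k)\<^sup>2))"
    by (intro suminf_le mult_left_mono Ysq summableI) auto
  also have "\<dots> = (\<Sum>k. ennreal (4 * (1/8) ^ k))"
  proof -
    have "2 ^ k * (2 * (1/4) ^ k)\<^sup>2 = 4 * (1/8::real) ^ k" for k
    proof -
      have "p * (2 * q)\<^sup>2 = 4 * (p * q * q)" for p q :: real by (simp add: power2_eq_square)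
      also have "2 ^ k * (1/4) ^ k * (1/4) ^ k = (2 * (1/4) * (1/4) :: real) ^ k"
        by (simp only: power_mult_distrib)
      finally show ?thesis by simp
    qed
    then have "ennreal (2 ^ k) * ennreal ((2 * (1/4) ^ k)\<^sup>2) = ennreal (4 * (1/8) ^ k)" for k
      by (simp only: ennreal_mult[symmetric] zero_le_power zero_le_numeral zero_le_power2)
    then show ?thesis by (simp only:)
  qed
  also have "\<dots> < \<infinity>"
  proof -
    have "summable (\<lambda>k. 4 * (1/8::real) ^ k)" by (intro summable_mult summable_geometric) simp
    then show ?thesis
      unfolding infinity_ennreal_def less_top[symmetric] by (rule ennreal_suminf_neq_top) simp
  qed
  finally have "AE t in lebesgue_on {0..}. (\<Sum>k. ennreal (2 ^ k) * ennreal ((norm (Y k t - Y (Suc k) t))\<^sup>2)) \<noteq> \<infinity>"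
    using Ydm by (intro nn_integral_PInf_AE) auto
  then have conv: "AE t in lebesgue_on {0..}. convergent (\<lambda>k. Y k t)"
  proof eventually_elim
    case (elim t)
    then obtain C where C: "(\<Sum>k. ennreal (2 ^ k) * ennreal ((norm (Y k t - Y (Suc k) t))\<^sup>2)) = ennreal C" "C \<ge> 0"
      by (cases "\<Sum>k. ennreal (2 ^ k) * ennreal ((norm (Y k t - Y (Suc k) t))\<^sup>2)") auto
    have "norm (Y (Suc k) t - Y k t) \<le> sqrt C * (sqrt (1/2)) ^ k" for k
    proof -
      have "ennreal (2 ^ k) * ennreal ((norm (Y k t - Y (Suc k) t))\<^sup>2) \<le> ennreal C"
        unfolding C(1)[symmetric]
        using sum_le_suminf[of "\<lambda>k. ennreal (2 ^ k) * ennreal ((norm (Y k t - Y (Suc k) t))\<^sup>2)" "{k}"]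
        by (simp add: summableI)
      then have "2 ^ k * (norm (Y (Suc k) t - Y k t))\<^sup>2 \<le> C"
        using C(2) by (simp add: ennreal_mult[symmetric] norm_minus_commute)
      then have "(norm (Y (Suc k) t - Y k t))\<^sup>2 \<le> C * (1/2) ^ k"
        by (simp add: field_simps)
      then have "norm (Y (Suc k) t - Y k t) \<le> sqrt (C * (1/2) ^ k)" by (rule real_le_rsqrt)
      then show ?thesis by (simp add: real_sqrt_mult real_sqrt_power)
    qed
    moreover have "summable (\<lambda>k. sqrt C * (sqrt (1/2)) ^ k)"
      by (intro summable_mult summable_geometric) simp
    ultimately have "summable (\<lambda>k. Y (Suc k) t - Y k t)"
      using summable_comparison_test'[of "\<lambda>k. sqrt C * (sqrt (1/2)) ^ k" 0 "\<lambda>k. Y (Suc k) t - Y k t"] by blast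
    then have "convergent (\<lambda>n. \<Sum>k<n. Y (Suc k) t - Y k t)" by (simp add: summable_iff_convergent)
    moreover have "(\<Sum>k<n. Y (Suc k) t - Y k t) = Y n t - Y 0 t" for n
      by (induction n) simp_all
    ultimately have "convergent (\<lambda>n. Y n t - Y 0 t)" by simp
    from convergent_add[OF this convergent_const[of "Y 0 t"]] show ?case by simp
  qed
  define y where "y t = lim (\<lambda>k. Y k t)" for t
  have Ylim: "AE t in lebesgue_on {0..}. (\<lambda>k. Y k t) \<longlonglongrightarrow> y t"
    using conv by eventually_elim (simp add: y_def convergent_LIMSEQ_iff)
  have ysq: "sqint {0..} y \<le> ennreal ((norm x0)\<^sup>2)"
  proof (rule sqint_Fatou[OF continuous_norm_measurable[OF Yc] Ylim])
    show "\<forall>\<^sub>F j in sequentially. sqint {0..} (Y j) \<le> ennreal ((norm (w j))\<^sup>2)"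
      unfolding Y_def by (intro always_eventually allI K_T_energy w(1))
    show "(\<lambda>j. ennreal ((norm (w j))\<^sup>2)) \<longlonglongrightarrow> ennreal ((norm x0)\<^sup>2)"
      by (intro tendsto_ennrealI tendsto_power tendsto_norm wlim)
  qed
  \<comment> \<open>Fatou in the second index turns the Cauchy estimate into a rate of convergence
    to \<open>y\<close>.\<close>
  have Yysq: "sqint {0..} (\<lambda>t. Y k t - y t) \<le> ennreal ((2 * (1/4) ^ k)\<^sup>2)" for k
  proof (rule sqint_Fatou[OF Ydm])
    show "AE t in lebesgue_on {0..}. (\<lambda>j. Y k t - Y j t) \<longlonglongrightarrow> Y k t - y t"
      using Ylim by eventually_elim (intro tendsto_intros)
    show "\<forall>\<^sub>F j in sequentially. sqint {0..} (\<lambda>t. Y k t - Y j t) \<le> ennreal ((2 * (1/4) ^ k)\<^sup>2)"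
      using eventually_ge_at_top[of k] by eventually_elim (rule Ysq)
  qed (rule tendsto_const)
  have AE_sub: "AE t in lebesgue_on {0..\<tau>}. P t" if "AE t in lebesgue_on {0..}. P t" for P and \<tau> :: real
    using that by (auto simp: AE_restrict_space_iff elim!: eventually_mono)
  have y_loc: "L2_loc y"
    unfolding L2_loc_def L2_on_def sqint_def[symmetric]
  proof (intro allI impI conjI)
    fix \<tau> :: real assume "\<tau> > 0"
    show "strongly_measurable (lebesgue_on {0..\<tau>}) y"
      by (rule strongly_measurable_limit_continuous[OF continuous_on_subset[OF Yc] AE_sub[OF Ylim]]) auto
    have "sqint {0..\<tau>} y \<le> sqint {0..} y" by (rule sqint_mono_set) auto
    with ysq show "sqint {0..\<tau>} y < \<infinity>" by (simp add: le_less_trans)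
  qed
  \<comment> \<open>\<open>u\<close> may differ from 0 on a null set, as optimal controls are
    determined only up to null sets; the approximating inputs are exactly 0.\<close>
  have u_zero: "sqint {0..\<tau>} u = 0" for \<tau>
    using sqint_cong_AE[OF AE_sub[OF u0]] by simp
  have u_loc: "L2_loc u"
    unfolding L2_loc_def L2_on_def sqint_def[symmetric]
    by (auto simp: u_zero intro!: strongly_measurable_AE_zero AE_sub u0)
  have "generalized_solution D G L K (\<lambda>t. T t x0) u y"
    unfolding generalized_solution_def sqint_def[symmetric]
  proof (intro conjI exI[of _ "\<lambda>k t. T t (w k)"] exI[of _ "\<lambda>k t. 0 :: 'u"] exI[of _ Y] allI impI)
    show "continuous_on {0..} (\<lambda>t. T t x0)" by (rule continuous_on_T)
    show "classical_solution D G L K (\<lambda>t. T t (w k)) (\<lambda>t. 0) (Y k)" for k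
      unfolding Y_def by (rule classical_solution_T[OF w(1)])
    fix \<tau> :: real assume "\<tau> > 0"
    show "uniform_limit {0..\<tau>} (\<lambda>k t. T t (w k)) (\<lambda>t. T t x0) sequentially"
    proof (rule uniform_limitI)
      fix e :: real assume "e > 0"
      with wlim have "\<forall>\<^sub>F k in sequentially. dist (w k) x0 < e" by (rule tendstoD)
      then show "\<forall>\<^sub>F k in sequentially. \<forall>t\<in>{0..\<tau>}. dist (T t (w k)) (T t x0) < e"
      proof eventually_elim
        case (elim k)
        have "dist (T t (w k)) (T t x0) \<le> dist (w k) x0" if "t \<in> {0..\<tau>}" for t
          using contraction[of t "w k - x0"] that linear_simps(2)[OF bounded_linear_T[of t]]
          by (simp add: dist_norm)
        with elim show ?case by (meson le_less_trans)
      qed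
    qed
    show "(\<lambda>k. sqint {0..\<tau>} (\<lambda>t. 0 - u t)) \<longlonglongrightarrow> 0"
      using u_zero[of \<tau>] by (simp add: sqint_def)
    have "(\<lambda>k. ennreal ((2 * (1/4) ^ k)\<^sup>2)) \<longlonglongrightarrow> ennreal ((2 * 0)\<^sup>2)"
      by (intro tendsto_ennrealI tendsto_power tendsto_mult quarter tendsto_const)
    moreover have "sqint {0..\<tau>} (\<lambda>t. Y k t - y t) \<le> ennreal ((2 * (1/4) ^ k)\<^sup>2)" for k
      by (rule order_trans[OF sqint_mono_set Yysq]) auto
    ultimately show "(\<lambda>k. sqint {0..\<tau>} (\<lambda>t. Y k t - y t)) \<longlonglongrightarrow> 0"
      using ennreal_tendsto_zero_le[of "\<lambda>k. sqint {0..\<tau>} (\<lambda>t. Y k t - y t)"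
          "\<lambda>k. ennreal ((2 * (1/4) ^ k)\<^sup>2)"] by simp
  qed (rule u_loc y_loc)+
  with ysq show ?thesis by blast
qed

text \<open>Subtracting a free trajectory does not change the input, so the energy inequality applies with the same \<open>u\<close>.\<close>

lemma distance_to_free_trajectory:
  assumes sol: "generalized_solution D G L K x u y" and w: "w \<in> domA" and s: "0 \<le> s" and st: "s \<le> t"
  shows "ennreal ((norm (x t - T (t - s) w))\<^sup>2) \<le> ennreal ((norm (x s - w))\<^sup>2) + sqint {s..t} u"
proof -
  obtain xs us ys where a: "\<And>k. classical_solution D G L K (xs k) (us k) (ys k)"
    "\<And>k. continuous_on {0..} (us k)" "\<And>k. continuous_on {0..} (ys k)"
    "\<And>t. t \<ge> 0 \<Longrightarrow> (\<lambda>k. xs k t) \<longlonglongrightarrow> x t"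
    "\<And>\<tau>. \<tau> > 0 \<Longrightarrow> uniform_limit {0..\<tau>} xs x sequentially"
    "\<And>\<tau>. \<tau> > 0 \<Longrightarrow> (\<lambda>k. sqint {0..\<tau>} (\<lambda>t. us k t - u t)) \<longlonglongrightarrow> 0"
    "\<And>\<tau>. \<tau> > 0 \<Longrightarrow> (\<lambda>k. sqint {0..\<tau>} (\<lambda>t. ys k t - y t)) \<longlonglongrightarrow> 0"
    "continuous_on {0..} x" "L2_loc u" "L2_loc y"
    by (rule generalized_solutionE[OF sol], rule that)
  have lim_u: "(\<lambda>k. sqint {s..t} (us k)) \<longlonglongrightarrow> sqint {s..t} u"
    by (rule sqint_L2_limit(1)[OF a(2) a(9) a(6) s])
  have step: "ennreal ((norm (xs k t - T (t - s) w))\<^sup>2) \<le> ennreal ((norm (xs k s - w))\<^sup>2) + sqint {s..t} (us k)" for k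
  proof -
    \<comment> \<open>Because \<open>w\<close> lies in \<open>domA\<close>, the subtracted orbit is
      differentiable and annihilated by \<open>G\<close>; hence \<open>z\<close> is a trajectory on
      \<open>[s, t]\<close> with input \<open>us k\<close>.\<close>
    define z where "z r = xs k r - T (r - s) w" for r
    have c: "continuous_on {0..} (ys k)"
      and f: "\<And>r. r \<ge> 0 \<Longrightarrow> xs k r \<in> D \<and> G (xs k r) = us k r \<and> K (xs k r) = ys k r"
      and d: "\<And>r. r \<ge> 0 \<Longrightarrow> (xs k has_vector_derivative L (xs k r)) (at r within {0..})"
      using a(1)[of k] unfolding classical_solution_def by metis+
    have Tw: "T (r - s) w \<in> domA" if "r \<in> {s..t}" for r using T_dom(1)[OF w] that by simp
    have zG: "G (z r) = us k r" and zK: "K (z r) = ys k r - K (T (r - s) w)" and zD: "z r \<in> D"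
      and zL: "L (z r) = L (xs k r) - L (T (r - s) w)" if "r \<in> {s..t}" for r
      using f[of r] that s Tw[OF that] by (auto simp: z_def G_simps K_simps D_simps L_simps domA_def)
    have "ennreal ((norm (z t))\<^sup>2) + sqint {s..t} (\<lambda>r. K (z r)) \<le> ennreal ((norm (z s))\<^sup>2) + sqint {s..t} (\<lambda>r. G (z r))"
    proof (rule trajectory_energy(1)[OF st _ _ _ _ node_passive])
      fix r assume r: "r \<in> {s..t}"
      have "((\<lambda>r. T r w) \<circ> (\<lambda>r. r - s) has_vector_derivative 1 *\<^sub>R L (T (r - s) w)) (at r within {s..t})"
      proof (rule vector_diff_chain_within)
        show "((\<lambda>r. r - s) has_vector_derivative 1) (at r within {s..t})"
          by (auto intro!: derivative_eq_intros simp: has_vector_derivative_def)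
        show "((\<lambda>r. T r w) has_vector_derivative L (T (r - s) w)) (at (r - s) within (\<lambda>r. r - s) ` {s..t})"
          by (rule has_vector_derivative_within_subset[OF has_vector_derivative_T_dom[OF w]]) (use r in auto)
      qed
      moreover have "(xs k has_vector_derivative L (xs k r)) (at r within {s..t})"
        by (rule has_vector_derivative_within_subset[OF d]) (use r s in auto)
      ultimately have "((\<lambda>r. xs k r - T (r - s) w) has_vector_derivative L (xs k r) - 1 *\<^sub>R L (T (r - s) w))
          (at r within {s..t})"
        unfolding o_def by (intro has_vector_derivative_diff)
      then show "(z has_vector_derivative L (z r)) (at r within {s..t})"
        unfolding zL[OF r] by (simp add: z_def[abs_def])
      show "z r \<in> D" by (rule zD[OF r])
    next
      have "continuous_on {s..t} (us k)" by (rule continuous_on_subset[OF a(2)]) (use s in auto)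
      then show "continuous_on {s..t} (\<lambda>r. G (z r))" 
        by (subst continuous_on_cong[OF refl, where g = "us k"]) (auto simp: zG)
      have "continuous_on {s..t} (ys k)" by (rule continuous_on_subset[OF c]) (use s in auto)
      moreover have "continuous_on {s..t} (\<lambda>r. K (T (r - s) w))"
        by (rule continuous_on_compose2[OF continuous_K_T[OF w], of "{s..t}" "\<lambda>r. r - s"])
          (auto intro: continuous_intros)
      ultimately have "continuous_on {s..t} (\<lambda>r. ys k r - K (T (r - s) w))"
        by (rule continuous_on_diff)
      then show "continuous_on {s..t} (\<lambda>r. K (z r))" 
        by (subst continuous_on_cong[OF refl, where g = "\<lambda>r. ys k r - K (T (r - s) w)"]) (auto simp: zK)
    qed
    also have "sqint {s..t} (\<lambda>r. G (z r)) = sqint {s..t} (us k)"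
      unfolding sqint_def using zG by (intro nn_integral_cong) simp
    finally have "ennreal ((norm (z t))\<^sup>2) \<le> ennreal ((norm (z s))\<^sup>2) + sqint {s..t} (us k)"
      by (rule order_trans[rotated]) simp
    then show ?thesis by (simp add: z_def)
  qed
  show ?thesis
  proof (rule LIMSEQ_le)
    show "(\<lambda>k. ennreal ((norm (xs k t - T (t - s) w))\<^sup>2)) \<longlonglongrightarrow> ennreal ((norm (x t - T (t - s) w))\<^sup>2)"
      using s st by (intro tendsto_ennrealI tendsto_power tendsto_norm tendsto_diff a(4) tendsto_const) auto
    show "(\<lambda>k. ennreal ((norm (xs k s - w))\<^sup>2) + sqint {s..t} (us k)) \<longlonglongrightarrow> ennreal ((norm (x s - w))\<^sup>2) + sqint {s..t} u"
      by (intro tendsto_add lim_u tendsto_ennrealI tendsto_power tendsto_norm tendsto_diff a(4) tendsto_const s)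
  qed (use step in blast)
qed

lemma state_tendsto_zero:
  assumes sol: "generalized_solution D G L K x u y" and u: "sqint {0..} u < \<infinity>" and stable: "strongly_stable T"
  shows "((\<lambda>t. norm (x t)) \<longlongrightarrow> 0) at_top"
proof (rule tendstoI)
  fix e :: real assume e: "e > 0"
  \<comment> \<open>Two squared errors of size \<open>d\<close>, one from moving \<open>x s\<close>
    into \<open>domA\<close> and one from the input energy after \<open>s\<close>, add up to
    \<open>(e/2)\<^sup>2\<close>. The other half of \<open>e\<close> is left for the decaying free
    orbit of \<open>w\<close>.\<close>
  define d where "d = e\<^sup>2 / 8"
  have d: "d > 0" using e by (simp add: d_def)
  have "L2_loc u" using sol by (simp add: generalized_solution_def)
  from sqint_tail[OF L2_loc_norm_measurable[OF this] u]
  have "\<forall>\<^sub>F n in sequentially. sqint {real n..} u < ennreal d"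
    using d by (intro order_tendstoD(2)[of _ 0]) auto
  then obtain n where n: "sqint {real n..} u < ennreal d" by (auto simp: eventually_sequentially)
  define s where "s = real n"
  obtain w where w: "w \<in> domA" "dist w (x s) < sqrt d" using dom_dense[of "sqrt d" "x s"] d by auto
  have "((\<lambda>t. norm (T t w)) \<longlongrightarrow> 0) at_top" using stable by (simp add: strongly_stable_def)
  moreover have "LIM t at_top. t - s :> at_top"
    using filterlim_tendsto_add_at_top[OF tendsto_const[of "-s"] filterlim_ident] by simp
  ultimately have "((\<lambda>t. norm (T (t - s) w)) \<longlongrightarrow> 0) at_top" by (rule filterlim_compose)
  then have "\<forall>\<^sub>F t in at_top. norm (T (t - s) w) < e / 2"
    using e by (intro order_tendstoD(2)[of _ 0]) auto
  then show "\<forall>\<^sub>F t in at_top. dist (norm (x t)) 0 < e"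
    using eventually_ge_at_top[of s]
  proof eventually_elim
    case (elim t)
    have "(norm (x s - w))\<^sup>2 \<le> (sqrt d)\<^sup>2"
      using w(2) by (intro power_mono) (auto simp: dist_norm norm_minus_commute)
    then have ws: "(norm (x s - w))\<^sup>2 \<le> d" using d by simp
    have "sqint {s..t} u \<le> sqint {real n..} u" by (rule sqint_mono_set) (auto simp: s_def)
    then have "ennreal ((norm (x t - T (t - s) w))\<^sup>2) \<le> ennreal d + ennreal d"
      using distance_to_free_trajectory[OF sol w(1) _ elim(2)] n ws
      by (intro order_trans[OF distance_to_free_trajectory[OF sol w(1) _ elim(2)]] add_mono) (auto simp: s_def ennreal_leI)
    then have "(norm (x t - T (t - s) w))\<^sup>2 \<le> (e / 2)\<^sup>2"
      using d by (simp add: ennreal_plus[symmetric] d_def power_divide del: ennreal_plus)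
    then have "norm (x t - T (t - s) w) \<le> e / 2" by (rule power2_le_imp_le) (use e in simp)
    moreover have "norm (x t) \<le> norm (x t - T (t - s) w) + norm (T (t - s) w)"
      by (metis norm_triangle_sub add.commute)
    ultimately show ?case using elim(1) by simp
  qed
qed

text \<open>Let the final time of the energy balance tend to infinity; the term of the final state
  vanishes. Finiteness of the output energy is part of the result.\<close>

lemma energy_preserving_cost:
  assumes sol: "generalized_solution D G L K x u y" and u: "sqint {0..} u < \<infinity>" and stable: "strongly_stable T"
    and pres: "scattering_energy_preserving D G L K"
  shows "sqint {0..} y = ennreal ((norm (x 0))\<^sup>2) + sqint {0..} u"
proof -
  have "L2_loc u" "L2_loc y" using sol by (auto simp: generalized_solution_def)
  then have lim: "(\<lambda>n. sqint {0..real n} u) \<longlonglongrightarrow> sqint {0..} u" "(\<lambda>n. sqint {0..real n} y) \<longlonglongrightarrow> sqint {0..} y"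
    by (auto intro!: sqint_Ici L2_loc_norm_measurable)
  have "(\<lambda>n. norm (x (real n))) \<longlonglongrightarrow> 0"
    by (rule filterlim_compose[OF state_tendsto_zero[OF sol u stable] filterlim_real_sequentially])
  then have "(\<lambda>n. ennreal ((norm (x (real n)))\<^sup>2) + sqint {0..real n} y) \<longlonglongrightarrow> ennreal (0\<^sup>2) + sqint {0..} y"
    by (intro tendsto_add tendsto_ennrealI tendsto_power lim)
  moreover have "(\<lambda>n. ennreal ((norm (x 0))\<^sup>2) + sqint {0..real n} u) \<longlonglongrightarrow> ennreal ((norm (x 0))\<^sup>2) + sqint {0..} u"
    by (intro tendsto_add lim tendsto_const)
  ultimately show ?thesis
    using generalized_solution_energy[OF sol _ pres] LIMSEQ_unique by fastforce
qed

end

section \<open>The optimal cost\<close>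

context passive_node
begin

lemma optimal_cost_le:
  assumes "generalized_solution D G L K x u y" "x 0 = x0" "L2_on {0..} u"
  shows "optimal_cost D G L K x0 \<le> sqint {0..} u + sqint {0..} y"
proof -
  have loc: "L2_loc u" "L2_loc y" using assms(1) by (auto simp: generalized_solution_def)
  have "optimal_cost D G L K x0 \<le> cost D G L K x0 u"
    unfolding optimal_cost_def using assms(3) by (intro INF_lower) simp
  also have "\<dots> \<le> sqint {0..} u + sqint {0..} y"
    unfolding cost_def nn_integral_cost[OF loc, symmetric] using assms(1,2) by (intro Inf_lower) blast
  finally show ?thesis .
qed

text \<open>An infimum is strictly below \<open>c\<close> exactly when some element is. Costs are
  therefore compared through individual solutions, without uniqueness of the output for a given
  input.\<close>

lemma cost_less_iff:
  "cost D G L K x0 u < c \<longleftrightarrow>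
    (\<exists>x y. generalized_solution D G L K x u y \<and> x 0 = x0 \<and> sqint {0..} u + sqint {0..} y < c)"
proof -
  define I where "I y = (\<integral>\<^sup>+ t. ennreal ((norm (u t))\<^sup>2 + (norm (y t))\<^sup>2) \<partial>lebesgue_on {0..})" for y :: "real \<Rightarrow> 'y"
  have "I y = sqint {0..} u + sqint {0..} y" if "generalized_solution D G L K x u y" for x y
    unfolding I_def using that by (intro nn_integral_cost) (auto simp: generalized_solution_def)
  then have "{I y |x y. generalized_solution D G L K x u y \<and> x 0 = x0} =
      {sqint {0..} u + sqint {0..} y |x y. generalized_solution D G L K x u y \<and> x 0 = x0}"
    by (intro Collect_cong) metis
  then show ?thesis
    unfolding cost_def I_def[symmetric] Inf_less_iff by auto
qed

lemma optimal_cost_lessE: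
  assumes "optimal_cost D G L K x0 < c"
  obtains x u y where "generalized_solution D G L K x u y" "x 0 = x0" "L2_on {0..} u"
    "sqint {0..} u + sqint {0..} y < c"
  using assms unfolding optimal_cost_def INF_less_iff cost_less_iff by blast

lemma cost_zero_input_le:
  assumes "AE t in lebesgue_on {0..}. u t = 0"
  shows "cost D G L K x0 u \<le> ennreal ((norm x0)\<^sup>2)"
proof (rule ccontr)
  assume "\<not> ?thesis"
  moreover obtain y where y: "generalized_solution D G L K (\<lambda>t. T t x0) u y" "sqint {0..} y \<le> ennreal ((norm x0)\<^sup>2)"
    using zero_input_solution[OF assms] by blast
  ultimately have "sqint {0..} y < cost D G L K x0 u" by (simp add: not_le le_less_trans)
  then have "cost D G L K x0 u < cost D G L K x0 u"
    using y(1) sqint_cong_AE[OF assms] by (subst cost_less_iff) (auto intro!: exI[of _ "\<lambda>t. T t x0"])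
  then show False by simp
qed

lemma finite_cost: "finite_cost_condition D G L K"
  unfolding finite_cost_condition_def
proof
  fix x0
  have "cost D G L K x0 (\<lambda>t. 0) \<le> ennreal ((norm x0)\<^sup>2)" by (rule cost_zero_input_le) simp
  then show "\<exists>u. cost D G L K x0 u < \<infinity>" by (intro exI[of _ "\<lambda>t. 0"]) (simp add: le_less_trans)
qed

lemma optimal_cost_le_norm: "optimal_cost D G L K x0 \<le> ennreal ((norm x0)\<^sup>2)"
proof -
  have "optimal_cost D G L K x0 \<le> cost D G L K x0 (\<lambda>t. 0)"
    unfolding optimal_cost_def by (intro INF_lower) (simp add: L2_on_zero)
  also have "\<dots> \<le> ennreal ((norm x0)\<^sup>2)" by (rule cost_zero_input_le) simp
  finally show ?thesis .
qed

text \<open>The quadratic form of the operator to be constructed. It is real-valued to fit the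
  Jordan-von Neumann argument; \<open>enn2real\<close> loses nothing, since the optimal cost is
  bounded by the squared norm.\<close>

definition value_form :: "'x \<Rightarrow> real" where "value_form x0 = enn2real (optimal_cost D G L K x0)"

lemma optimal_cost_eq: "optimal_cost D G L K x0 = ennreal (value_form x0)"
  using optimal_cost_le_norm[of x0] by (simp add: value_form_def less_top[symmetric] top_unique) (metis ennreal_enn2real_if top_unique ennreal_neq_top)

lemma value_form_nonneg: "0 \<le> value_form x0" by (simp add: value_form_def)

lemma value_form_le: "value_form x0 \<le> (norm x0)\<^sup>2"
  using optimal_cost_le_norm[of x0] by (simp add: optimal_cost_eq)

lemma near_optimal:
  assumes "e > 0"
  obtains x u y where "generalized_solution D G L K x u y" "x 0 = x0" "L2_on {0..} u"
    "sqint {0..} u + sqint {0..} y \<le> ennreal (value_form x0 + e)"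
proof -
  have "optimal_cost D G L K x0 < ennreal (value_form x0 + e)"
    using assms value_form_nonneg[of x0] by (simp add: optimal_cost_eq ennreal_less_iff)
  then show thesis by (rule optimal_cost_lessE) (rule that, assumption+, rule less_imp_le)
qed

lemma value_form_scaleC_le: "value_form (c *\<^sub>C x0) \<le> (cmod c)\<^sup>2 * value_form x0"
proof (rule field_le_epsilon)
  fix e :: real assume e: "e > 0"
  \<comment> \<open>Adding 1 to the denominator allows \<open>c = 0\<close>.\<close>
  define d where "d = e / ((cmod c)\<^sup>2 + 1)"
  have pos: "(cmod c)\<^sup>2 + 1 > 0" by (simp add: add_nonneg_pos)
  have d: "d > 0" using e pos by (simp add: d_def)
  obtain x u y where s: "generalized_solution D G L K x u y" "x 0 = x0" "L2_on {0..} u"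
    "sqint {0..} u + sqint {0..} y \<le> ennreal (value_form x0 + d)"
    by (rule near_optimal[OF d, of x0])
  have loc: "L2_loc u" "L2_loc y" using s(1) by (auto simp: generalized_solution_def)
  note s1 = generalized_solution_lincomb[OF s(1) s(1), of c 0]
  have "optimal_cost D G L K (c *\<^sub>C x0) \<le> sqint {0..} (\<lambda>t. c *\<^sub>C u t) + sqint {0..} (\<lambda>t. c *\<^sub>C y t)"
    using s1 L2_on_lincomb[OF s(3) s(3), of c 0] s(2) by (intro optimal_cost_le[where x = "\<lambda>t. c *\<^sub>C x t"]) auto
  also have "\<dots> = ennreal ((cmod c)\<^sup>2) * (sqint {0..} u + sqint {0..} y)"
    using loc by (simp add: sqint_scaleC L2_loc_norm_measurable distrib_left)
  also have "\<dots> \<le> ennreal ((cmod c)\<^sup>2) * ennreal (value_form x0 + d)"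
    by (intro mult_left_mono s(4)) simp
  also have "\<dots> = ennreal ((cmod c)\<^sup>2 * (value_form x0 + d))" by (simp add: ennreal_mult')
  finally have "value_form (c *\<^sub>C x0) \<le> (cmod c)\<^sup>2 * (value_form x0 + d)"
    using value_form_nonneg[of x0] d by (simp add: optimal_cost_eq)
  moreover have "(cmod c)\<^sup>2 * d \<le> ((cmod c)\<^sup>2 + 1) * d" using d by (intro mult_right_mono) auto
  moreover have "((cmod c)\<^sup>2 + 1) * d = e" using pos by (simp add: d_def)
  ultimately show "value_form (c *\<^sub>C x0) \<le> (cmod c)\<^sup>2 * value_form x0 + e" by (simp add: algebra_simps)
qed

text \<open>For nonzero \<open>c\<close> the reverse inequality is the proved one for
  \<open>inverse c\<close> at \<open>c *\<^sub>C x0\<close>.\<close>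

lemma value_form_scaleC: "value_form (c *\<^sub>C x0) = (cmod c)\<^sup>2 * value_form x0"
proof (cases "c = 0")
  case True
  then show ?thesis using value_form_scaleC_le[of c x0] value_form_nonneg[of "c *\<^sub>C x0"] by simp
next
  case False
  have "value_form x0 \<le> (cmod (inverse c))\<^sup>2 * value_form (c *\<^sub>C x0)"
    using value_form_scaleC_le[of "inverse c" "c *\<^sub>C x0"] False by (simp add: scaleC_scaleC)
  then have "(cmod c)\<^sup>2 * value_form x0 \<le> value_form (c *\<^sub>C x0)"
    unfolding norm_inverse power_inverse using False by (simp add: field_simps)
  then show ?thesis using value_form_scaleC_le[of c x0] by simp
qed

lemma value_form_parallelogram_le: "value_form (x0 + z0) + value_form (x0 - z0) \<le> 2 * value_form x0 + 2 * value_form z0"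
proof (rule field_le_epsilon)
  fix e :: real assume e: "e > 0"
  \<comment> \<open>Each of the two near-optimal solutions enters with a factor 2, so slacks of
    \<open>e / 4\<close> add up to \<open>e\<close>.\<close>
  then have e4: "e / 4 > 0" by simp
  obtain x u y where s: "generalized_solution D G L K x u y" "x 0 = x0" "L2_on {0..} u"
    "sqint {0..} u + sqint {0..} y \<le> ennreal (value_form x0 + e / 4)"
    by (rule near_optimal[OF e4, of x0])
  obtain z v w where r: "generalized_solution D G L K z v w" "z 0 = z0" "L2_on {0..} v"
    "sqint {0..} v + sqint {0..} w \<le> ennreal (value_form z0 + e / 4)"
    by (rule near_optimal[OF e4, of z0])
  have sum: "generalized_solution D G L K (\<lambda>t. x t + z t) (\<lambda>t. u t + v t) (\<lambda>t. y t + w t)"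
    "L2_on {0..} (\<lambda>t. u t + v t)"
    using generalized_solution_lincomb[OF s(1) r(1), of 1 1] L2_on_lincomb[OF s(3) r(3), of 1 1] by simp_all
  have diff: "generalized_solution D G L K (\<lambda>t. x t - z t) (\<lambda>t. u t - v t) (\<lambda>t. y t - w t)"
    "L2_on {0..} (\<lambda>t. u t - v t)"
    using generalized_solution_lincomb[OF s(1) r(1), of 1 "-1"] L2_on_lincomb[OF s(3) r(3), of 1 "-1"]
    by (simp_all add: scaleC_minus_one)
  have m: "(\<lambda>t. norm (u t)) \<in> borel_measurable (lebesgue_on {0..})" "(\<lambda>t. norm (y t)) \<in> borel_measurable (lebesgue_on {0..})"
    if "generalized_solution D G L K x u y" for x u y
    using that by (auto simp: generalized_solution_def intro: L2_loc_norm_measurable)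
  have "ennreal (value_form (x0 + z0) + value_form (x0 - z0)) = optimal_cost D G L K (x0 + z0) + optimal_cost D G L K (x0 - z0)"
    by (simp add: optimal_cost_eq value_form_nonneg)
  also have "\<dots> \<le> (sqint {0..} (\<lambda>t. u t + v t) + sqint {0..} (\<lambda>t. y t + w t))
      + (sqint {0..} (\<lambda>t. u t - v t) + sqint {0..} (\<lambda>t. y t - w t))"
    using s(2) r(2) by (intro add_mono optimal_cost_le[OF sum(1) _ sum(2)] optimal_cost_le[OF diff(1) _ diff(2)]) auto
  also have "\<dots> = (sqint {0..} (\<lambda>t. u t + v t) + sqint {0..} (\<lambda>t. u t - v t))
      + (sqint {0..} (\<lambda>t. y t + w t) + sqint {0..} (\<lambda>t. y t - w t))"
    by (simp add: add_ac)
  also have "\<dots> = (2 * sqint {0..} u + 2 * sqint {0..} v) + (2 * sqint {0..} y + 2 * sqint {0..} w)"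
    by (simp only: sqint_parallelogram[OF m(1)[OF s(1)] m(1)[OF r(1)] m(1)[OF sum(1)] m(1)[OF diff(1)]]
        sqint_parallelogram[OF m(2)[OF s(1)] m(2)[OF r(1)] m(2)[OF sum(1)] m(2)[OF diff(1)]])
  also have "\<dots> = 2 * (sqint {0..} u + sqint {0..} y) + 2 * (sqint {0..} v + sqint {0..} w)"
    by (simp add: distrib_left add_ac)
  also have "\<dots> \<le> 2 * ennreal (value_form x0 + e / 4) + 2 * ennreal (value_form z0 + e / 4)"
    by (intro add_mono mult_left_mono s(4) r(4)) simp_all
  also have "\<dots> = ennreal (2 * (value_form x0 + e / 4) + 2 * (value_form z0 + e / 4))"
  proof -
    have "2 * ennreal r = ennreal (2 * r)" if "r \<ge> 0" for r using that ennreal_mult[of 2 r] by simp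
    then show ?thesis
      using value_form_nonneg[of x0] value_form_nonneg[of z0] e by (simp add: ennreal_plus[symmetric] del: ennreal_plus)
  qed
  finally have "value_form (x0 + z0) + value_form (x0 - z0) \<le> 2 * (value_form x0 + e / 4) + 2 * (value_form z0 + e / 4)"
    using value_form_nonneg[of x0] value_form_nonneg[of z0] e by (subst (asm) ennreal_le_iff) auto
  then show "value_form (x0 + z0) + value_form (x0 - z0) \<le> 2 * value_form x0 + 2 * value_form z0 + e" by simp
qed

text \<open>The reverse inequality is the proved one at \<open>x0 + z0\<close> and
  \<open>x0 - z0\<close>, whose sum and difference are doubled vectors; homogeneity supplies the
  factor 4.\<close>

lemma value_form_parallelogram: "value_form (x0 + z0) + value_form (x0 - z0) = 2 * value_form x0 + 2 * value_form z0"
proof (rule antisym[OF value_form_parallelogram_le])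
  have "value_form (2 *\<^sub>R x) = 4 * value_form x" for x
    using value_form_scaleC[of "complex_of_real 2" x] by (simp only: scaleC_of_real) simp
  then show "2 * value_form x0 + 2 * value_form z0 \<le> value_form (x0 + z0) + value_form (x0 - z0)"
    using value_form_parallelogram_le[of "x0 + z0" "x0 - z0"] by (simp add: scaleR_2)
qed

lemma optimal_cost_operator_iff:
  "optimal_cost_operator D G L K P \<longleftrightarrow>
    bounded_clinear P \<and> (\<forall>x z. cinner (P x) z = cinner x (P z)) \<and> (\<forall>x. Re (cinner x (P x)) = value_form x)"
  by (simp add: optimal_cost_operator_def optimal_cost_eq value_form_nonneg)

lemma ex1_optimal_cost_operator: "\<exists>!P. optimal_cost_operator D G L K P"
proof (rule ex_ex1I)
  show "\<exists>P. optimal_cost_operator D G L K P"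
    unfolding optimal_cost_operator_iff
    by (rule quadratic_form_operator[OF value_form_parallelogram value_form_scaleC value_form_nonneg value_form_le])
next
  fix P Q assume "optimal_cost_operator D G L K P" "optimal_cost_operator D G L K Q"
  then show "P = Q" unfolding optimal_cost_operator_iff by (intro selfadjoint_eqI) auto
qed

section \<open>The energy preserving case with a strongly stable semigroup\<close>

context
  assumes pres: "scattering_energy_preserving D G L K" and stable: "strongly_stable T"
begin

text \<open>The output returns the initial energy and all of the input energy, which the cost has
  already charged once. Any nonzero input is thus pure loss.\<close>

lemma total_cost:
  assumes "generalized_solution D G L K x u y" "x 0 = x0" "L2_on {0..} u"
  shows "sqint {0..} u + sqint {0..} y = ennreal ((norm x0)\<^sup>2) + 2 * sqint {0..} u"
proof -
  have "sqint {0..} u < \<infinity>" using assms(3) by (simp add: L2_on_def sqint_def)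
  from energy_preserving_cost[OF assms(1) this stable pres] show ?thesis
    by (simp add: assms(2) mult_2 add_ac)
qed

lemma optimal_cost_eq_norm: "optimal_cost D G L K x0 = ennreal ((norm x0)\<^sup>2)"
proof (rule antisym[OF optimal_cost_le_norm], rule ccontr)
  assume "\<not> ennreal ((norm x0)\<^sup>2) \<le> optimal_cost D G L K x0"
  then have "optimal_cost D G L K x0 < ennreal ((norm x0)\<^sup>2)" by simp
  then obtain x u y where "generalized_solution D G L K x u y" "x 0 = x0" "L2_on {0..} u"
    "sqint {0..} u + sqint {0..} y < ennreal ((norm x0)\<^sup>2)"
    by (rule optimal_cost_lessE)
  then have "ennreal ((norm x0)\<^sup>2) + 2 * sqint {0..} u < ennreal ((norm x0)\<^sup>2)"
    using total_cost by metis
  then show False by (meson le_iff_add not_less)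
qed

lemma optimal_cost_operator_identity:
  assumes "optimal_cost_operator D G L K P"
  shows "P = (\<lambda>x. x)"
proof (rule selfadjoint_eqI)
  show "bounded_clinear P" "cinner (P x) z = cinner x (P z)" for x z
    using assms by (auto simp: optimal_cost_operator_def)
  show "bounded_clinear (\<lambda>x::'x. x)"
    by (auto simp: bounded_clinear_def clinear_on_def intro: exI[of _ 1])
  have "value_form x = (norm x)\<^sup>2" for x by (simp add: value_form_def optimal_cost_eq_norm)
  then show "Re (cinner x (P x)) = Re (cinner x x)" for x
    using assms by (simp add: optimal_cost_operator_iff cinner_self)
qed simp

text \<open>By \<open>total_cost\<close>, every solution driven by \<open>u\<close> costs the
  minimum plus \<open>2 * sqint {0..} u\<close>; optimality forces this excess to vanish.\<close>

lemma optimal_control_iff: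
  "optimal_control D G L K x0 u \<longleftrightarrow> (AE t in lebesgue_on {0..}. u t = 0)"
proof
  assume u0: "AE t in lebesgue_on {0..}. u t = 0"
  have L2: "L2_on {0..} u"
    unfolding L2_on_def sqint_def[symmetric]
    using sqint_cong_AE[OF u0] strongly_measurable_AE_zero[OF u0] by simp
  have "optimal_cost D G L K x0 \<le> cost D G L K x0 u"
    unfolding optimal_cost_def using L2 by (intro INF_lower) simp
  then show "optimal_control D G L K x0 u"
    using cost_zero_input_le[OF u0, of x0] L2 by (simp add: optimal_control_def optimal_cost_eq_norm)
next
  assume "optimal_control D G L K x0 u"
  then have L2: "L2_on {0..} u" and c: "cost D G L K x0 u = ennreal ((norm x0)\<^sup>2)"
    by (auto simp: optimal_control_def optimal_cost_eq_norm)
  have m: "(\<lambda>t. norm (u t)) \<in> borel_measurable (lebesgue_on {0..})"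
    using L2 by (intro strongly_measurable_norm) (auto simp: L2_on_def)
  have "sqint {0..} u = 0"
  proof (rule ccontr)
    assume "sqint {0..} u \<noteq> 0"
    then have "0 < 2 * sqint {0..} u" by (simp add: ennreal_zero_less_mult_iff zero_less_iff_neq_zero)
    \<comment> \<open>A cost strictly below this value produces a single solution below it, although
      \<open>total_cost\<close> assigns exactly this value to every solution with input
      \<open>u\<close>. Strictness uses that the squared norm is finite.\<close>
    then have "cost D G L K x0 u < ennreal ((norm x0)\<^sup>2) + 2 * sqint {0..} u"
      unfolding c using ennreal_add_left_cancel_less[of "ennreal ((norm x0)\<^sup>2)" 0] by simp
    then obtain x y where "generalized_solution D G L K x u y" "x 0 = x0"
      "sqint {0..} u + sqint {0..} y < ennreal ((norm x0)\<^sup>2) + 2 * sqint {0..} u"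
      unfolding cost_less_iff by blast
    then show False using total_cost[OF _ _ L2] by fastforce
  qed
  then have "AE t in lebesgue_on {0..}. ennreal ((norm (u t))\<^sup>2) = 0"
    unfolding sqint_def using m by (subst (asm) nn_integral_0_iff_AE) auto
  then show "AE t in lebesgue_on {0..}. u t = 0" by eventually_elim simp
qed

text \<open>For the identity operator the two inner products add up to twice a real part, which
  energy preservation replaces by the input term minus the output term; only twice the input term
  remains.\<close>

lemma Riccati_identity: "boundary_node_Riccati D G L K (\<lambda>x. x) (\<lambda>x. sqrt 2 *\<^sub>R G x)"
  unfolding boundary_node_Riccati_def
proof
  fix x assume "x \<in> D"
  then have "2 * Re (cinner (L x) x) = (norm (G x))\<^sup>2 - (norm (K x))\<^sup>2"
    using pres by (simp add: scattering_energy_preserving_def)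
  moreover have "cinner (L x) x + cinner x (L x) = complex_of_real (2 * Re (cinner (L x) x))"
    by (subst cinner_commute[of x "L x"]) (simp add: complex_eq_iff)
  ultimately show "cinner (L x) x + cinner x (L x) + complex_of_real ((norm (G x))\<^sup>2)
      + complex_of_real ((norm (K x))\<^sup>2) = complex_of_real ((norm (sqrt 2 *\<^sub>R G x))\<^sup>2)"
    by (simp add: power_mult_distrib)
qed

end

end

theorem theorem6:
  fixes D :: "'x::complex_hilbert set"
    and G :: "'x \<Rightarrow> 'u::complex_hilbert"
    and L :: "'x \<Rightarrow> 'x"
    and K :: "'x \<Rightarrow> 'y::complex_hilbert"
  assumes "boundary_node D G L K"
    and "scattering_passive D G L K"
  shows "finite_cost_condition D G L K \<and>
    (\<exists>!P. optimal_cost_operator D G L K P) \<and>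
    (\<forall>P. optimal_cost_operator D G L K P \<longrightarrow>
       (\<forall>x0. Re (cinner x0 (P x0)) \<le> (norm x0)\<^sup>2)) \<and>
    (scattering_energy_preserving D G L K \<and>
     (\<exists>T. generates_semigroup {x\<in>D. G x = 0} L T \<and> strongly_stable T) \<longrightarrow>
       (\<forall>P. optimal_cost_operator D G L K P \<longrightarrow> P = (\<lambda>x. x)) \<and>
       (\<forall>x0 u. optimal_control D G L K x0 u \<longleftrightarrow> (AE t in lebesgue_on {0..}. u t = 0)) \<and>
       boundary_node_Riccati D G L K (\<lambda>x. x) (\<lambda>x. sqrt 2 *\<^sub>R G x))"
proof -
  obtain T where "generates_semigroup {x\<in>D. G x = 0} L T"
    using assms(1) by (auto simp: boundary_node_def)
  then interpret passive_node D G L K T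
    using assms by unfold_locales
  have preserving: "(\<forall>P. optimal_cost_operator D G L K P \<longrightarrow> P = (\<lambda>x. x)) \<and>
       (\<forall>x0 u. optimal_control D G L K x0 u \<longleftrightarrow> (AE t in lebesgue_on {0..}. u t = 0)) \<and>
       boundary_node_Riccati D G L K (\<lambda>x. x) (\<lambda>x. sqrt 2 *\<^sub>R G x)"
    if pres: "scattering_energy_preserving D G L K"
      and S: "generates_semigroup {x\<in>D. G x = 0} L S" "strongly_stable S" for S
  proof -
    \<comment> \<open>The stability hypothesis comes with its own semigroup; instantiating the
      locale with it avoids identifying it with \<open>T\<close>.\<close>
    interpret S: passive_node D G L K S
      using assms S(1) by unfold_locales
    show ?thesis
      using S.optimal_cost_operator_identity[OF pres S(2)] S.optimal_control_iff[OF pres S(2)]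
        S.Riccati_identity[OF pres S(2)] by blast
  qed
  have "Re (cinner x0 (P x0)) \<le> (norm x0)\<^sup>2" if "optimal_cost_operator D G L K P" for P x0
    using that value_form_le[of x0] by (simp add: optimal_cost_operator_iff)
  then show ?thesis
    using finite_cost ex1_optimal_cost_operator preserving by blast
qed

end
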